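(* Let $k\geq 1$ be a fixed integer, let $\varepsilon>0$, and let $p=p(n)$ satisfy $$\left(\frac{2\ln n+\omega(1)}{n^{k+1}}\right)^{1/(k+2)}=p<\left(\left(\frac{1}{k+1}-\varepsilon\right)\frac{\ln n}{n^k}\right)^{1/(k+1)}.$$ Then there is no set $\mathcal{Q}=\mathcal{Q}(n)\subset\binom{[n]}{2}$ of size at most $$\frac{1}{8(k+1)^2n^{k-2}p^k}\,e^{n^kp^{k+1}}\ln n$$ such that whp $G_n\sim G(n,p)$ is $\mathcal{Q}$-reconstructible.
   Context: $[n]:=\{1,\ldots,n\}$. $G(n,p)$ is the binomial random graph on vertex set $[n]$: each pair of vertices is an edge independently with probability $p$. "Whp" (with high probability) means with probability tending to $1$ as $n\to\infty$. $\omega(1)$ stands for a function of $n$ tending to infinity as $n\to\infty$. The sets $\mathcal{Q}(n)$ are deterministic (they do not depend on the random graph). For a graph $G$ on $[n]$, $d_G(x,y)$ is the graph distance between $x$ and $y$ in $G$ ($\infty$ if they lie in different components). A graph $G$ on $[n]$ is $\mathcal{Q}$-reconstructible, for a set $\mathcal{Q}\subset\binom{[n]}{2}$ of pairs of vertices, if for every graph $G'$ on $[n]$ such that $d_{G'}(x,y)=d_G(x,y)$ for all $\{x,y\}\in\mathcal{Q}$, we have $G'=G$. *)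

theory Defs
  imports "HOL-Probability.Probability" "HOL-Library.Extended_Nat"
begin

text \<open>A simple graph on the vertex set \<open>{1..n}\<close> is represented by its edge set, that is, by a
  subset of \<open>vertex_pairs n\<close>.\<close>

definition vertex_pairs :: "nat \<Rightarrow> nat set set" where
  "vertex_pairs n = {e. e \<subseteq> {1..n} \<and> card e = 2}"

definition graph_path :: "nat set set \<Rightarrow> nat \<Rightarrow> nat list \<Rightarrow> nat \<Rightarrow> bool" where
  "graph_path G x xs y \<longleftrightarrow>
     xs \<noteq> [] \<and> hd xs = x \<and> last xs = y \<and> distinct xs \<and> successively (\<lambda>u v. {u, v} \<in> G) xs"

text \<open>The infimum of the empty set in \<^typ>\<open>enat\<close> is \<open>\<infinity>\<close>, so vertices in different components are at
  distance \<open>\<infinity>\<close>.\<close>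

definition graph_dist :: "nat set set \<Rightarrow> nat \<Rightarrow> nat \<Rightarrow> enat" where
  "graph_dist G x y = (INF xs\<in>{xs. graph_path G x xs y}. enat (length xs - 1))"

definition reconstructible :: "nat \<Rightarrow> nat set set \<Rightarrow> nat set set \<Rightarrow> bool" where
  "reconstructible n Q G \<longleftrightarrow>
     (\<forall>G'\<subseteq>vertex_pairs n.
        (\<forall>x y. {x, y} \<in> Q \<longrightarrow> graph_dist G' x y = graph_dist G x y) \<longrightarrow> G' = G)"

text \<open>\<^const>\<open>bernoulli_pmf\<close> clamps its parameter to \<open>[0, 1]\<close>, so this is \<open>G(n,p)\<close> for \<open>0 \<le> p \<le> 1\<close>.\<close>

definition binomial_random_graph :: "nat \<Rightarrow> real \<Rightarrow> nat set set pmf" where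
  "binomial_random_graph n p =
     map_pmf (\<lambda>f. {e \<in> vertex_pairs n. f e})
       (Pi_pmf (vertex_pairs n) False (\<lambda>_. bernoulli_pmf p))"

end

theory Submission
  imports Defs "HOL-Real_Asymp.Real_Asymp"
begin

text \<open>Write \<open>d = n p\<close> and \<open>\<lambda> = n\<^sup>k p\<^bsup>k+1\<^esup> = p d\<^sup>k\<close>; the latter is roughly the mean number of paths of
  length \<open>k + 1\<close> between two given vertices. Adding a non-edge \<open>{x, y}\<close> to \<open>G\<close> changes the distance
  of a pair \<open>{u, v} \<in> Q\<close> only if \<open>d(u, x) + 1 + d(y, v) < d(u, v)\<close> (up to exchanging \<open>u\<close> and \<open>v\<close>). Such
  a pair is a witness of the non-edge, and a graph with an unwitnessed non-edge is not reconstructible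
  (\<open>not_reconstructible_if_unwitnessed\<close>). So it suffices that an unwitnessed non-edge exists with
  probability bounded away from \<open>0\<close>.

  By the lower bound on \<open>p\<close>, all pairs in \<open>Q\<close> are at distance at most \<open>k + 2\<close> with high probability
  (\<open>prob_not_all_close_le\<close>), hence a witness satisfies \<open>d(u, x) + d(v, y) \<le> k\<close>, and if equality holds it
  also satisfies \<open>d(u, v) > k + 1\<close>, an event of probability about \<open>exp (-\<lambda>)\<close>. For a fixed pair \<open>{x, y}\<close>
  there are on average about \<open>2 (k + 1) |Q| d\<^sup>k / n\<^sup>2\<close> ordered pairs from \<open>Q\<close> with
  \<open>d(u, x) + d(v, y) = k\<close>, so the assumed bound on \<open>|Q|\<close> makes the mean number of witnesses at most
  about \<open>ln n / (4 (k + 1))\<close>. The relevant events are positively correlated, and Harris' inequality turns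
  this into a lower bound \<open>n\<^bsup>-c\<^esup>\<close> for the probability that \<open>{x, y}\<close> has no witness. The argument gives
  \<open>c = 37 / (80 (k + 1))\<close>; the excess over \<open>20 / (80 (k + 1))\<close> pays for the crude estimates.

  This is applied to \<open>r\<close> disjoint pairs \<open>{x\<^sub>i, y\<^sub>i}\<close> of vertices of low degree in \<open>Q\<close>, with
  \<open>r\<close> about \<open>n\<^bsup>38/(80(k+1))\<^esup>\<close>. This exponent exceeds \<open>c\<close>, and it is less than \<open>1 / (2 (k + 1))\<close>,
  so that with high probability the \<open>2 r\<close> test vertices are pairwise at distance greater than \<open>k\<close>. Then
  the short paths that matter for the pair \<open>i\<close> use no other test vertex, and given the graph on the common
  part the pairs behave independently. Lemma \<open>amplification\<close> combines them: it needs only that for each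
  \<open>i\<close>, with probability bounded below over the common part, the conditional probability of success is at
  least \<open>n\<^bsup>-c\<^esup>\<close>.

  For \<open>\<lambda> \<le> 1/2\<close> the factor \<open>exp (-\<lambda>)\<close> can be given away: \<open>clear_small\<close> asks that no pair of \<open>Q\<close> at all
  satisfies \<open>d(u, x) + d(v, y) \<le> k\<close>, which says that the edges at \<open>x\<close> and \<open>y\<close> avoid a list of one- and
  two-element sets (\<open>prob_clear_small_ge\<close>). For \<open>\<lambda> > 1/2\<close> everything except the edges at \<open>y\<close> is exposed, and
  \<open>clear_large\<close> asks that these edges avoid a set of \<open>blocked\<close> vertices and hit the balls of radius \<open>k\<close>
  around the vertices \<open>u\<close> with \<open>{u, y} \<in> Q\<close> and \<open>d(u, x) = k\<close>. The set and the balls rarely overlap, so that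
  Harris' inequality applies again; each ball is missed with probability about
  \<open>exp (-\<lambda>)\<close>, and \<open>1 - t \<ge> exp (-2 t)\<close> holds for \<open>t\<close> up to \<open>7/10\<close>, which explains the threshold \<open>1/2\<close>
  (\<open>prob_clear_prob_ge\<close>). The factor \<open>exp (-\<lambda>)\<close>, the size of the balls and the bound on distances in
  \<open>Q\<close> all come from Janson's inequality for paths (\<open>prob_no_path_le\<close>).\<close>

section \<open>Random subsets and correlation inequalities\<close>

text \<open>The expectation of \<open>f\<close> on the random subset of the finite set \<open>E\<close> that contains
  each element independently with probability \<open>p\<close>. A finite sum is more convenient than a measure here:
  edge sets are split, restricted and conditioned upon all the time, and with sums this is elementary algebra.\<close>

definition bexp :: "real \<Rightarrow> 'a set \<Rightarrow> ('a set \<Rightarrow> real) \<Rightarrow> real" where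
  "bexp p E f = (\<Sum>G\<in>Pow E. p ^ card G * (1 - p) ^ card (E - G) * f G)"

lemma bexp_empty [simp]: "bexp p {} f = f {}"
  by (simp add: bexp_def)

lemma bexp_insert:
  assumes "finite E" "e \<notin> E"
  shows "bexp p (insert e E) f = (1 - p) * bexp p E f + p * bexp p E (\<lambda>G. f (insert e G))"
proof -
  have inj: "inj_on (insert e) (Pow E)"
    using assms(2) by (auto simp: inj_on_def)
  have disj: "Pow E \<inter> insert e ` Pow E = {}"
    using assms(2) by auto
  have 1: "p ^ card G * (1 - p) ^ card (insert e E - G) * f G
      = (1 - p) * (p ^ card G * (1 - p) ^ card (E - G) * f G)" if "G \<in> Pow E" for G
  proof -
    have "insert e E - G = insert e (E - G)" using that assms by auto
    then show ?thesis using assms by simp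
  qed
  have 2: "p ^ card (insert e G) * (1 - p) ^ card (insert e E - insert e G) * f (insert e G)
      = p * (p ^ card G * (1 - p) ^ card (E - G) * f (insert e G))" if "G \<in> Pow E" for G
  proof -
    have "insert e E - insert e G = E - G" using that assms by auto
    moreover have "card (insert e G) = Suc (card G)"
      using that assms by (meson Pow_iff card_insert_disjoint rev_finite_subset subsetD)
    ultimately show ?thesis by simp
  qed
  have "bexp p (insert e E) f
      = (\<Sum>G\<in>Pow E. p ^ card G * (1 - p) ^ card (insert e E - G) * f G)
      + (\<Sum>G\<in>insert e ` Pow E. p ^ card G * (1 - p) ^ card (insert e E - G) * f G)"
    unfolding bexp_def Pow_insert using assms disj by (intro sum.union_disjoint) auto
  also have "(\<Sum>G\<in>insert e ` Pow E. p ^ card G * (1 - p) ^ card (insert e E - G) * f G)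
      = (\<Sum>G\<in>Pow E. p * (p ^ card G * (1 - p) ^ card (E - G) * f (insert e G)))"
    unfolding sum.reindex[OF inj] o_def by (rule sum.cong[OF refl 2])
  also have "(\<Sum>G\<in>Pow E. p ^ card G * (1 - p) ^ card (insert e E - G) * f G)
      = (\<Sum>G\<in>Pow E. (1 - p) * (p ^ card G * (1 - p) ^ card (E - G) * f G))"
    by (rule sum.cong[OF refl 1])
  finally show ?thesis by (simp add: bexp_def sum_distrib_left)
qed

lemma bexp_cong:
  assumes "\<And>G. G \<subseteq> E \<Longrightarrow> f G = g G"
  shows "bexp p E f = bexp p E g"
  unfolding bexp_def by (rule sum.cong) (use assms in auto)

lemma bexp_const [simp]: "finite E \<Longrightarrow> bexp p E (\<lambda>_. c) = c"
proof (induction E rule: finite_induct)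
  case (insert e E)
  then show ?case by (simp add: bexp_insert algebra_simps)
qed simp

lemma bexp_add: "bexp p E (\<lambda>G. f G + g G) = bexp p E f + bexp p E g"
  by (simp add: bexp_def distrib_left sum.distrib)

lemma bexp_cmult: "bexp p E (\<lambda>G. c * f G) = c * bexp p E f"
  by (simp add: bexp_def sum_distrib_left algebra_simps)

lemma bexp_cmult_right: "bexp p E (\<lambda>G. f G * c) = bexp p E f * c"
  using bexp_cmult[of p E c f] by (simp add: mult.commute)

lemma bexp_uminus: "bexp p E (\<lambda>G. - f G) = - bexp p E f"
  using bexp_cmult[of p E "-1" f] by simp

lemma bexp_diff: "bexp p E (\<lambda>G. f G - g G) = bexp p E f - bexp p E g"
  using bexp_add[of p E f "\<lambda>G. - g G"] bexp_uminus[of p E g] by simp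

lemma bexp_sum: "bexp p E (\<lambda>G. \<Sum>i\<in>I. f i G) = (\<Sum>i\<in>I. bexp p E (f i))"
  unfolding bexp_def sum_distrib_left by (rule sum.swap)

lemma bexp_mono:
  assumes "0 \<le> p" "p \<le> 1" "\<And>G. G \<subseteq> E \<Longrightarrow> f G \<le> g G"
  shows "bexp p E f \<le> bexp p E g"
  unfolding bexp_def by (intro sum_mono mult_left_mono) (use assms in auto)

lemma bexp_nonneg:
  assumes "0 \<le> p" "p \<le> 1" "\<And>G. G \<subseteq> E \<Longrightarrow> 0 \<le> f G"
  shows "0 \<le> bexp p E f"
  unfolding bexp_def by (intro sum_nonneg mult_nonneg_nonneg) (use assms in auto)

lemma bexp_le_const:
  assumes "0 \<le> p" "p \<le> 1" "finite E" "\<And>G. G \<subseteq> E \<Longrightarrow> f G \<le> c"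
  shows "bexp p E f \<le> c"
  using bexp_mono[OF assms(1,2), of E f "\<lambda>_. c"] assms by simp

text \<open>Fubini: exposing \<open>E1\<close> first and \<open>E2\<close> afterwards. All conditioning below is done
  with this identity.\<close>

lemma bexp_union:
  assumes "finite E1" "finite E2" "E1 \<inter> E2 = {}"
  shows "bexp p (E1 \<union> E2) f = bexp p E1 (\<lambda>G1. bexp p E2 (\<lambda>G2. f (G1 \<union> G2)))"
  using assms
proof (induction E1 arbitrary: f rule: finite_induct)
  case (insert e E)
  have "bexp p (insert e E \<union> E2) f
      = (1 - p) * bexp p (E \<union> E2) f + p * bexp p (E \<union> E2) (\<lambda>G. f (insert e G))"
    using insert by (simp add: bexp_insert)
  then show ?case using insert by (simp add: bexp_insert)
qed simp

lemma bexp_restrict: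
  assumes "finite E" "E' \<subseteq> E"
  shows "bexp p E (\<lambda>G. f (G \<inter> E')) = bexp p E' f"
proof -
  have fin: "finite E'" "finite (E - E')" using assms finite_subset by auto
  have "E = E' \<union> (E - E')" using assms by auto
  then have "bexp p E (\<lambda>G. f (G \<inter> E')) =
      bexp p E' (\<lambda>G1. bexp p (E - E') (\<lambda>G2. f ((G1 \<union> G2) \<inter> E')))"
    using bexp_union[OF fin, of p "\<lambda>G. f (G \<inter> E')"] by auto
  also have "\<dots> = bexp p E' (\<lambda>G1. bexp p (E - E') (\<lambda>G2. f G1))"
    by (intro bexp_cong arg_cong[where f = f]) auto
  also have "\<dots> = bexp p E' f" using fin by simp
  finally show ?thesis .
qed

lemma bexp_superset:
  assumes "finite E" "F \<subseteq> E"
  shows "bexp p E (\<lambda>G. of_bool (F \<subseteq> G)) = p ^ card F"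
proof -
  have fF: "finite F" using assms finite_subset by auto
  have "bexp p F (\<lambda>G. of_bool (F \<subseteq> G)) = p ^ card F"
  proof -
    have "bexp p F (\<lambda>G. of_bool (F \<subseteq> G)) = (\<Sum>G\<in>Pow F. if G = F then p ^ card F else 0)"
      unfolding bexp_def by (rule sum.cong) auto
    then show ?thesis using fF by simp
  qed
  moreover have "bexp p E (\<lambda>G. of_bool (F \<subseteq> G)) = bexp p E (\<lambda>G. of_bool (F \<subseteq> G \<inter> F))"
    by (rule bexp_cong) auto
  ultimately show ?thesis
    using bexp_restrict[OF assms, of p "\<lambda>G. of_bool (F \<subseteq> G)"] by simp
qed

lemma bexp_superset_indep:
  assumes "finite E" "F \<subseteq> E"
  shows "bexp p E (\<lambda>G. of_bool (F \<subseteq> G) * g (G - F)) = p ^ card F * bexp p E (\<lambda>G. g (G - F))"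
proof -
  have fin: "finite F" "finite (E - F)" using assms finite_subset by auto
  have E: "F \<union> (E - F) = E" using assms by auto
  have eq: "(G1 \<union> G2) - F = G2" if "G1 \<subseteq> F" "G2 \<subseteq> E - F" for G1 G2 using that by auto
  have eq2: "F \<subseteq> G1 \<union> G2 \<longleftrightarrow> F \<subseteq> G1" if "G1 \<subseteq> F" "G2 \<subseteq> E - F" for G1 G2
    using that by auto
  have "bexp p E (\<lambda>G. of_bool (F \<subseteq> G) * g (G - F)) =
     bexp p F (\<lambda>G1. bexp p (E - F) (\<lambda>G2. of_bool (F \<subseteq> G1 \<union> G2) * g (G1 \<union> G2 - F)))"
    using bexp_union[OF fin, of p] E by simp
  also have "\<dots> = bexp p F (\<lambda>G1. bexp p (E - F) (\<lambda>G2. of_bool (F \<subseteq> G1) * g G2))"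
    by (intro bexp_cong) (simp add: eq eq2)
  also have "\<dots> = p ^ card F * bexp p (E - F) g"
    using fin by (simp add: bexp_cmult bexp_cmult_right bexp_superset)
  also have "bexp p (E - F) g = bexp p E (\<lambda>G. g (G - F))"
  proof -
    have "bexp p E (\<lambda>G. g (G - F)) = bexp p E (\<lambda>G. g (G \<inter> (E - F)))"
      by (intro bexp_cong arg_cong[where f = g]) auto
    then show ?thesis using bexp_restrict[OF assms(1), of "E - F" p g] by auto
  qed
  finally show ?thesis .
qed

text \<open>The generating function of a binomial variable; it yields the Chernoff bound for degrees.\<close>

lemma bexp_power_card:
  assumes "finite E" "F \<subseteq> E"
  shows "bexp p E (\<lambda>G. c ^ card (G \<inter> F)) = (1 - p + p * c) ^ card F"
proof -
  have fF: "finite F" using assms finite_subset by auto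
  have "bexp p F (\<lambda>G. c ^ card G) = (1 - p + p * c) ^ card F"
    using fF
  proof (induction F rule: finite_induct)
    case (insert e F)
    have "bexp p F (\<lambda>G. c ^ card (insert e G)) = bexp p F (\<lambda>G. c * c ^ card G)"
    proof (rule bexp_cong)
      fix G assume "G \<subseteq> F"
      then have "finite G" "e \<notin> G" using insert finite_subset by auto
      then show "c ^ card (insert e G) = c * c ^ card G" by simp
    qed
    then show ?case using insert by (simp add: bexp_insert bexp_cmult algebra_simps)
  qed simp
  then show ?thesis using bexp_restrict[OF assms, of p "\<lambda>G. c ^ card G"] by simp
qed

lemma bexp_disjoint:
  assumes "finite E" "F \<subseteq> E"
  shows "bexp p E (\<lambda>G. of_bool (G \<inter> F = {})) = (1 - p) ^ card F"
proof -
  have "bexp p E (\<lambda>G. of_bool (G \<inter> F = {})) = bexp p E (\<lambda>G. 0 ^ card (G \<inter> F))"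
  proof (rule bexp_cong)
    fix G assume "G \<subseteq> E"
    have "finite (G \<inter> F)" using assms finite_subset[of F E] by auto
    then show "of_bool (G \<inter> F = {}) = (0::real) ^ card (G \<inter> F)"
      by (simp add: power_0_left of_bool_def)
  qed
  then show ?thesis using bexp_power_card[OF assms, of p 0] by simp
qed

lemma bexp_markov:
  assumes "0 \<le> p" "p \<le> 1" "finite E" "0 < c" "\<And>G. G \<subseteq> E \<Longrightarrow> 0 \<le> X G"
  shows "bexp p E (\<lambda>G. of_bool (c \<le> X G)) \<le> bexp p E X / c"
proof -
  have "bexp p E (\<lambda>G. c * of_bool (c \<le> X G)) \<le> bexp p E X"
    by (rule bexp_mono) (use assms in auto)
  then show ?thesis using assms(4) by (simp add: bexp_cmult field_simps)
qed

text \<open>Induction on the ground set: conditioned on the new element both functions satisfy the inequality, and the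
  two conditional means of each function are ordered the same way, as in Chebyshev's sum inequality.\<close>

theorem harris_inequality:
  assumes "0 \<le> p" "p \<le> 1" "finite E"
    and "\<And>G G'. G \<subseteq> G' \<Longrightarrow> G' \<subseteq> E \<Longrightarrow> f G \<le> f G'"
    and "\<And>G G'. G \<subseteq> G' \<Longrightarrow> G' \<subseteq> E \<Longrightarrow> g G \<le> g G'"
  shows "bexp p E f * bexp p E g \<le> bexp p E (\<lambda>G. f G * g G)"
  using assms(3,4,5)
proof (induction E arbitrary: f g rule: finite_induct)
  case (insert e E)
  let ?f1 = "\<lambda>G. f (insert e G)" and ?g1 = "\<lambda>G. g (insert e G)"
  let ?a0 = "bexp p E f" and ?a1 = "bexp p E ?f1" and ?b0 = "bexp p E g" and ?b1 = "bexp p E ?g1"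
  have 0: "?a0 * ?b0 \<le> bexp p E (\<lambda>G. f G * g G)"
    by (rule insert.IH) (auto intro: insert.prems)
  have 1: "?a1 * ?b1 \<le> bexp p E (\<lambda>G. ?f1 G * ?g1 G)"
    by (rule insert.IH) (rule insert.prems; blast)+
  have a: "?a0 \<le> ?a1" and b: "?b0 \<le> ?b1"
    by (intro bexp_mono assms(1,2) insert.prems; blast)+
  have "((1 - p) * ?a0 + p * ?a1) * ((1 - p) * ?b0 + p * ?b1)
      = (1 - p) * (?a0 * ?b0) + p * (?a1 * ?b1) - p * (1 - p) * ((?a1 - ?a0) * (?b1 - ?b0))"
    by (simp add: algebra_simps)
  also have "\<dots> \<le> (1 - p) * (?a0 * ?b0) + p * (?a1 * ?b1)"
    using a b assms(1,2) by simp
  also have "\<dots> \<le> (1 - p) * bexp p E (\<lambda>G. f G * g G) + p * bexp p E (\<lambda>G. ?f1 G * ?g1 G)"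
    using 0 1 assms(1,2) by (intro add_mono mult_left_mono) auto
  finally show ?case using insert.hyps by (simp add: bexp_insert)
qed simp

lemma harris_decreasing:
  assumes "0 \<le> p" "p \<le> 1" "finite E"
    and "\<And>G G'. G \<subseteq> G' \<Longrightarrow> G' \<subseteq> E \<Longrightarrow> f G' \<le> f G"
    and "\<And>G G'. G \<subseteq> G' \<Longrightarrow> G' \<subseteq> E \<Longrightarrow> g G' \<le> g G"
  shows "bexp p E f * bexp p E g \<le> bexp p E (\<lambda>G. f G * g G)"
  using harris_inequality[OF assms(1-3), of "\<lambda>G. - f G" "\<lambda>G. - g G"] assms(4,5)
  by (simp add: bexp_uminus)

lemma harris_mixed:
  assumes "0 \<le> p" "p \<le> 1" "finite E"
    and "\<And>G G'. G \<subseteq> G' \<Longrightarrow> G' \<subseteq> E \<Longrightarrow> f G \<le> f G'"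
    and "\<And>G G'. G \<subseteq> G' \<Longrightarrow> G' \<subseteq> E \<Longrightarrow> g G' \<le> g G"
  shows "bexp p E (\<lambda>G. f G * g G) \<le> bexp p E f * bexp p E g"
  using harris_inequality[OF assms(1-3), of f "\<lambda>G. - g G"] assms(4,5)
  by (simp add: bexp_uminus)

text \<open>Avoiding each of a family of sets costs no more than if these events were independent, since they are all
  decreasing.\<close>

lemma harris_avoid:
  fixes E :: "'a set"
  assumes "0 \<le> p" "p \<le> 1" "finite E" "finite I" "\<And>i. i \<in> I \<Longrightarrow> F i \<subseteq> E"
  shows "(\<Prod>i\<in>I. 1 - p ^ card (F i)) \<le> bexp p E (\<lambda>G. of_bool (\<forall>i\<in>I. \<not> F i \<subseteq> G))"
  using assms(4,5)
proof (induction I rule: finite_induct)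
  case (insert i I)
  let ?f = "\<lambda>G. of_bool (\<not> F i \<subseteq> G) :: real" and ?g = "\<lambda>G. of_bool (\<forall>i\<in>I. \<not> F i \<subseteq> G) :: real"
  have Fi: "F i \<subseteq> E" using insert.prems by auto
  have "bexp p E ?f = bexp p E (\<lambda>G. 1 - of_bool (F i \<subseteq> G))"
    by (rule bexp_cong) auto
  also have "\<dots> = 1 - p ^ card (F i)"
    using bexp_superset[OF assms(3) Fi, of p] assms(3) by (simp add: bexp_diff)
  finally have f: "bexp p E ?f = 1 - p ^ card (F i)" .
  have "p ^ card (F i) \<le> 1" using assms by (simp add: power_le_one)
  then have "(\<Prod>i\<in>insert i I. 1 - p ^ card (F i)) \<le> bexp p E ?f * bexp p E ?g"
    using insert f by (simp add: mult_left_mono)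
  also have "\<dots> \<le> bexp p E (\<lambda>G. ?f G * ?g G)"
  proof (rule harris_decreasing)
    fix G G' :: "'a set" assume G: "G \<subseteq> G'"
    show "?f G' \<le> ?f G" "?g G' \<le> ?g G"
      using G by (simp_all add: of_bool_def) (meson order_trans)+
  qed (use assms in auto)
  also have "\<dots> = bexp p E (\<lambda>G. of_bool (\<forall>i\<in>insert i I. \<not> F i \<subseteq> G))"
    by (rule bexp_cong) auto
  finally show ?case .
qed (use assms in simp)

text \<open>The increasing counterpart of \<open>harris_avoid\<close>: hitting all sets of a family.\<close>

lemma harris_hit:
  fixes E :: "'a set"
  assumes "0 \<le> p" "p \<le> 1" "finite E" "finite I" "\<And>i. i \<in> I \<Longrightarrow> F i \<subseteq> E"
  shows "(\<Prod>i\<in>I. 1 - (1 - p) ^ card (F i)) \<le> bexp p E (\<lambda>G. of_bool (\<forall>i\<in>I. G \<inter> F i \<noteq> {}))"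
  using assms(4,5)
proof (induction I rule: finite_induct)
  case (insert i I)
  let ?f = "\<lambda>G. of_bool (G \<inter> F i \<noteq> {}) :: real" and ?g = "\<lambda>G. of_bool (\<forall>i\<in>I. G \<inter> F i \<noteq> {}) :: real"
  have Fi: "F i \<subseteq> E" using insert.prems by auto
  have "bexp p E ?f = bexp p E (\<lambda>G. 1 - of_bool (G \<inter> F i = {}))"
    by (rule bexp_cong) auto
  also have "\<dots> = 1 - (1 - p) ^ card (F i)"
    using bexp_disjoint[OF assms(3) Fi, of p] assms(3) by (simp add: bexp_diff)
  finally have f: "bexp p E ?f = 1 - (1 - p) ^ card (F i)" .
  have "(1 - p) ^ card (F i) \<le> 1" using assms by (simp add: power_le_one)
  then have "(\<Prod>i\<in>insert i I. 1 - (1 - p) ^ card (F i)) \<le> bexp p E ?f * bexp p E ?g"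
    using insert f by (simp add: mult_left_mono)
  also have "\<dots> \<le> bexp p E (\<lambda>G. ?f G * ?g G)"
  proof (rule harris_inequality)
    fix G G' :: "'a set" assume G: "G \<subseteq> G'"
    then have "G \<inter> F j \<noteq> {} \<Longrightarrow> G' \<inter> F j \<noteq> {}" for j by blast
    then show "?f G \<le> ?f G'" "?g G \<le> ?g G'" by (simp_all add: of_bool_def)
  qed (use assms in auto)
  also have "\<dots> = bexp p E (\<lambda>G. of_bool (\<forall>i\<in>insert i I. G \<inter> F i \<noteq> {}))"
    by (rule bexp_cong) auto
  finally show ?case .
qed (use assms in simp)

text \<open>Conditioning on the events one by one, as in the proof of Boppana and Spencer. The new set \<open>F
  i\<close> is independent of those disjoint from it; the overlapping ones are removed by a union bound whose terms
  are controlled by Harris' inequality. The induction meets each overlapping pair once; the last sum counts it twice,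
  which makes it symmetric.\<close>

theorem janson_inequality:
  fixes E :: "'a set"
  assumes p: "0 \<le> p" "p \<le> 1" and E: "finite E" and "finite I" "\<And>i. i \<in> I \<Longrightarrow> F i \<subseteq> E"
  shows "bexp p E (\<lambda>G. of_bool (\<forall>i\<in>I. \<not> F i \<subseteq> G))
     \<le> exp (- (\<Sum>i\<in>I. p ^ card (F i))
           + (\<Sum>i\<in>I. \<Sum>j\<in>{j\<in>I. j \<noteq> i \<and> F i \<inter> F j \<noteq> {}}. p ^ card (F i \<union> F j)))"
  using assms(4,5)
proof (induction I rule: finite_induct)
  case (insert i I)
  let ?none = "\<lambda>J G. of_bool (\<forall>j\<in>J. \<not> F j \<subseteq> G) :: real"
  let ?D = "\<lambda>I i. \<Sum>j\<in>{j\<in>I. j \<noteq> i \<and> F i \<inter> F j \<noteq> {}}. p ^ card (F i \<union> F j)"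
  define J0 where "J0 = {j\<in>I. F i \<inter> F j = {}}"
  define J1 where "J1 = {j\<in>I. F i \<inter> F j \<noteq> {}}"
  define \<beta> where "\<beta> = p ^ card (F i) - (\<Sum>j\<in>J1. p ^ card (F i \<union> F j))"
  have J: "J0 \<subseteq> I" "J1 \<subseteq> I" "I = J0 \<union> J1" "finite J1" using insert by (auto simp: J0_def J1_def)
  have FE: "F i \<subseteq> E" "\<And>j. j \<in> I \<Longrightarrow> F j \<subseteq> E" using insert.prems by auto
  have none_nonneg: "0 \<le> bexp p E (?none J)" for J
    by (rule bexp_nonneg) (use p in auto)
  \<comment> \<open>the sets disjoint from \<open>F i\<close> are independent of it; the others are removed by a union bound\<close>
  have indep: "bexp p E (\<lambda>G. of_bool (F i \<subseteq> G) * ?none J0 G) = p ^ card (F i) * bexp p E (?none J0)"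
  proof -
    have *: "?none J0 G = ?none J0 (G - F i)" for G
    proof -
      have "F j \<subseteq> G \<longleftrightarrow> F j \<subseteq> G - F i" if "j \<in> J0" for j using that by (auto simp: J0_def)
      then show ?thesis by auto
    qed
    show ?thesis
      using bexp_superset_indep[OF E FE(1), of p "?none J0"] *[symmetric] by simp
  qed
  have corr: "bexp p E (\<lambda>G. of_bool (F i \<union> F j \<subseteq> G) * ?none J0 G)
      \<le> p ^ card (F i \<union> F j) * bexp p E (?none J0)" if "j \<in> J1" for j
  proof -
    have sub: "F i \<union> F j \<subseteq> E" using FE J that by auto
    have "bexp p E (\<lambda>G. of_bool (F i \<union> F j \<subseteq> G) * ?none J0 G)
      \<le> bexp p E (\<lambda>G. of_bool (F i \<union> F j \<subseteq> G)) * bexp p E (?none J0)"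
      proof (rule harris_mixed[OF p E])
      fix G G' :: "'a set" assume "G \<subseteq> G'"
      then show "of_bool (F i \<union> F j \<subseteq> G) \<le> (of_bool (F i \<union> F j \<subseteq> G') :: real)"
        "?none J0 G' \<le> ?none J0 G" by (auto simp: of_bool_def)
    qed
    then show ?thesis using bexp_superset[OF E sub] by simp
  qed
  have "\<beta> * bexp p E (?none J0) = bexp p E (\<lambda>G. of_bool (F i \<subseteq> G) * ?none J0 G)
      - (\<Sum>j\<in>J1. p ^ card (F i \<union> F j) * bexp p E (?none J0))"
    by (simp add: \<beta>_def indep left_diff_distrib sum_distrib_right)
  also have "\<dots> \<le> bexp p E (\<lambda>G. of_bool (F i \<subseteq> G) * ?none J0 G)
      - (\<Sum>j\<in>J1. bexp p E (\<lambda>G. of_bool (F i \<union> F j \<subseteq> G) * ?none J0 G))"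
    by (intro diff_left_mono sum_mono corr)
  also have "\<dots> = bexp p E (\<lambda>G. of_bool (F i \<subseteq> G) * ?none J0 G
      - (\<Sum>j\<in>J1. of_bool (F i \<union> F j \<subseteq> G) * ?none J0 G))"
    by (simp add: bexp_diff bexp_sum)
  also have "\<dots> \<le> bexp p E (\<lambda>G. of_bool (F i \<subseteq> G) * ?none I G)"
  proof (rule bexp_mono[OF p])
    fix G assume "G \<subseteq> E"
    show "of_bool (F i \<subseteq> G) * ?none J0 G - (\<Sum>j\<in>J1. of_bool (F i \<union> F j \<subseteq> G) * ?none J0 G)
        \<le> of_bool (F i \<subseteq> G) * ?none I G"
    proof (cases "F i \<subseteq> G \<and> (\<forall>j\<in>J0. \<not> F j \<subseteq> G) \<and> (\<exists>j\<in>J1. F j \<subseteq> G)")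
      case True
      then obtain j where j: "j \<in> J1" "F j \<subseteq> G" by auto
      then have "(1::real) \<le> (\<Sum>j\<in>J1. of_bool (F i \<union> F j \<subseteq> G) * ?none J0 G)"
        using True J(4) member_le_sum[of j J1 "\<lambda>j. of_bool (F i \<union> F j \<subseteq> G) * ?none J0 G"] by auto
      then show ?thesis using True by simp
    next
      case False
      have "0 \<le> (\<Sum>j\<in>J1. of_bool (F i \<union> F j \<subseteq> G) * ?none J0 G)" by (intro sum_nonneg) auto
      moreover have "of_bool (F i \<subseteq> G) * ?none J0 G \<le> of_bool (F i \<subseteq> G) * ?none I G"
        using False J(3) by auto
      ultimately show ?thesis by linarith
    qed
  qed
  finally have key0: "\<beta> * bexp p E (?none J0) \<le> bexp p E (\<lambda>G. of_bool (F i \<subseteq> G) * ?none I G)" .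
  have key: "\<beta> * bexp p E (?none I) \<le> bexp p E (\<lambda>G. of_bool (F i \<subseteq> G) * ?none I G)"
  proof (cases "0 \<le> \<beta>")
    case True
    have "bexp p E (?none I) \<le> bexp p E (?none J0)"
      by (rule bexp_mono[OF p]) (use J in auto)
    then show ?thesis using key0 True by (meson mult_left_mono order_trans)
  next
    case False
    then have "\<beta> * bexp p E (?none I) \<le> 0" using none_nonneg[of I] by (simp add: mult_nonpos_nonneg)
    also have "0 \<le> bexp p E (\<lambda>G. of_bool (F i \<subseteq> G) * ?none I G)"
      by (rule bexp_nonneg) (use p in auto)
    finally show ?thesis .
  qed
  have "bexp p E (?none (insert i I)) = bexp p E (\<lambda>G. ?none I G - of_bool (F i \<subseteq> G) * ?none I G)"
    by (rule bexp_cong) auto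
  also have "\<dots> \<le> (1 - \<beta>) * bexp p E (?none I)"
    using key by (simp add: bexp_diff algebra_simps)
  also have "\<dots> \<le> exp (- \<beta>) * bexp p E (?none I)"
    using exp_ge_add_one_self[of "-\<beta>"] none_nonneg[of I] by (intro mult_right_mono) auto
  also have "\<dots> \<le> exp (- \<beta>) * exp (- (\<Sum>i\<in>I. p ^ card (F i)) + (\<Sum>i\<in>I. ?D I i))"
    using insert by (intro mult_left_mono) auto
  also have "\<dots> = exp (- (\<Sum>i\<in>insert i I. p ^ card (F i)) + ((\<Sum>j\<in>J1. p ^ card (F i \<union> F j)) + (\<Sum>i\<in>I. ?D I i)))"
    using insert.hyps by (simp add: exp_add[symmetric] \<beta>_def)
  also have "\<dots> \<le> exp (- (\<Sum>i\<in>insert i I. p ^ card (F i)) + (\<Sum>i'\<in>insert i I. ?D (insert i I) i'))"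
  proof -
    have "J1 = {j \<in> insert i I. j \<noteq> i \<and> F i \<inter> F j \<noteq> {}}" using insert.hyps by (auto simp: J1_def)
    moreover have "(\<Sum>i\<in>I. ?D I i) \<le> (\<Sum>i'\<in>I. ?D (insert i I) i')"
      using insert.hyps p by (intro sum_mono sum_mono2) auto
    ultimately show ?thesis using insert.hyps by simp
  qed
  finally show ?case .
qed (use assms in simp)

lemma bexp_blocks:
  assumes "\<And>i. i < (r::nat) \<Longrightarrow> finite (Ei i)" "\<And>i j. i < r \<Longrightarrow> j < r \<Longrightarrow> i \<noteq> j \<Longrightarrow> Ei i \<inter> Ei j = {}"
  shows "bexp p (\<Union>i<r. Ei i) (\<lambda>G. \<Prod>i<r. f i (G \<inter> Ei i)) = (\<Prod>i<r. bexp p (Ei i) (f i))"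
  using assms
proof (induction r)
  case (Suc r)
  have U: "(\<Union>i<Suc r. Ei i) = (\<Union>i<r. Ei i) \<union> Ei r" by (auto simp: lessThan_Suc)
  have "Ei i \<inter> Ei r = {}" if "i < r" for i using Suc.prems(2)[of i r] that by auto
  then have dis: "(\<Union>i<r. Ei i) \<inter> Ei r = {}" by auto
  have "bexp p (\<Union>i<Suc r. Ei i) (\<lambda>G. \<Prod>i<Suc r. f i (G \<inter> Ei i))
     = bexp p (\<Union>i<r. Ei i) (\<lambda>G1. bexp p (Ei r) (\<lambda>G2. \<Prod>i<Suc r. f i ((G1 \<union> G2) \<inter> Ei i)))"
    unfolding U using dis Suc.prems(1) by (intro bexp_union) auto
  also have "\<dots> = bexp p (\<Union>i<r. Ei i) (\<lambda>G1. bexp p (Ei r) (\<lambda>G2. (\<Prod>i<r. f i (G1 \<inter> Ei i)) * f r G2))"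
  proof (intro bexp_cong)
    fix G1 G2 assume G: "G1 \<subseteq> (\<Union>i<r. Ei i)" "G2 \<subseteq> Ei r"
    have "(G1 \<union> G2) \<inter> Ei i = G1 \<inter> Ei i" if "i < r" for i using G Suc.prems(2)[of i r] that by auto
    moreover have "(G1 \<union> G2) \<inter> Ei r = G2" using G dis by auto
    ultimately show "(\<Prod>i<Suc r. f i ((G1 \<union> G2) \<inter> Ei i)) = (\<Prod>i<r. f i (G1 \<inter> Ei i)) * f r G2"
      by simp
  qed
  also have "\<dots> = (\<Prod>i<Suc r. bexp p (Ei i) (f i))"
    using Suc by (simp add: bexp_cmult bexp_cmult_right)
  finally show ?case .
qed simp

text \<open>The events \<open>C i\<close> depend on a common part \<open>E0\<close> and on private parts \<open>Ei
  i\<close>, so they are independent given \<open>G0\<close>. Call \<open>i\<close> good for \<open>G0\<close> if its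
  conditional probability is at least \<open>\<phi>\<close>. On average at least \<open>g r\<close> indices are good,
  hence at least \<open>g r / 2\<close> are good with probability at least \<open>g / 2\<close>, and then all \<open>C
  i\<close> fail with probability at most \<open>(1 - \<phi>)\<^bsup>g r / 2\<^esup>\<close>. Goodness is handled by
  averaging over \<open>i\<close> because all indices look at the same \<open>G0\<close> and may be good or bad
  together.\<close>

theorem amplification:
  assumes p: "0 \<le> p" "p \<le> 1" and fin: "finite E"
    and sub: "E0 \<subseteq> E" "\<And>i. i < r \<Longrightarrow> Ei i \<subseteq> E"
    and dis0: "\<And>i. i < r \<Longrightarrow> E0 \<inter> Ei i = {}"
    and dis: "\<And>i j. i < r \<Longrightarrow> j < r \<Longrightarrow> i \<noteq> j \<Longrightarrow> Ei i \<inter> Ei j = {}"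
    and C: "\<And>i G. i < r \<Longrightarrow> C i G \<longleftrightarrow> C i (G \<inter> (E0 \<union> Ei i))"
    and phi: "0 \<le> \<phi>" and g1: "g \<le> 1"
    and g: "\<And>i. i < r \<Longrightarrow>
       g \<le> bexp p E0 (\<lambda>G0. of_bool (\<phi> \<le> bexp p (Ei i) (\<lambda>G1. of_bool (C i (G0 \<union> G1)))))"
  shows "bexp p E (\<lambda>G. of_bool (\<forall>i<r. \<not> C i G)) \<le> 1 - g / 2 + exp (- (g * \<phi> * real r / 2))"
proof -
  define U where "U = (\<Union>i<r. Ei i)"
  define h where "h i G0 = bexp p (Ei i) (\<lambda>G1. of_bool (C i (G0 \<union> G1)))" for i G0
  have finE: "finite E0" "\<And>i. i < r \<Longrightarrow> finite (Ei i)" "finite U" "E0 \<inter> U = {}" "E0 \<union> U \<subseteq> E"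
  proof -
    show "E0 \<inter> U = {}" using dis0 by (auto simp: U_def)
    show "E0 \<union> U \<subseteq> E" using sub by (auto simp: U_def)
    then show "finite E0" "finite U" using finite_subset[OF _ fin] by auto
    show "finite (Ei i)" if "i < r" for i using finite_subset[OF _ fin] sub(2) that by auto
  qed
  have h01: "0 \<le> h i G0" "h i G0 \<le> 1" if "i < r" for i G0
    unfolding h_def using p finE that by (auto intro!: bexp_nonneg bexp_le_const)
  have "bexp p E (\<lambda>G. of_bool (\<forall>i<r. \<not> C i G))
      = bexp p E (\<lambda>G. of_bool (\<forall>i<r. \<not> C i (G \<inter> (E0 \<union> U))))"
  proof (intro bexp_cong arg_cong[where f = of_bool] all_cong1 imp_cong refl)
    fix G i assume "i < r"
    then have "C i (G \<inter> (E0 \<union> U)) = C i (G \<inter> (E0 \<union> U) \<inter> (E0 \<union> Ei i))" using C by blast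
    also have "G \<inter> (E0 \<union> U) \<inter> (E0 \<union> Ei i) = G \<inter> (E0 \<union> Ei i)" using \<open>i < r\<close> by (auto simp: U_def)
    finally show "(\<not> C i G) = (\<not> C i (G \<inter> (E0 \<union> U)))" using C \<open>i < r\<close> by blast
  qed
  also have "\<dots> = bexp p (E0 \<union> U) (\<lambda>G. of_bool (\<forall>i<r. \<not> C i G))"
    by (rule bexp_restrict) (use fin finE in auto)
  also have "\<dots> = bexp p E0 (\<lambda>G0. bexp p U (\<lambda>G1. of_bool (\<forall>i<r. \<not> C i (G0 \<union> G1))))"
    by (rule bexp_union) (use finE in auto)
  also have "\<dots> = bexp p E0 (\<lambda>G0. bexp p U (\<lambda>G1. \<Prod>i<r. 1 - of_bool (C i (G0 \<union> (G1 \<inter> Ei i)))))"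
  proof (intro bexp_cong)
    fix G0 G1 assume G: "G0 \<subseteq> E0" "G1 \<subseteq> U"
    have "C i (G0 \<union> G1) = C i (G0 \<union> (G1 \<inter> Ei i))" if "i < r" for i
    proof -
      have "(G0 \<union> G1) \<inter> (E0 \<union> Ei i) = G0 \<union> (G1 \<inter> Ei i)"
        using G that finE(4) dis0 by auto
      then show ?thesis using C[OF that, of "G0 \<union> G1"] by simp
    qed
    then show "of_bool (\<forall>i<r. \<not> C i (G0 \<union> G1)) = (\<Prod>i<r. 1 - of_bool (C i (G0 \<union> (G1 \<inter> Ei i))) :: real)"
      by (auto simp: prod_zero_iff intro!: prod.neutral[symmetric])
  qed
  also have "\<dots> = bexp p E0 (\<lambda>G0. \<Prod>i<r. 1 - h i G0)"
    unfolding U_def using dis finE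
    by (subst bexp_blocks[where f = "\<lambda>i G. 1 - of_bool (C i (G0 \<union> G))" for G0])
       (auto simp: bexp_diff h_def)
  also have "\<dots> \<le> bexp p E0 (\<lambda>G0. of_bool (real (card {i. i < r \<and> \<phi> \<le> h i G0}) < g * r / 2) + exp (- (g * \<phi> * real r / 2)))"
  proof (rule bexp_mono[OF p])
    fix G0
    let ?N = "{i. i < r \<and> \<phi> \<le> h i G0}"
    have "(\<Prod>i<r. 1 - h i G0) \<le> (\<Prod>i<r. exp (- (if i \<in> ?N then \<phi> else 0)))"
    proof (rule prod_mono)
      fix i assume i: "i \<in> {..<r}"
      have "1 - h i G0 \<le> exp (- h i G0)" using exp_ge_add_one_self[of "- h i G0"] by simp
      also have "\<dots> \<le> exp (- (if i \<in> ?N then \<phi> else 0))" using i h01 by auto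
      finally show "0 \<le> 1 - h i G0 \<and> 1 - h i G0 \<le> exp (- (if i \<in> ?N then \<phi> else 0))"
        using i h01 by auto
    qed
    also have "\<dots> = exp (\<Sum>i<r. - (if i \<in> ?N then \<phi> else 0))" by (simp add: exp_sum)
    also have "(\<Sum>i<r. - (if i \<in> ?N then \<phi> else 0)) = - (\<phi> * card ?N)"
    proof -
      have "(\<Sum>i<r. if i \<in> ?N then \<phi> else 0) = (\<Sum>i\<in>{i\<in>{..<r}. i \<in> ?N}. \<phi>)"
        by (rule sum.inter_filter[symmetric]) simp
      also have "{i\<in>{..<r}. i \<in> ?N} = ?N" by auto
      finally show ?thesis by (simp add: sum_negf mult.commute)
    qed
    finally have 1: "(\<Prod>i<r. 1 - h i G0) \<le> exp (- (\<phi> * card ?N))" .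
    show "(\<Prod>i<r. 1 - h i G0) \<le> of_bool (real (card ?N) < g * r / 2) + exp (- (g * \<phi> * real r / 2))"
    proof (cases "real (card ?N) < g * r / 2")
      case True
      have "exp (- (\<phi> * card ?N)) \<le> 1" using phi by simp
      then show ?thesis using True 1 by (smt (verit) exp_gt_zero of_bool_eq(2))
    next
      case False
      then have "\<phi> * (g * r / 2) \<le> \<phi> * card ?N" using phi by (intro mult_left_mono) auto
      then have "exp (- (\<phi> * card ?N)) \<le> exp (- (g * \<phi> * real r / 2))" by (simp add: algebra_simps)
      then have "(\<Prod>i<r. 1 - h i G0) \<le> exp (- (g * \<phi> * real r / 2))" using 1 by (rule order_trans[rotated])
      moreover have "of_bool (real (card ?N) < g * r / 2) = (0::real)" using False by simp
      ultimately show ?thesis by linarith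
    qed
  qed
  also have "\<dots> \<le> 1 - g / 2 + exp (- (g * \<phi> * real r / 2))"
  proof -
    define P where "P = bexp p E0 (\<lambda>G0. of_bool (real (card {i. i < r \<and> \<phi> \<le> h i G0}) < g * r / 2))"
    have P1: "P \<le> 1" unfolding P_def by (rule bexp_le_const) (use p finE in auto)
    have "P \<le> 1 - g / 2"
    proof (cases "r = 0")
      case True
      then show ?thesis using g1 finE by (simp add: P_def)
    next
      case False
      have "g * r = (\<Sum>i<r. g)" by simp
      also have "\<dots> \<le> (\<Sum>i<r. bexp p E0 (\<lambda>G0. of_bool (\<phi> \<le> h i G0)))"
        unfolding h_def by (intro sum_mono g) auto
      also have "\<dots> = bexp p E0 (\<lambda>G0. real (card {i. i < r \<and> \<phi> \<le> h i G0}))"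
      proof -
        have "real (card {i. i < r \<and> \<phi> \<le> h i G0}) = (\<Sum>i<r. of_bool (\<phi> \<le> h i G0))" for G0
        proof -
          have "{i. i < r \<and> \<phi> \<le> h i G0} = {..<r} \<inter> {i. \<phi> \<le> h i G0}" by auto
          then show ?thesis by (simp add: sum_of_bool_eq)
        qed
        then show ?thesis by (simp only: bexp_sum)
      qed
      also have "\<dots> \<le> bexp p E0 (\<lambda>G0. r - (r - g * r / 2) * of_bool (real (card {i. i < r \<and> \<phi> \<le> h i G0}) < g * r / 2))"
      proof (rule bexp_mono[OF p])
        fix G0
        have "card {i. i < r \<and> \<phi> \<le> h i G0} \<le> card {..<r}" by (rule card_mono) auto
        then show "real (card {i. i < r \<and> \<phi> \<le> h i G0})
          \<le> r - (r - g * r / 2) * of_bool (real (card {i. i < r \<and> \<phi> \<le> h i G0}) < g * r / 2)"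
          by auto
      qed
      also have "\<dots> = r - (r - g * r / 2) * P"
        using finE by (simp add: bexp_diff bexp_cmult P_def)
      finally have "r * ((1 - g / 2) * P) \<le> r * (1 - g)" by (simp add: algebra_simps)
      then have 2: "(1 - g / 2) * P \<le> 1 - g" using False by simp
      have "(1 - g / 2) * P \<le> (1 - g / 2) * (1 - g / 2)"
      proof -
        have "(1 - g / 2) * (1 - g / 2) = (1 - g) + (g / 2) * (g / 2)" by (simp add: algebra_simps)
        then show ?thesis using 2 zero_le_square[of "g / 2"] by linarith
      qed
      then show ?thesis using g1 by simp
    qed
    then show ?thesis using finE by (simp add: bexp_add P_def)
  qed
  finally show ?thesis .
qed

section \<open>Graphs, closeness and undetected edges\<close>

definition pairs :: "nat set \<Rightarrow> nat set set" where
  "pairs S = {e. e \<subseteq> S \<and> card e = 2}"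

lemma vertex_pairs_eq: "vertex_pairs n = pairs {1..n}"
  by (simp add: vertex_pairs_def pairs_def)

lemma finite_pairs [simp]: "finite S \<Longrightarrow> finite (pairs S)"
  by (rule finite_subset[of _ "Pow S"]) (auto simp: pairs_def)

lemma pairs_mono: "S \<subseteq> S' \<Longrightarrow> pairs S \<subseteq> pairs S'"
  by (auto simp: pairs_def)

lemma doubleton_in_pairs: "{a, b} \<in> pairs S \<longleftrightarrow> a \<in> S \<and> b \<in> S \<and> a \<noteq> b"
  by (auto simp: pairs_def card_insert_if)

text \<open>The link to measure theory: probabilities in \<open>G(n,p)\<close> become finite sums, with which all
  estimates are carried out.\<close>

lemma prob_binomial_random_graph:
  assumes "0 \<le> p" "p \<le> 1"
  shows "measure_pmf.prob (binomial_random_graph n p) {G. P G} = bexp p (vertex_pairs n) (\<lambda>G. of_bool (P G))"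
proof -
  let ?E = "vertex_pairs n"
  have fin: "finite ?E" by (simp add: vertex_pairs_eq)
  let ?M = "Pi_pmf ?E False (\<lambda>_. bernoulli_pmf p)"
  let ?g = "\<lambda>f. {e \<in> ?E. f e}"
  have "finite (set_pmf ?M)"
    by (rule finite_subset[OF set_Pi_pmf_subset'[OF fin]])
       (intro finite_PiE_dflt fin, auto)
  have pm: "pmf (binomial_random_graph n p) G = p ^ card G * (1 - p) ^ card (?E - G)" if G: "G \<subseteq> ?E" for G
  proof -
    have inj: "inj_on ?g (PiE_dflt ?E False (\<lambda>_. UNIV))"
      by (rule inj_onI, rule ext) (fastforce simp: PiE_dflt_def)
    have sub: "set_pmf ?M \<subseteq> PiE_dflt ?E False (\<lambda>_. UNIV)"
      using set_Pi_pmf_subset'[OF fin, of False "\<lambda>_. bernoulli_pmf p"] by (auto simp: PiE_dflt_def)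
    have "?g -` {G} \<inter> PiE_dflt ?E False (\<lambda>_. UNIV) = {\<lambda>e. e \<in> G}"
      using G by (auto simp: PiE_dflt_def fun_eq_iff)
    moreover have "measure_pmf.prob ?M (?g -` {G}) = measure_pmf.prob ?M (?g -` {G} \<inter> PiE_dflt ?E False (\<lambda>_. UNIV))"
      by (rule measure_prob_cong_0) (use sub in \<open>auto simp: set_pmf_eq\<close>)
    ultimately have "pmf (binomial_random_graph n p) G = pmf ?M (\<lambda>e. e \<in> G)"
      unfolding binomial_random_graph_def pmf_map by (simp add: measure_pmf_single)
    also have "\<dots> = (\<Prod>e\<in>?E. pmf (bernoulli_pmf p) (e \<in> G))"
      using fin G by (subst pmf_Pi) auto
    also have "\<dots> = (\<Prod>e\<in>?E. if e \<in> G then p else 1 - p)"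
      using assms by (intro prod.cong) auto
    also have "\<dots> = (\<Prod>e\<in>G. p) * (\<Prod>e\<in>?E - G. 1 - p)"
      using fin G by (simp add: prod.If_cases Int_absorb1 Diff_eq)
    finally show ?thesis by simp
  qed
  have "set_pmf (binomial_random_graph n p) \<subseteq> Pow ?E"
    by (auto simp: binomial_random_graph_def)
  then have "measure_pmf.prob (binomial_random_graph n p) {G. P G}
      = measure_pmf.prob (binomial_random_graph n p) {G \<in> Pow ?E. P G}"
    by (intro measure_prob_cong_0) (auto simp: set_pmf_eq)
  also have "\<dots> = (\<Sum>G\<in>{G \<in> Pow ?E. P G}. pmf (binomial_random_graph n p) G)"
    using fin by (intro measure_measure_pmf_finite) auto
  also have "\<dots> = (\<Sum>G\<in>Pow ?E. if P G then pmf (binomial_random_graph n p) G else 0)"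
    using fin by (intro sum.inter_filter) auto
  also have "\<dots> = bexp p ?E (\<lambda>G. of_bool (P G))"
    unfolding bexp_def by (intro sum.cong) (auto simp: pm)
  finally show ?thesis .
qed

text \<open>Distance at most \<open>l\<close>. Stating this with walks in recursive form avoids
  \<^typ>\<open>enat\<close> and makes monotonicity in the graph and in \<open>l\<close> immediate.\<close>

primrec near :: "nat set set \<Rightarrow> nat \<Rightarrow> nat \<Rightarrow> nat \<Rightarrow> bool" where
  "near G 0 u v \<longleftrightarrow> u = v"
| "near G (Suc l) u v \<longleftrightarrow> u = v \<or> (\<exists>w. {u, w} \<in> G \<and> near G l w v)"

lemma near_refl [simp]: "near G l u u" by (cases l) auto

lemma near_Suc: "near G l u v \<Longrightarrow> near G (Suc l) u v"
  by (induction l arbitrary: u) auto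

lemma near_mono_length: "near G l u v \<Longrightarrow> l \<le> l' \<Longrightarrow> near G l' u v"
proof (induction "l' - l" arbitrary: l')
  case (Suc d)
  then obtain l'' where "l' = Suc l''" by (cases l') auto
  then show ?case using Suc near_Suc[of G l'' u v] by (simp del: near.simps)
qed simp

lemma near_mono_graph: "near G l u v \<Longrightarrow> G \<subseteq> G' \<Longrightarrow> near G' l u v"
  by (induction l arbitrary: u) auto

lemma near_trans: "near G l u v \<Longrightarrow> near G m v w \<Longrightarrow> near G (l + m) u w"
proof (induction l arbitrary: u)
  case (Suc l)
  show ?case
  proof (cases "u = v")
    case True
    then show ?thesis using Suc.prems near_mono_length[of G m v w "Suc l + m"] by (simp del: near.simps)
  next
    case False
    then show ?thesis using Suc by auto
  qed
qed auto

lemma near_edge: "{u, v} \<in> G \<Longrightarrow> near G 1 u v" by auto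

lemma near_sym: "near G l u v \<Longrightarrow> near G l v u"
proof (induction l arbitrary: u)
  case (Suc l)
  show ?case
  proof (cases "u = v")
    case False
    then obtain w where w: "{u, w} \<in> G" "near G l w v" using Suc.prems by auto
    have "near G (l + 1) v u"
      using near_trans[OF Suc.IH[OF w(2)], of 1 u] w(1) near_edge[of w u G] by (simp add: insert_commute)
    then show ?thesis by (simp del: near.simps)
  qed simp
qed auto

fun pedges :: "nat list \<Rightarrow> nat set set" where
  "pedges (a # b # xs) = insert {a, b} (pedges (b # xs))"
| "pedges _ = {}"

lemma finite_pedges [simp]: "finite (pedges xs)"
  by (induction xs rule: pedges.induct) auto

lemma pedges_Cons: "xs \<noteq> [] \<Longrightarrow> pedges (a # xs) = insert {a, hd xs} (pedges xs)"
  by (cases xs) auto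

lemma pedges_subset_Pow: "e \<in> pedges xs \<Longrightarrow> e \<subseteq> set xs"
  by (induction xs rule: pedges.induct) auto

lemma card_pedges: "distinct xs \<Longrightarrow> card (pedges xs) = length xs - 1"
proof (induction xs rule: pedges.induct)
  case (1 a b xs)
  then have "{a, b} \<notin> pedges (b # xs)" using pedges_subset_Pow[of "{a,b}" "b # xs"] by auto
  then show ?case using 1 by auto
qed auto

lemma pedges_subset_pairs: "distinct xs \<Longrightarrow> set xs \<subseteq> S \<Longrightarrow> pedges xs \<subseteq> pairs S"
  by (induction xs rule: pedges.induct) (auto simp: doubleton_in_pairs)

lemma successively_iff_pedges: "successively (\<lambda>u v. {u, v} \<in> G) xs \<longleftrightarrow> pedges xs \<subseteq> G"
  by (induction xs rule: pedges.induct) auto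

lemma pedges_append_subset: "pedges ys \<subseteq> pedges (xs @ ys)"
proof (induction xs)
  case (Cons x xs)
  then show ?case by (cases "xs @ ys") auto
qed auto

lemma near_iff_path:
  "near G l u v \<longleftrightarrow> (\<exists>xs. xs \<noteq> [] \<and> hd xs = u \<and> last xs = v \<and> distinct xs \<and> pedges xs \<subseteq> G \<and> length xs \<le> Suc l)"
proof
  show "near G l u v \<Longrightarrow> \<exists>xs. xs \<noteq> [] \<and> hd xs = u \<and> last xs = v \<and> distinct xs \<and> pedges xs \<subseteq> G \<and> length xs \<le> Suc l"
  proof (induction l arbitrary: u)
    case 0
    then show ?case by (intro exI[of _ "[u]"]) auto
  next
    case (Suc l)
    show ?case
    proof (cases "u = v")
      case True
      then show ?thesis by (intro exI[of _ "[u]"]) auto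
    next
      case False
      then obtain w where w: "{u, w} \<in> G" "near G l w v" using Suc.prems by auto
      obtain xs where xs: "xs \<noteq> []" "hd xs = w" "last xs = v" "distinct xs" "pedges xs \<subseteq> G" "length xs \<le> Suc l"
        using Suc.IH[OF w(2)] by auto
      show ?thesis
      proof (cases "u \<in> set xs")
        case False
        then show ?thesis using xs w by (intro exI[of _ "u # xs"]) (auto simp: pedges_Cons)
      next
        case True
        then obtain as bs where "xs = as @ u # bs" by (auto dest: split_list)
        then show ?thesis using xs pedges_append_subset[of "u # bs" as]
          by (intro exI[of _ "u # bs"]) auto
      qed
    qed
  qed
next
  assume "\<exists>xs. xs \<noteq> [] \<and> hd xs = u \<and> last xs = v \<and> distinct xs \<and> pedges xs \<subseteq> G \<and> length xs \<le> Suc l"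
  then obtain xs where "xs \<noteq> []" "hd xs = u" "last xs = v" "pedges xs \<subseteq> G" "length xs \<le> Suc l" by auto
  then show "near G l u v"
  proof (induction xs arbitrary: u l rule: pedges.induct)
    case (1 a b xs)
    then obtain l' where "l = Suc l'" by (cases l) auto
    then show ?case using 1 by auto
  qed auto
qed

lemma graph_dist_le_iff: "graph_dist G u v \<le> enat l \<longleftrightarrow> near G l u v"
proof -
  let ?A = "{xs. graph_path G u xs v}"
  have "graph_dist G u v \<le> enat l \<longleftrightarrow> (\<exists>xs\<in>?A. enat (length xs - 1) \<le> enat l)"
  proof
    assume le: "graph_dist G u v \<le> enat l"
    have ne: "?A \<noteq> {}"
    proof
      assume "?A = {}"
      then have "graph_dist G u v = \<infinity>"
        unfolding graph_dist_def by (simp only: image_empty Inf_empty top_enat_def)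
      then show False using le by simp
    qed
    then obtain xs where "xs \<in> ?A" by auto
    then have "(INF xs\<in>?A. enat (length xs - 1)) \<in> (\<lambda>xs. enat (length xs - 1)) ` ?A"
      by (intro wellorder_InfI[of "enat (length xs - 1)"] imageI)
    then show "\<exists>xs\<in>?A. enat (length xs - 1) \<le> enat l" using le by (auto simp: graph_dist_def)
  next
    assume "\<exists>xs\<in>?A. enat (length xs - 1) \<le> enat l"
    then show "graph_dist G u v \<le> enat l" unfolding graph_dist_def by (meson INF_lower2)
  qed
  also have "\<dots> \<longleftrightarrow> near G l u v"
  proof
    assume "\<exists>xs\<in>?A. enat (length xs - 1) \<le> enat l"
    then obtain xs where "graph_path G u xs v" "length xs - 1 \<le> l" by auto
    then show "near G l u v" unfolding near_iff_path
      by (intro exI[of _ xs]) (auto simp: graph_path_def successively_iff_pedges)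
  next
    assume "near G l u v"
    then show "\<exists>xs\<in>?A. enat (length xs - 1) \<le> enat l" unfolding near_iff_path
      by (fastforce simp: graph_path_def successively_iff_pedges)
  qed
  finally show ?thesis .
qed

text \<open>A distance is determined by the set of its upper bounds, including the infinite distance, for which this
  set is empty.\<close>

lemma graph_dist_eqI:
  assumes "\<And>l. near G' l u v \<longleftrightarrow> near G l u v"
  shows "graph_dist G' u v = graph_dist G u v"
proof (rule antisym)
  show "graph_dist G' u v \<le> graph_dist G u v"
    using assms graph_dist_le_iff[of G' u v] graph_dist_le_iff[of G u v]
    by (cases "graph_dist G u v") auto
  show "graph_dist G u v \<le> graph_dist G' u v"
    using assms graph_dist_le_iff[of G' u v] graph_dist_le_iff[of G u v]
    by (cases "graph_dist G' u v") auto
qed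

text \<open>A shortest walk uses the new edge at most once. The induction is on the length: if the first step is the
  new edge and the remaining walk uses it again, everything before the last use can be dropped.\<close>

lemma near_insert_edge:
  assumes "near (insert {x, y} G) l u v"
  shows "near G l u v \<or> (\<exists>i j. i + j + 1 \<le> l \<and>
      (near G i u x \<and> near G j v y \<or> near G i u y \<and> near G j v x))"
  using assms
proof (induction l arbitrary: u)
  case (Suc l)
  show ?case
  proof (cases "u = v")
    case False
    then obtain w where w: "{u, w} \<in> insert {x, y} G" "near (insert {x, y} G) l w v"
      using Suc.prems by auto
    note IH = Suc.IH[OF w(2)]
    show ?thesis
    proof (cases "{u, w} \<in> G")
      case True
      from IH show ?thesis
      proof (elim disjE exE conjE)
        fix i j assume "i + j + 1 \<le> l" "near G i w x" "near G j v y"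
        then show ?thesis using True by (intro disjI2 exI[of _ "Suc i"] exI[of _ j]) auto
      next
        fix i j assume "i + j + 1 \<le> l" "near G i w y" "near G j v x"
        then show ?thesis using True by (intro disjI2 exI[of _ "Suc i"] exI[of _ j]) auto
      qed (use True in auto)
    next
      case False
      then have "u = x \<and> w = y \<or> u = y \<and> w = x" using w(1) by (auto simp: doubleton_eq_iff)
      then show ?thesis
      proof
        assume uw: "u = x \<and> w = y"
        from IH have "near G l w v \<or> (\<exists>j. j \<le> l \<and> near G j v y) \<or> (\<exists>j. Suc j \<le> l \<and> near G j v x)"
        proof (elim disjE exE conjE)
          fix i j assume "i + j + 1 \<le> l" "near G j v y"
          then show ?thesis by (intro disjI2 disjI1 exI[of _ j]) simp
        next
          fix i j assume "i + j + 1 \<le> l" "near G j v x"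
          then show ?thesis by (intro disjI2 exI[of _ j]) simp
        qed simp
        then show ?thesis
        proof (elim disjE exE conjE)
          assume "near G l w v"
          then show ?thesis using uw by (intro disjI2 exI[of _ 0] exI[of _ l]) (auto intro: near_sym)
        next
          fix j assume "j \<le> l" "near G j v y"
          then show ?thesis using uw by (intro disjI2 exI[of _ 0] exI[of _ j]) auto
        next
          fix j assume "Suc j \<le> l" "near G j v x"
          then show ?thesis using uw near_mono_length[OF near_sym, of G j v x "Suc l"] by (simp del: near.simps)
        qed
      next
        assume uw: "u = y \<and> w = x"
        from IH have "near G l w v \<or> (\<exists>j. j \<le> l \<and> near G j v x) \<or> (\<exists>j. Suc j \<le> l \<and> near G j v y)"
        proof (elim disjE exE conjE)
          fix i j assume "i + j + 1 \<le> l" "near G j v y"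
          then show ?thesis by (intro disjI2 exI[of _ j]) simp
        next
          fix i j assume "i + j + 1 \<le> l" "near G j v x"
          then show ?thesis by (intro disjI2 disjI1 exI[of _ j]) simp
        qed simp
        then show ?thesis
        proof (elim disjE exE conjE)
          assume "near G l w v"
          then show ?thesis using uw by (intro disjI2 exI[of _ 0] exI[of _ l]) (auto intro: near_sym)
        next
          fix j assume "j \<le> l" "near G j v x"
          then show ?thesis using uw by (intro disjI2 exI[of _ 0] exI[of _ j]) auto
        next
          fix j assume "Suc j \<le> l" "near G j v y"
          then show ?thesis using uw near_mono_length[OF near_sym, of G j v y "Suc l"] by (simp del: near.simps)
        qed
      qed
    qed
  qed simp
qed auto

text \<open>Without a witness, \<open>G\<close> and \<open>G\<close> with the additional edge \<open>{x, y}\<close>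
  have the same distances on \<open>Q\<close>. One orientation in the assumption is enough because \<open>u\<close>
  and \<open>v\<close> range over both orders.\<close>

lemma not_reconstructible_if_unwitnessed:
  assumes G: "G \<subseteq> vertex_pairs n" and xy: "x \<in> {1..n}" "y \<in> {1..n}" "x \<noteq> y" "{x, y} \<notin> G"
    and unw: "\<And>u v i j. {u, v} \<in> Q \<Longrightarrow> near G i u x \<Longrightarrow> near G j v y \<Longrightarrow> near G (i + j + 1) u v"
  shows "\<not> reconstructible n Q G"
proof
  assume rec: "reconstructible n Q G"
  let ?G' = "insert {x, y} G"
  have "graph_dist ?G' u v = graph_dist G u v" if Q: "{u, v} \<in> Q" for u v
  proof (rule graph_dist_eqI, rule iffI)
    fix l assume "near ?G' l u v"
    from near_insert_edge[OF this] show "near G l u v"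
    proof (elim disjE exE conjE)
      fix i j assume "i + j + 1 \<le> l" "near G i u x" "near G j v y"
      then show ?thesis using unw[OF Q] near_mono_length by blast
    next
      fix i j assume *: "i + j + 1 \<le> l" "near G i u y" "near G j v x"
      have "near G (j + i + 1) v u" using unw[of v u j i] * Q by (simp add: insert_commute)
      then show ?thesis using near_mono_length[OF near_sym, of G "j + i + 1" v u l] * by (simp del: near.simps)
    qed auto
  next
    fix l assume "near G l u v"
    then show "near ?G' l u v" by (rule near_mono_graph) auto
  qed
  moreover have "?G' \<subseteq> vertex_pairs n" using G xy by (auto simp: vertex_pairs_eq doubleton_in_pairs)
  ultimately have "?G' = G" using rec by (auto simp: reconstructible_def)
  then show False using xy by auto
qed

text \<open>If the other vertices of \<open>W\<close> are far from \<open>x\<close>, a short walk to \<open>x \<in>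
  W\<close> meets no other vertex of \<open>W\<close>. This and \<open>near_last_step\<close> make the events for
  different test pairs depend on disjoint sets of edges.\<close>

lemma near_restrict:
  assumes "near G i u x" "i \<le> k" "G \<subseteq> pairs V" "x \<in> W" "W \<subseteq> V" "\<And>w. w \<in> W \<Longrightarrow> w \<noteq> x \<Longrightarrow> \<not> near G k w x"
  shows "near (G \<inter> pairs (insert x (V - W))) i u x \<and> u \<in> insert x (V - W)"
  using assms(1,2)
proof (induction i arbitrary: u)
  case (Suc i)
  show ?case
  proof (cases "u = x")
    case False
    then obtain w where w: "{u, w} \<in> G" "near G i w x" using Suc.prems by auto
    then have IH: "near (G \<inter> pairs (insert x (V - W))) i w x" "w \<in> insert x (V - W)"
      using Suc.IH[of w] Suc.prems by auto
    have "u \<notin> W" using assms(6)[of u] False near_mono_length[OF Suc.prems] by auto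
    moreover have "u \<in> V" "u \<noteq> w" using subsetD[OF assms(3) w(1)] unfolding doubleton_in_pairs by auto
    ultimately have "u \<in> insert x (V - W)" "{u, w} \<in> G \<inter> pairs (insert x (V - W))"
      using w(1) IH(2) by (auto simp: doubleton_in_pairs)
    then show ?thesis using IH(1) by auto
  qed simp
qed auto

lemma near_last_step:
  assumes "near G i v y" "i \<le> k" "G \<subseteq> pairs V" "y \<in> W" "W \<subseteq> V" "\<And>w. w \<in> W \<Longrightarrow> w \<noteq> y \<Longrightarrow> \<not> near G k w y"
    "v \<noteq> y"
  shows "\<exists>j b. i = Suc j \<and> b \<in> V - W \<and> {y, b} \<in> G \<and> near (G \<inter> pairs (V - W)) j v b \<and> v \<in> V - W"
  using assms(1,2,7)
proof (induction i arbitrary: v)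
  case (Suc i)
  then obtain w where w: "{v, w} \<in> G" "near G i w y" by auto
  have vW: "v \<notin> W" using assms(6)[of v] Suc.prems near_mono_length[OF Suc.prems(1,2)] by auto
  have v: "v \<in> V - W" "v \<noteq> w" using subsetD[OF assms(3) w(1)] vW unfolding doubleton_in_pairs by auto
  show ?case
  proof (cases "w = y")
    case True
    then show ?thesis using w v by (intro exI[of _ i] exI[of _ v]) (auto simp: insert_commute)
  next
    case False
    then obtain j b where jb: "i = Suc j" "b \<in> V - W" "{y, b} \<in> G" "near (G \<inter> pairs (V - W)) j w b" "w \<in> V - W"
      using Suc.IH[OF w(2)] Suc.prems by auto
    then have "near (G \<inter> pairs (V - W)) (Suc j) v b"
      using w(1) v by (auto simp: doubleton_in_pairs)
    then show ?thesis using jb v by blast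
  qed
qed auto

section \<open>First moments: walks, degrees and balls\<close>

lemma bexp_superset_le:
  assumes "0 \<le> p" "finite E"
  shows "bexp p E (\<lambda>G. of_bool (F \<subseteq> G)) \<le> p ^ card F"
proof (cases "F \<subseteq> E")
  case True
  then show ?thesis using bexp_superset[OF assms(2) True] by simp
next
  case False
  then have "bexp p E (\<lambda>G. of_bool (F \<subseteq> G)) = bexp p E (\<lambda>_. 0)" by (intro bexp_cong) auto
  then show ?thesis using assms by simp
qed

lemma bexp_union_bound:
  assumes p: "0 \<le> p" "p \<le> 1" and "finite E" "finite I"
    and "\<And>G. G \<subseteq> E \<Longrightarrow> P G \<Longrightarrow> \<exists>i\<in>I. R i G"
  shows "bexp p E (\<lambda>G. of_bool (P G)) \<le> (\<Sum>i\<in>I. bexp p E (\<lambda>G. of_bool (R i G)))"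
proof -
  have "bexp p E (\<lambda>G. of_bool (P G)) \<le> bexp p E (\<lambda>G. \<Sum>i\<in>I. of_bool (R i G))"
  proof (rule bexp_mono[OF p])
    fix G assume G: "G \<subseteq> E"
    show "of_bool (P G) \<le> (\<Sum>i\<in>I. of_bool (R i G) :: real)"
    proof (cases "P G")
      case True
      then obtain i where i: "i \<in> I" "R i G" using assms(5) G by auto
      then show ?thesis using member_le_sum[of i I "\<lambda>i. of_bool (R i G) :: real"] assms(4) by auto
    qed (auto intro: sum_nonneg)
  qed
  then show ?thesis by (simp add: bexp_sum)
qed

lemma near_path_obtain:
  assumes "near G s u v" "u \<noteq> v" "G \<subseteq> pairs S"
  obtains xs where "length xs < s" "set xs \<subseteq> S" "distinct (u # xs @ [v])" "pedges (u # xs @ [v]) \<subseteq> G"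
proof -
  obtain ys where ys: "ys \<noteq> []" "hd ys = u" "last ys = v" "distinct ys" "pedges ys \<subseteq> G" "length ys \<le> Suc s"
    using assms(1) unfolding near_iff_path by auto
  then obtain zs where zs: "ys = u # zs" by (cases ys) auto
  then have "zs \<noteq> []" using ys assms(2) by auto
  then obtain xs where xs: "zs = xs @ [v]" using ys zs by (cases zs rule: rev_cases) auto
  have in_S: "set w \<subseteq> S" if "pedges w \<subseteq> G" "length w \<ge> 2" for w
    using that
  proof (induction w rule: pedges.induct)
    case (1 a b ws)
    then have "{a, b} \<in> pairs S" using assms(3) by auto
    then have "a \<in> S" "b \<in> S" by (simp_all add: doubleton_in_pairs)
    then show ?case using 1 by (cases ws) simp_all
  qed auto
  have "set ys \<subseteq> S" by (rule in_S) (use ys zs xs in simp_all)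
  then show ?thesis using that[of xs] ys zs xs by simp
qed

lemma prob_near_le:
  assumes p: "0 \<le> p" "p \<le> 1" and S: "finite S" and "u \<noteq> v"
  shows "bexp p (pairs S) (\<lambda>G. of_bool (near G s u v)) \<le> p * (\<Sum>t<s. (real (card S) * p) ^ t)"
proof -
  let ?L = "\<lambda>t. {xs. set xs \<subseteq> S \<and> length xs = t}"
  let ?I = "Sigma {..<s} ?L"
  let ?R = "\<lambda>(t, xs) G. distinct (u # xs @ [v]) \<and> pedges (u # xs @ [v]) \<subseteq> G"
  have fin: "finite (?L t)" for t using finite_lists_length_eq[OF S] .
  have "bexp p (pairs S) (\<lambda>G. of_bool (near G s u v)) \<le> (\<Sum>i\<in>?I. bexp p (pairs S) (\<lambda>G. of_bool (?R i G)))"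
  proof (rule bexp_union_bound[OF p])
    fix G assume "G \<subseteq> pairs S" "near G s u v"
    then obtain xs where "length xs < s" "set xs \<subseteq> S" "distinct (u # xs @ [v])" "pedges (u # xs @ [v]) \<subseteq> G"
      using near_path_obtain[of G s u v S] assms(4) by metis
    then show "\<exists>i\<in>?I. ?R i G" by (intro bexI[of _ "(length xs, xs)"]) auto
  qed (use S fin in auto)
  also have "\<dots> \<le> (\<Sum>i\<in>?I. p ^ Suc (fst i))"
  proof (rule sum_mono)
    fix i assume i: "i \<in> ?I"
    obtain t xs where [simp]: "i = (t, xs)" by (cases i)
    show "bexp p (pairs S) (\<lambda>G. of_bool (?R i G)) \<le> p ^ Suc (fst i)"
    proof (cases "distinct (u # xs @ [v])")
      case True
      have "bexp p (pairs S) (\<lambda>G. of_bool (?R i G)) = bexp p (pairs S) (\<lambda>G. of_bool (pedges (u # xs @ [v]) \<subseteq> G))"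
        using True by (intro bexp_cong) (simp only: \<open>i = (t, xs)\<close> prod.case simp_thms)
      also have "\<dots> \<le> p ^ card (pedges (u # xs @ [v]))" using p S by (intro bexp_superset_le) simp_all
      also have "card (pedges (u # xs @ [v])) = Suc t" using card_pedges[OF True] i by auto
      finally show ?thesis by simp
    next
      case False
      then have "bexp p (pairs S) (\<lambda>G. of_bool (?R i G)) = bexp p (pairs S) (\<lambda>_. 0)" by (intro bexp_cong) auto
      then show ?thesis using p S by simp
    qed
  qed
  also have "\<dots> = (\<Sum>t<s. \<Sum>xs\<in>?L t. p ^ Suc t)"
    using sum.Sigma[of "{..<s}" ?L "\<lambda>t xs. p ^ Suc t"] fin by (simp add: case_prod_unfold)
  also have "\<dots> = p * (\<Sum>t<s. (real (card S) * p) ^ t)"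
    unfolding sum_distrib_left
  proof (rule sum.cong[OF refl])
    fix t
    have "(\<Sum>xs\<in>?L t. p ^ Suc t) = real (card S ^ t) * p ^ Suc t"
      by (simp add: card_lists_length_eq[OF S])
    then show "(\<Sum>xs\<in>?L t. p ^ Suc t) = p * (real (card S) * p) ^ t"
      by (simp add: power_mult_distrib)
  qed
  finally show ?thesis .
qed

text \<open>With base \<open>m \<ge> 1 + 1/\<delta>\<close> the last term dominates. This is how sums over all
  distances up to \<open>j\<close> are replaced by the contribution of distance exactly \<open>j\<close>.\<close>

lemma geometric_sum_le:
  fixes m \<delta> :: real
  assumes "0 < \<delta>" "1 + \<delta> \<le> \<delta> * m"
  shows "(\<Sum>i\<le>j. m ^ i) \<le> (1 + \<delta>) * m ^ j"
proof (induction j)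
  case (Suc j)
  have "0 < \<delta> * m" using assms by linarith
  then have "0 < m" using assms(1) by (simp add: zero_less_mult_iff)
  have "(\<Sum>i\<le>Suc j. m ^ i) = (\<Sum>i\<le>j. m ^ i) + m ^ Suc j" by simp
  also have "\<dots> \<le> (1 + \<delta>) * m ^ j + m ^ Suc j" using Suc by simp
  also have "(1 + \<delta>) * m ^ j \<le> (\<delta> * m) * m ^ j"
    using assms(2) \<open>0 < m\<close> by (intro mult_right_mono) auto
  also have "(\<delta> * m) * m ^ j + m ^ Suc j = (1 + \<delta>) * m ^ Suc j" by (simp add: distrib_right)
  finally show ?case by simp
qed (use assms in simp)

lemma prob_near_le_power:
  fixes p d \<delta> :: real
  assumes p: "0 \<le> p" "p \<le> 1" and d: "d = real n * p" and \<delta>: "0 < \<delta>" "1 + \<delta> \<le> \<delta> * d" and n: "0 < n"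
    and S: "finite S" "card S \<le> n" and uv: "u \<noteq> v"
  shows "bexp p (pairs S) (\<lambda>G. of_bool (near G s u v)) \<le> (1 + \<delta>) * d ^ s / real n"
proof -
  have "bexp p (pairs S) (\<lambda>G. of_bool (near G s u v)) \<le> p * (\<Sum>t<s. (real (card S) * p) ^ t)"
    by (rule prob_near_le[OF p S(1) uv])
  also have "\<dots> \<le> p * (\<Sum>t<s. d ^ t)"
    using p S by (intro mult_left_mono sum_mono power_mono) (auto simp: d mult_right_mono)
  also have "\<dots> \<le> (1 + \<delta>) * d ^ s / real n"
  proof (cases s)
    case 0
    then show ?thesis using \<delta> by simp
  next
    case (Suc s')
    have "(\<Sum>t<s. d ^ t) \<le> (1 + \<delta>) * d ^ s'"
      using geometric_sum_le[OF \<delta>, of s'] by (simp add: Suc lessThan_Suc_atMost)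
    then have "p * (\<Sum>t<s. d ^ t) \<le> p * ((1 + \<delta>) * d ^ s')" using p by (intro mult_left_mono) auto
    also have "\<dots> = (1 + \<delta>) * d ^ s / real n" using n by (simp add: Suc d)
    finally show ?thesis .
  qed
  finally show ?thesis .
qed

lemma sum_union_le:
  fixes f :: "'a \<Rightarrow> real"
  assumes "finite A" "finite B" "\<And>x. 0 \<le> f x"
  shows "sum f (A \<union> B) \<le> sum f A + sum f B"
  using sum.union_inter[OF assms(1,2), of f] sum_nonneg[of "A \<inter> B" f] assms(3) by simp

text \<open>Extend a walk at its start by one vertex. If the new vertex is not on the walk and not prescribed, it can
  be chosen in \<open>n\<close> ways and its edge is new, which gives \<open>n p = d\<close>. If it belongs to
  \<open>S\<close>, there is no choice, so \<open>d\<close> is replaced by \<open>p = d / n\<close>; this is the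
  factor \<open>1 / n\<close> per prescribed vertex. If it repeats a vertex of the walk, the edge may be old, but
  there are at most \<open>L + 1\<close> choices. The factorial collects these numbers.\<close>

lemma sum_walks_visiting:
  fixes n p d :: real
  assumes p: "0 \<le> p" "p \<le> 1" and V: "finite V" "real (card V) \<le> n" and d: "d = n * p" "1 \<le> d"
    and "0 < n" "finite S" "card S \<le> 4" "a \<notin> S"
  shows "(\<Sum>w\<in>{w. length w = Suc L \<and> last w = a \<and> set w \<subseteq> V \<and> S \<subseteq> set w}. p ^ card (pedges w))
      \<le> fact (L + 5) * d ^ L / n ^ card S"
  using assms(8-10)
proof (induction L arbitrary: S)
  case 0
  have *: "{w. length w = Suc 0 \<and> last w = a \<and> set w \<subseteq> V \<and> S \<subseteq> set w} \<subseteq> (if S = {} then {[a]} else {})"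
    using 0 by (auto simp: length_Suc_conv)
  have "(\<Sum>w\<in>{w. length w = Suc 0 \<and> last w = a \<and> set w \<subseteq> V \<and> S \<subseteq> set w}. p ^ card (pedges w))
     \<le> (\<Sum>w\<in>(if S = {} then {[a]} else {}). p ^ card (pedges w))"
    by (rule sum_mono2) (use * p in auto)
  also have "\<dots> \<le> fact (0 + 5) * d ^ 0 / n ^ card S"
    using assms(7) by (auto simp: fact_numeral)
  finally show ?case .
next
  case (Suc L)
  let ?W = "\<lambda>L S. {w. length w = Suc L \<and> last w = a \<and> set w \<subseteq> V \<and> S \<subseteq> set w}"
  let ?wt = "\<lambda>w. p ^ card (pedges w)"
  have fin: "finite (?W L S)" for L S
    by (rule finite_subset[OF _ finite_lists_length_eq[OF V(1), of "Suc L"]]) auto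
  have fin2: "finite {w \<in> ?W L S. b \<notin> set w}" "finite (?W L S)" for L S b
    by (rule finite_subset[OF _ fin[of L S]]) (use fin[of L S] in auto)
  have wt: "?wt (b # w) \<le> (if b \<in> set w then 1 else p) * ?wt w" if "w \<noteq> []" for b w
  proof (cases "b \<in> set w")
    case True
    have "card (pedges w) \<le> card (pedges (b # w))"
      using that by (intro card_mono) (auto simp: pedges_Cons)
    then show ?thesis using True p by (simp add: power_decreasing)
  next
    case False
    then have "{b, hd w} \<notin> pedges w" using pedges_subset_Pow by blast
    then show ?thesis using False that by (simp add: pedges_Cons)
  qed
  have sub: "?W (Suc L) S \<subseteq> (\<lambda>(b, w). b # w) ` (V \<times> ?W L S) \<union>
      (\<Union>b\<in>S. (\<lambda>w. b # w) ` {w \<in> ?W L (S - {b}). b \<notin> set w})"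
  proof
    fix w' assume w': "w' \<in> ?W (Suc L) S"
    then obtain b w where w: "w' = b # w" "length w = Suc L" by (auto simp: length_Suc_conv)
    then have "w \<noteq> []" by auto
    then have w2: "last w = a" "b \<in> V" "set w \<subseteq> V" "S \<subseteq> insert b (set w)" using w' w by auto
    show "w' \<in> (\<lambda>(b, w). b # w) ` (V \<times> ?W L S) \<union>
      (\<Union>b\<in>S. (\<lambda>w. b # w) ` {w \<in> ?W L (S - {b}). b \<notin> set w})"
    proof (cases "S \<subseteq> set w")
      case True
      then show ?thesis using w w2 by auto
    next
      case False
      then have "b \<in> S" "b \<notin> set w" "S - {b} \<subseteq> set w" using w2 by auto
      then show ?thesis using w w2 by auto
    qed
  qed
  let ?B = "fact (L + 5) * d ^ L / n ^ card S"
  have "(\<Sum>w\<in>?W (Suc L) S. ?wt w) \<le> (\<Sum>w\<in>(\<lambda>(b, w). b # w) ` (V \<times> ?W L S) \<union>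
      (\<Union>b\<in>S. (\<lambda>w. b # w) ` {w \<in> ?W L (S - {b}). b \<notin> set w}). ?wt w)"
    by (rule sum_mono2[OF _ sub]) (use p fin2 V Suc.prems in auto)
  also have "\<dots> \<le> (\<Sum>w\<in>(\<lambda>(b, w). b # w) ` (V \<times> ?W L S). ?wt w) +
       (\<Sum>w\<in>(\<Union>b\<in>S. (\<lambda>w. b # w) ` {w \<in> ?W L (S - {b}). b \<notin> set w}). ?wt w)"
    by (rule sum_union_le) (use p fin2 V Suc.prems in auto)
  also have "\<dots> \<le> (\<Sum>w\<in>?W L S. \<Sum>b\<in>V. ?wt (b # w)) + (\<Sum>b\<in>S. \<Sum>w\<in>{w \<in> ?W L (S - {b}). b \<notin> set w}. ?wt (b # w))"
  proof (rule add_mono)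
    have "(\<Sum>w\<in>(\<lambda>(b, w). b # w) ` (V \<times> ?W L S). ?wt w) = (\<Sum>(b, w)\<in>V \<times> ?W L S. ?wt (b # w))"
      by (subst sum.reindex) (auto simp: inj_on_def case_prod_unfold)
    also have "\<dots> = (\<Sum>w\<in>?W L S. \<Sum>b\<in>V. ?wt (b # w))"
      by (subst sum.swap) (simp add: sum.cartesian_product)
    finally show "(\<Sum>w\<in>(\<lambda>(b, w). b # w) ` (V \<times> ?W L S). ?wt w) \<le> (\<Sum>w\<in>?W L S. \<Sum>b\<in>V. ?wt (b # w))" by simp
    have "(\<Sum>w\<in>(\<Union>b\<in>S. (\<lambda>w. b # w) ` {w \<in> ?W L (S - {b}). b \<notin> set w}). ?wt w)
       = (\<Sum>b\<in>S. \<Sum>w\<in>(\<lambda>w. b # w) ` {w \<in> ?W L (S - {b}). b \<notin> set w}. ?wt w)"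
      by (rule sum.UNION_disjoint) (use fin2 Suc.prems in auto)
    also have "\<dots> = (\<Sum>b\<in>S. \<Sum>w\<in>{w \<in> ?W L (S - {b}). b \<notin> set w}. ?wt (b # w))"
      by (rule sum.cong[OF refl], subst sum.reindex) (simp_all add: inj_on_def)
    finally show "(\<Sum>w\<in>(\<Union>b\<in>S. (\<lambda>w. b # w) ` {w \<in> ?W L (S - {b}). b \<notin> set w}). ?wt w)
       \<le> (\<Sum>b\<in>S. \<Sum>w\<in>{w \<in> ?W L (S - {b}). b \<notin> set w}. ?wt (b # w))" by simp
  qed
  also have "\<dots> \<le> (real L + 1 + d) * ?B + 4 * (d * ?B)"
  proof (rule add_mono)
    have "(\<Sum>b\<in>V. ?wt (b # w)) \<le> (real L + 1 + d) * ?wt w" if w: "w \<in> ?W L S" for w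
    proof -
      have ne: "w \<noteq> []" using w by auto
      have "(\<Sum>b\<in>V. ?wt (b # w)) \<le> (\<Sum>b\<in>V. (of_bool (b \<in> set w) + p) * ?wt w)"
        by (intro sum_mono order_trans[OF wt[OF ne]] mult_right_mono) (use p in auto)
      also have "\<dots> = (\<Sum>b\<in>V. of_bool (b \<in> set w) + p) * ?wt w" by (simp add: sum_distrib_right)
      also have "\<dots> \<le> (real L + 1 + d) * ?wt w"
      proof (rule mult_right_mono)
        have "(\<Sum>b\<in>V. of_bool (b \<in> set w) + p) = real (card (V \<inter> {b. b \<in> set w})) + real (card V) * p"
          using V by (simp add: sum.distrib sum_of_bool_eq)
        also have "card (V \<inter> {b. b \<in> set w}) \<le> Suc L"
          using w card_length[of w] card_mono[of "set w" "V \<inter> {b. b \<in> set w}"] by auto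
        also have "real (card V) * p \<le> d" using V p d by (simp add: mult_right_mono)
        finally show "(\<Sum>b\<in>V. of_bool (b \<in> set w) + p) \<le> real L + 1 + d" by simp
      qed (use p in auto)
      finally show ?thesis .
    qed
    then have "(\<Sum>w\<in>?W L S. \<Sum>b\<in>V. ?wt (b # w)) \<le> (real L + 1 + d) * (\<Sum>w\<in>?W L S. ?wt w)"
      unfolding sum_distrib_left by (intro sum_mono) simp
    also have "\<dots> \<le> (real L + 1 + d) * ?B"
      using Suc.prems d by (intro mult_left_mono Suc.IH) auto
    finally show "(\<Sum>w\<in>?W L S. \<Sum>b\<in>V. ?wt (b # w)) \<le> (real L + 1 + d) * ?B" .
    have "(\<Sum>w\<in>{w \<in> ?W L (S - {b}). b \<notin> set w}. ?wt (b # w)) \<le> d * ?B" if b: "b \<in> S" for b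
    proof -
      have "(\<Sum>w\<in>{w \<in> ?W L (S - {b}). b \<notin> set w}. ?wt (b # w)) \<le> (\<Sum>w\<in>{w \<in> ?W L (S - {b}). b \<notin> set w}. p * ?wt w)"
      proof (rule sum_mono)
        fix w assume "w \<in> {w \<in> ?W L (S - {b}). b \<notin> set w}"
        then have "w \<noteq> []" "b \<notin> set w" by auto
        then show "?wt (b # w) \<le> p * ?wt w" using wt[of w b] by simp
      qed
      also have "\<dots> \<le> (\<Sum>w\<in>?W L (S - {b}). p * ?wt w)"
        by (rule sum_mono2) (use fin p in auto)
      also have "\<dots> = p * (\<Sum>w\<in>?W L (S - {b}). ?wt w)" by (simp add: sum_distrib_left)
      also have "\<dots> \<le> p * (fact (L + 5) * d ^ L / n ^ card (S - {b}))"
        proof (intro mult_left_mono Suc.IH)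
        show "card (S - {b}) \<le> 4" using card_Diff1_le[of S b] Suc.prems(2) by linarith
      qed (use Suc.prems p in simp_all)
      also have "\<dots> = d * ?B"
      proof -
        have "card S = Suc (card (S - {b}))" using b Suc.prems(1) by (metis card.remove)
        then show ?thesis using assms(7) by (simp add: d)
      qed
      finally show ?thesis .
    qed
    then have "(\<Sum>b\<in>S. \<Sum>w\<in>{w \<in> ?W L (S - {b}). b \<notin> set w}. ?wt (b # w)) \<le> real (card S) * (d * ?B)"
      using sum_bounded_above[of S _ "d * ?B"] by simp
    also have "\<dots> \<le> 4 * (d * ?B)"
      using Suc.prems d assms(7) by (intro mult_right_mono) auto
    finally show "(\<Sum>b\<in>S. \<Sum>w\<in>{w \<in> ?W L (S - {b}). b \<notin> set w}. ?wt (b # w)) \<le> 4 * (d * ?B)" .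
  qed
  also have "\<dots> = (real L + 1 + 5 * d) * ?B"
  proof -
    have "(real L + 1 + d) * B + 4 * (d * B) = (real L + 1 + 5 * d) * B" for B by (simp add: algebra_simps)
    then show ?thesis .
  qed
  also have "\<dots> \<le> ((real L + 6) * d) * ?B"
  proof (rule mult_right_mono)
    \<comment> \<open>\<open>d \<ge> 1\<close> absorbs the steps back into the walk\<close>
    have "real L + 1 \<le> (real L + 1) * d" using d by (simp add: mult_le_cancel_left1)
    then show "real L + 1 + 5 * d \<le> (real L + 6) * d" by (simp add: algebra_simps)
  qed (use d assms(7) in auto)
  also have "\<dots> = fact (Suc L + 5) * d ^ Suc L / n ^ card S"
  proof -
    have "fact (Suc L + 5) = (real L + 6) * fact (L + 5)"
      using fact_Suc[of "L + 5", where 'a = real] by (simp add: algebra_simps)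
    then show ?thesis by simp
  qed
  finally show ?case .
qed

text \<open>Connected configurations of several short paths are bounded by a single walk through all their vertices.
  \<open>visits\<close> records such a walk from \<open>b\<close> to \<open>a\<close>, and \<open>visits_near\<close>
  extends it.\<close>

definition visits :: "nat set set \<Rightarrow> nat \<Rightarrow> nat \<Rightarrow> nat \<Rightarrow> nat set \<Rightarrow> bool" where
  "visits G L a b S \<longleftrightarrow> (\<exists>w. w \<noteq> [] \<and> hd w = b \<and> last w = a \<and> length w \<le> Suc L \<and> pedges w \<subseteq> G \<and> S \<subseteq> set w)"

lemma visits_start: "visits G 0 a a {a}"
  unfolding visits_def by (intro exI[of _ "[a]"]) auto

lemma visits_near:
  assumes "visits G L a b S" "near G l b c"
  shows "visits G (L + l) a c (insert c S)"
proof -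
  obtain w where w: "w \<noteq> []" "hd w = b" "last w = a" "length w \<le> Suc L" "pedges w \<subseteq> G" "S \<subseteq> set w"
    using assms(1) unfolding visits_def by auto
  have "near G l c b" using assms(2) by (rule near_sym)
  then show ?thesis
  proof (induction l arbitrary: c)
    case 0
    then show ?case using w unfolding visits_def by (intro exI[of _ w]) (auto simp: hd_in_set)
  next
    case (Suc l)
    show ?case
    proof (cases "c = b")
      case True
      then show ?thesis using w unfolding visits_def by (intro exI[of _ w]) (auto simp: hd_in_set)
    next
      case False
      then obtain c' where c': "{c, c'} \<in> G" "near G l c' b" using Suc.prems by auto
      obtain w' where w': "w' \<noteq> []" "hd w' = c'" "last w' = a" "length w' \<le> Suc (L + l)" "pedges w' \<subseteq> G" "insert c' S \<subseteq> set w'"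
        using Suc.IH[OF c'(2)] unfolding visits_def by auto
      then show ?thesis using c' unfolding visits_def
        by (intro exI[of _ "c # w'"]) (auto simp: pedges_Cons)
    qed
  qed
qed

lemma visits_mono: "visits G L a b S \<Longrightarrow> G \<subseteq> G' \<Longrightarrow> L \<le> L' \<Longrightarrow> S' \<subseteq> S \<Longrightarrow> visits G' L' a b S'"
  unfolding visits_def
  apply (elim exE)
  subgoal for w by (intro exI[of _ w]) auto
  done

lemma prob_visits_le:
  fixes n p d :: real
  assumes p: "0 \<le> p" "p \<le> 1" and V: "finite V" "real (card V) \<le> n" and d: "d = n * p" "1 \<le> d"
    and n: "0 < n" and S: "finite S" "card S \<le> 4" "a \<notin> S" and a: "a \<in> V"
  shows "bexp p (pairs V) (\<lambda>G. of_bool (\<exists>b. visits G L a b S)) \<le> (real L + 1) * fact (L + 5) * d ^ L / n ^ card S"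
proof -
  let ?W = "\<lambda>L. {w. length w = Suc L \<and> last w = a \<and> set w \<subseteq> V \<and> S \<subseteq> set w}"
  have fin: "finite (?W L)" for L
    by (rule finite_subset[OF _ finite_lists_length_eq[OF V(1), of "Suc L"]]) auto
  have "bexp p (pairs V) (\<lambda>G. of_bool (\<exists>b. visits G L a b S))
     \<le> (\<Sum>i\<in>(SIGMA l:{..L}. ?W l). bexp p (pairs V) (\<lambda>G. of_bool (pedges (snd i) \<subseteq> G)))"
  proof (rule bexp_union_bound[OF p])
    fix G assume G: "G \<subseteq> pairs V" and "\<exists>b. visits G L a b S"
    then obtain w where w: "w \<noteq> []" "last w = a" "length w \<le> Suc L" "pedges w \<subseteq> G" "S \<subseteq> set w"
      unfolding visits_def by auto
    have "set w \<subseteq> V"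
      using w(1,2,4)
    proof (induction w rule: pedges.induct)
      case (1 a b ws)
      then have "{a, b} \<in> pairs V" using G by auto
      then have "a \<in> V" by (simp add: doubleton_in_pairs)
      then show ?case using 1 by simp
    qed (use a in simp_all)
    then have "(length w - 1, w) \<in> (SIGMA l:{..L}. ?W l)" using w by (cases w) simp_all
    then show "\<exists>i\<in>(SIGMA l:{..L}. ?W l). pedges (snd i) \<subseteq> G"
      by (rule bexI[rotated]) (simp add: w)
  qed (use fin V in auto)
  also have "\<dots> \<le> (\<Sum>i\<in>(SIGMA l:{..L}. ?W l). p ^ card (pedges (snd i)))"
    by (intro sum_mono bexp_superset_le) (use p V in auto)
  also have "\<dots> = (\<Sum>l\<le>L. \<Sum>w\<in>?W l. p ^ card (pedges w))"
    using sum.Sigma[of "{..L}" ?W "\<lambda>l w. p ^ card (pedges w)"] fin by (simp add: case_prod_unfold)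
  also have "\<dots> \<le> (\<Sum>l\<le>L. fact (l + 5) * d ^ l / n ^ card S)"
    by (intro sum_mono sum_walks_visiting assms)
  also have "\<dots> \<le> (\<Sum>l\<le>L. fact (L + 5) * d ^ L / n ^ card S)"
  proof (intro sum_mono divide_right_mono mult_mono)
    fix l assume "l \<in> {..L}"
    then show "fact (l + 5) \<le> (fact (L + 5) :: real)" "d ^ l \<le> d ^ L"
      using d by (auto intro!: fact_mono power_increasing)
  qed (use n d in auto)
  finally show ?thesis by (simp add: algebra_simps)
qed

lemma edge_in_vertices: "G \<subseteq> pairs S \<Longrightarrow> {a, b} \<in> G \<Longrightarrow> a \<in> S \<and> b \<in> S \<and> a \<noteq> b"
  using doubleton_in_pairs by blast

definition deg :: "nat set set \<Rightarrow> nat \<Rightarrow> nat" where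
  "deg G v = card {w. {v, w} \<in> G}"

lemma finite_nbrs: "G \<subseteq> pairs S \<Longrightarrow> finite S \<Longrightarrow> finite {w. {v, w} \<in> G}"
  by (rule finite_subset[of _ S]) (auto dest: edge_in_vertices)

text \<open>The Chernoff bound, by exponential moments with base \<open>1 + \<delta>\<close>.\<close>

lemma prob_deg_large:
  fixes \<delta> d p :: real
  assumes p: "0 \<le> p" "p \<le> 1" and S: "finite S" and d: "real (card S) * p \<le> d" and \<delta>: "0 < \<delta>"
  shows "bexp p (pairs S) (\<lambda>G. of_bool ((1 + \<delta>) * d \<le> real (deg G v)))
     \<le> exp (- d * ((1 + \<delta>) * ln (1 + \<delta>) - \<delta>))"
proof -
  let ?F = "(\<lambda>w. {v, w}) ` {w\<in>S. w \<noteq> v \<and> v \<in> S}"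
  have F: "?F \<subseteq> pairs S" by (auto simp: doubleton_in_pairs)
  have cF: "card ?F \<le> card S"
    by (rule order_trans[OF card_image_le card_mono]) (use S in auto)
  have degF: "deg G v = card (G \<inter> ?F)" if "G \<subseteq> pairs S" for G
  proof -
    have "G \<inter> ?F = (\<lambda>w. {v, w}) ` {w. {v, w} \<in> G}"
      by (auto dest: edge_in_vertices[OF that])
    moreover have "inj_on (\<lambda>w. {v, w}) {w. {v, w} \<in> G}"
      by (auto simp: inj_on_def doubleton_eq_iff)
    ultimately show ?thesis by (simp add: deg_def card_image)
  qed
  let ?t = "(1 + \<delta>) powr ((1 + \<delta>) * d)"
  have "bexp p (pairs S) (\<lambda>G. of_bool ((1 + \<delta>) * d \<le> real (deg G v)))
     \<le> bexp p (pairs S) (\<lambda>G. of_bool (?t \<le> (1 + \<delta>) ^ card (G \<inter> ?F)))"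
  proof (rule bexp_mono[OF p])
    fix G assume G: "G \<subseteq> pairs S"
    have "?t \<le> (1 + \<delta>) ^ card (G \<inter> ?F)" if "(1 + \<delta>) * d \<le> real (deg G v)"
    proof -
      have "?t \<le> (1 + \<delta>) powr real (card (G \<inter> ?F))"
        using that \<delta> degF[OF G] by (intro powr_mono) auto
      then show ?thesis using \<delta> by (simp add: powr_realpow)
    qed
    then show "of_bool ((1 + \<delta>) * d \<le> real (deg G v)) \<le> (of_bool (?t \<le> (1 + \<delta>) ^ card (G \<inter> ?F)) :: real)"
      by auto
  qed
  also have "\<dots> \<le> bexp p (pairs S) (\<lambda>G. (1 + \<delta>) ^ card (G \<inter> ?F)) / ?t"
    by (rule bexp_markov) (use p S \<delta> in auto)
  also have "bexp p (pairs S) (\<lambda>G. (1 + \<delta>) ^ card (G \<inter> ?F)) = (1 + p * \<delta>) ^ card ?F"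
    using S by (subst bexp_power_card[OF _ F]) (auto simp: algebra_simps)
  also have "\<dots> \<le> (1 + p * \<delta>) ^ card S"
    using cF p \<delta> by (intro power_increasing) auto
  also have "\<dots> \<le> exp (p * \<delta>) ^ card S"
    using p \<delta> by (intro power_mono) auto
  also have "\<dots> = exp (\<delta> * (real (card S) * p))" by (simp add: exp_of_nat_mult[symmetric] algebra_simps)
  also have "\<dots> \<le> exp (\<delta> * d)" using d \<delta> by simp
  also have "exp (\<delta> * d) / ?t = exp (- d * ((1 + \<delta>) * ln (1 + \<delta>) - \<delta>))"
    using \<delta> unfolding powr_def by (simp add: exp_diff[symmetric]) (simp add: algebra_simps)
  finally show ?thesis using \<delta> by (simp add: divide_right_mono)
qed

lemma card_ball_le:
  fixes m :: real
  assumes G: "G \<subseteq> pairs S" "finite S" and m: "\<And>v. real (deg G v) \<le> m"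
  shows "finite {b. near G j v b} \<and> real (card {b. near G j v b}) \<le> (\<Sum>i\<le>j. m ^ i)"
proof (induction j arbitrary: v)
  case (Suc j)
  have "0 \<le> m" using m[of 0] by linarith
  let ?N = "{w. {v, w} \<in> G}"
  have fN: "finite ?N" using finite_nbrs G by auto
  have eq: "{b. near G (Suc j) v b} = insert v (\<Union>w\<in>?N. {b. near G j w b})" by auto
  have fin: "finite (\<Union>w\<in>?N. {b. near G j w b})" using Suc fN by auto
  have "real (card {b. near G (Suc j) v b}) \<le> 1 + real (card (\<Union>w\<in>?N. {b. near G j w b}))"
    unfolding eq using fin by (simp add: card_insert_if)
  also have "real (card (\<Union>w\<in>?N. {b. near G j w b})) \<le> real (\<Sum>w\<in>?N. card {b. near G j w b})"
    using card_UN_le[OF fN] by (simp only: of_nat_le_iff)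
  also have "\<dots> \<le> (\<Sum>w\<in>?N. (\<Sum>i\<le>j. m ^ i))"
    unfolding of_nat_sum using Suc by (intro sum_mono) auto
  also have "\<dots> = real (deg G v) * (\<Sum>i\<le>j. m ^ i)" by (simp add: deg_def)
  also have "\<dots> \<le> m * (\<Sum>i\<le>j. m ^ i)"
    using m \<open>0 \<le> m\<close> by (intro mult_right_mono sum_nonneg) auto
  also have "1 + m * (\<Sum>i\<le>j. m ^ i) = (\<Sum>i\<le>Suc j. m ^ i)"
    by (simp add: sum.atMost_Suc_shift sum_distrib_left del: sum.atMost_Suc)
  finally show ?case using eq fin by auto
next
  case 0
  have "{b. near G 0 v b} = {v}" by auto
  then show ?case by simp
qed

section \<open>Janson's inequality for paths\<close>

text \<open>Two different paths of the same length from \<open>a\<close> have different edge sets. In the second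
  moment, a path different from a given one therefore always leaves it, which is where a factor \<open>1 / D\<close>
  is gained.\<close>

lemma path_determined_by_edges:
  assumes "distinct (a # w)" "distinct (a # w')" "pedges (a # w') \<subseteq> pedges (a # w)" "length w' = length w"
  shows "w' = w"
proof -
  have "w' = take (length w') w"
    using assms(1-3)
  proof (induction w' arbitrary: a w)
    case (Cons b w'')
    have "{a, b} \<in> pedges (a # w)" using Cons.prems by simp
    then obtain c ws where w: "w = c # ws" by (cases w) auto
    have "{a, b} \<notin> pedges (c # ws)" using pedges_subset_Pow[of "{a, b}" "c # ws"] Cons.prems w by auto
    then have "{a, b} = {a, c}" using \<open>{a, b} \<in> pedges (a # w)\<close> w by simp
    then have bc: "b = c" by (auto simp: doubleton_eq_iff)
    have "e \<in> pedges (b # ws)" if "e \<in> pedges (b # w'')" for e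
    proof -
      have "a \<notin> e" using pedges_subset_Pow[OF that] Cons.prems by auto
      moreover have "e \<in> pedges (a # b # ws)" using that Cons.prems(3) w bc by auto
      ultimately show ?thesis by auto
    qed
    then show ?case using Cons.IH[of b ws] Cons.prems w bc by auto
  qed simp
  then show ?thesis using assms(4) by simp
qed

text \<open>Walks with \<open>t\<close> inner vertices in \<open>V0\<close> and end in \<open>Z\<close>, without their
  starting point. Distinctness is not demanded here: it is imposed for the count from below and dropped for the bounds
  from above, which are then plain recursions.\<close>

primrec walks_to :: "nat set \<Rightarrow> nat set \<Rightarrow> nat \<Rightarrow> nat list set" where
  "walks_to V0 Z 0 = (\<lambda>z. [z]) ` Z"
| "walks_to V0 Z (Suc t) = (\<lambda>(b, w). b # w) ` (V0 \<times> walks_to V0 Z t)"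

lemma finite_walks_to: "finite V0 \<Longrightarrow> finite Z \<Longrightarrow> finite (walks_to V0 Z t)"
  by (induction t) auto

lemma walks_to_iff: "w \<in> walks_to V0 Z t \<longleftrightarrow> (\<exists>xs z. w = xs @ [z] \<and> set xs \<subseteq> V0 \<and> length xs = t \<and> z \<in> Z)"
proof (induction t arbitrary: w)
  case (Suc t)
  show ?case
  proof
    assume "w \<in> walks_to V0 Z (Suc t)"
    then obtain b w' where w: "w = b # w'" "b \<in> V0" "w' \<in> walks_to V0 Z t" by auto
    then obtain xs z where "w' = xs @ [z]" "set xs \<subseteq> V0" "length xs = t" "z \<in> Z" using Suc by blast
    then show "\<exists>xs z. w = xs @ [z] \<and> set xs \<subseteq> V0 \<and> length xs = Suc t \<and> z \<in> Z"
      using w by (intro exI[of _ "b # xs"] exI[of _ z]) simp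
  next
    assume "\<exists>xs z. w = xs @ [z] \<and> set xs \<subseteq> V0 \<and> length xs = Suc t \<and> z \<in> Z"
    then obtain xs z where w: "w = xs @ [z]" "set xs \<subseteq> V0" "length xs = Suc t" "z \<in> Z" by blast
    then obtain b ys where xs: "xs = b # ys" by (cases xs) auto
    then have "ys @ [z] \<in> walks_to V0 Z t" using w Suc[of "ys @ [z]"] by auto
    then show "w \<in> walks_to V0 Z (Suc t)" using w xs by force
  qed
qed (auto simp: image_iff)

lemma walks_to_ne: "w \<in> walks_to V0 Z t \<Longrightarrow> w \<noteq> []"
  by (cases t) auto

lemma length_walks_to: "w \<in> walks_to V0 Z t \<Longrightarrow> length w = Suc t"
  by (induction t arbitrary: w) auto

lemma card_walks_to_le:
  assumes "finite V0" "finite Z"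
  shows "card (walks_to V0 Z t) \<le> card V0 ^ t * card Z"
proof (induction t)
  case (Suc t)
  have "card (walks_to V0 Z (Suc t)) \<le> card (V0 \<times> walks_to V0 Z t)"
    unfolding walks_to.simps using assms finite_walks_to by (intro card_image_le) auto
  also have "\<dots> = card V0 * card (walks_to V0 Z t)" by (simp add: card_cartesian_product)
  also have "\<dots> \<le> card V0 * (card V0 ^ t * card Z)" using Suc by (rule mult_le_mono2)
  finally show ?case by simp
qed (simp add: card_image_le assms)

lemma sum_walks_to_Suc:
  "(\<Sum>w\<in>walks_to V0 Z (Suc t). f w) = (\<Sum>b\<in>V0. \<Sum>w\<in>walks_to V0 Z t. f (b # w))"
proof -
  have "(\<Sum>w\<in>walks_to V0 Z (Suc t). f w) = (\<Sum>(b, w)\<in>V0 \<times> walks_to V0 Z t. f (b # w))"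
    unfolding walks_to.simps by (subst sum.reindex) (auto simp: inj_on_def case_prod_unfold)
  then show ?thesis by (simp add: sum.cartesian_product)
qed

text \<open>For a walk with distinct vertices this is the probability that it is present given that the edges in
  \<open>P\<close> are (\<open>cond_weight_distinct\<close>). For other walks it counts repeated edges repeatedly,
  which keeps it multiplicative.\<close>

fun cond_weight :: "nat set set \<Rightarrow> real \<Rightarrow> nat list \<Rightarrow> real" where
  "cond_weight P p (a # b # w) = (if {a, b} \<in> P then 1 else p) * cond_weight P p (b # w)"
| "cond_weight P p _ = 1"

lemma cond_weight_nonneg: "0 \<le> p \<Longrightarrow> 0 \<le> cond_weight P p w"
  by (induction P p w rule: cond_weight.induct) auto

lemma cond_weight_eq_1: "pedges w \<subseteq> P \<Longrightarrow> cond_weight P p w = 1"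
  by (induction P p w rule: cond_weight.induct) auto

lemma cond_weight_distinct: "distinct w \<Longrightarrow> p ^ card (pedges w - P) = cond_weight P p w"
proof (induction w rule: pedges.induct)
  case (1 a b w)
  have "{a, b} \<notin> pedges (b # w)" using 1 pedges_subset_Pow[of "{a,b}" "b # w"] by auto
  then show ?case using 1 by (auto simp: insert_Diff_if)
qed auto

text \<open>Let \<open>P\<close> be the edge set of a path on at most \<open>m\<close> vertices. The three sums below
  measure the walks from \<open>a\<close> to \<open>Z\<close> by their overlap with \<open>P\<close>. Walks with all
  edges in \<open>P\<close> have weight one each, but there are few of these. The walks that leave \<open>P\<close>
  have total weight of order \<open>J p D\<^sup>t\<close>, where \<open>J = |Z|\<close>, as if \<open>P\<close> were
  absent. Those that moreover share an edge with \<open>P\<close> have \<open>O(1)\<close> choices instead of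
  \<open>D\<close> at some step, hence a total weight smaller by a factor \<open>D\<close>. Each sum is estimated by
  recursion over the first step, whose edge is either in \<open>P\<close> (at most \<open>m\<close> choices) or not
  (weight \<open>p\<close>).\<close>

context
  fixes V0 Z :: "nat set" and P :: "nat set set" and p D :: real and U :: "nat set" and m :: nat
  assumes fin: "finite V0" "finite Z" and p: "0 \<le> p" "p \<le> 1"
    and D: "D = real (card V0) * p" "1 \<le> D" and J: "1 \<le> card Z"
    and P: "\<forall>e\<in>P. e \<subseteq> U" "finite U" "card U \<le> m"
begin

definition "walks_inside t a = (\<Sum>w\<in>walks_to V0 Z t. of_bool (pedges (a # w) \<subseteq> P) :: real)"
definition "walks_leaving t a = (\<Sum>w\<in>walks_to V0 Z t. of_bool (\<not> pedges (a # w) \<subseteq> P) * cond_weight P p (a # w))"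
definition "walks_mixed t a = (\<Sum>w\<in>walks_to V0 Z t. of_bool (\<not> pedges (a # w) \<subseteq> P \<and> pedges (a # w) \<inter> P \<noteq> {}) * cond_weight P p (a # w))"

lemma card_P_nbrs: "finite {b. {a, b} \<in> P}" "card {b. {a, b} \<in> P} \<le> m"
proof -
  have sub: "{b. {a, b} \<in> P} \<subseteq> U" using P(1) by blast
  show "finite {b. {a, b} \<in> P}" using sub P(2) finite_subset by blast
  show "card {b. {a, b} \<in> P} \<le> m" using card_mono[OF P(2) sub] P(3) by linarith
qed

lemma sum_P_nbrs_le:
  assumes "\<And>b. f b \<le> c" "0 \<le> (c::real)"
  shows "(\<Sum>b\<in>V0. of_bool ({a, b} \<in> P) * f b) \<le> real m * c"
proof -
  have "(\<Sum>b\<in>V0. of_bool ({a, b} \<in> P) * f b) \<le> (\<Sum>b\<in>V0. of_bool ({a, b} \<in> P) * c)"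
    by (intro sum_mono mult_left_mono assms) auto
  also have "\<dots> = real (card (V0 \<inter> {b. {a, b} \<in> P})) * c"
    using fin by (simp add: sum_distrib_right[symmetric] sum_of_bool_eq)
  also have "\<dots> \<le> real m * c"
  proof (rule mult_right_mono)
    have "card (V0 \<inter> {b. {a, b} \<in> P}) \<le> card {b. {a, b} \<in> P}"
      by (intro card_mono card_P_nbrs) auto
    then show "real (card (V0 \<inter> {b. {a, b} \<in> P})) \<le> real m" using card_P_nbrs(2)[of a] by linarith
  qed (rule assms)
  finally show ?thesis .
qed

lemma walks_inside_nonneg: "0 \<le> walks_inside t a" unfolding walks_inside_def by (intro sum_nonneg) auto

lemma walks_inside_Suc: "walks_inside (Suc t) a = (\<Sum>b\<in>V0. of_bool ({a, b} \<in> P) * walks_inside t b)"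
  unfolding walks_inside_def sum_walks_to_Suc sum_distrib_left
  by (intro sum.cong refl) (simp add: pedges_Cons walks_to_ne)

lemma walks_inside_le: "walks_inside t a \<le> of_bool (a \<in> U) * real m ^ Suc t"
proof (induction t arbitrary: a)
  case 0
  show ?case
  proof (cases "a \<in> U")
    case True
    have "walks_inside 0 a = (\<Sum>z\<in>Z. of_bool ({a, z} \<in> P))"
      unfolding walks_inside_def walks_to.simps by (subst sum.reindex) (auto simp: inj_on_def)
    also have "\<dots> = real (card (Z \<inter> {b. {a, b} \<in> P}))" using fin by (simp add: sum_of_bool_eq)
    also have "card (Z \<inter> {b. {a, b} \<in> P}) \<le> card {b. {a, b} \<in> P}"
      by (intro card_mono card_P_nbrs) auto
    finally show ?thesis using True card_P_nbrs(2)[of a] by simp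
  next
    case False
    have "walks_inside 0 a = (\<Sum>w\<in>walks_to V0 Z 0. 0)"
      unfolding walks_inside_def
    proof (rule sum.cong[OF refl])
      fix w assume "w \<in> walks_to V0 Z 0"
      then obtain z where "w = [z]" by auto
      then show "of_bool (pedges (a # w) \<subseteq> P) = (0::real)" using False P(1)[THEN bspec, of "{a, z}"] by auto
    qed
    then show ?thesis using False by simp
  qed
next
  case (Suc t)
  show ?case
  proof (cases "a \<in> U")
    case True
    have "walks_inside t b \<le> real m ^ Suc t" for b
      using Suc.IH[of b] by (cases "b \<in> U") (auto intro: order_trans)
    then show ?thesis unfolding walks_inside_Suc
      using sum_P_nbrs_le[of "walks_inside t" "real m ^ Suc t" a] True by simp
  next
    case False
    have "{a, b} \<notin> P" for b using P(1)[THEN bspec, of "{a, b}"] False by auto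
    then show ?thesis unfolding walks_inside_Suc using False by simp
  qed
qed

lemma sum_walks_inside_le: "(\<Sum>b\<in>V0. walks_inside t b) \<le> real m ^ Suc (Suc t)"
proof -
  have "(\<Sum>b\<in>V0. walks_inside t b) \<le> (\<Sum>b\<in>V0. of_bool (b \<in> U) * real m ^ Suc t)"
    by (intro sum_mono walks_inside_le)
  also have "\<dots> = real (card (V0 \<inter> U)) * real m ^ Suc t"
    using fin by (simp add: sum_distrib_right[symmetric] sum_of_bool_eq)
  also have "card (V0 \<inter> U) \<le> card U" by (intro card_mono P(2)) auto
  then have "real (card (V0 \<inter> U)) * real m ^ Suc t \<le> real m * real m ^ Suc t"
    using P(3) by (intro mult_right_mono) auto
  finally show ?thesis by simp
qed

lemma step_le:
  assumes "\<And>b. f b \<le> c1" "0 \<le> c1" "\<And>b. g b \<le> c2" "0 \<le> c2" "\<And>b. 0 \<le> g b"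
  shows "(\<Sum>b\<in>V0. of_bool ({a, b} \<in> P) * f b + of_bool ({a, b} \<notin> P) * (p * (g b + walks_inside t b)))
     \<le> real m * c1 + D * c2 + p * real m ^ Suc (Suc t)"
proof -
  have "(\<Sum>b\<in>V0. of_bool ({a, b} \<in> P) * f b + of_bool ({a, b} \<notin> P) * (p * (g b + walks_inside t b)))
      \<le> (\<Sum>b\<in>V0. of_bool ({a, b} \<in> P) * f b) + (\<Sum>b\<in>V0. p * c2) + p * (\<Sum>b\<in>V0. walks_inside t b)"
  proof -
    have "of_bool ({a, b} \<notin> P) * (p * (g b + walks_inside t b)) \<le> p * c2 + p * walks_inside t b" for b
    proof -
      have "of_bool ({a, b} \<notin> P) * (p * (g b + walks_inside t b)) \<le> p * (g b + walks_inside t b)"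
        using p assms(5)[of b] walks_inside_nonneg[of t b] by (cases "{a, b} \<in> P") auto
      also have "\<dots> \<le> p * (c2 + walks_inside t b)" using p assms(3)[of b] by (intro mult_left_mono) auto
      finally show ?thesis by (simp add: distrib_left)
    qed
    then show ?thesis
      unfolding sum.distrib[symmetric] sum_distrib_left by (intro sum_mono) (simp add: add.assoc add_left_mono)
  qed
  also have "\<dots> \<le> real m * c1 + D * c2 + p * real m ^ Suc (Suc t)"
    using sum_P_nbrs_le[of f c1 a] assms sum_walks_inside_le[of t] p D
    by (intro add_mono mult_left_mono) auto
  finally show ?thesis .
qed

lemma walks_leaving_nonneg: "0 \<le> walks_leaving t a"
  unfolding walks_leaving_def using p by (intro sum_nonneg mult_nonneg_nonneg cond_weight_nonneg) auto

lemma walks_mixed_nonneg: "0 \<le> walks_mixed t a"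
  unfolding walks_mixed_def using p by (intro sum_nonneg mult_nonneg_nonneg cond_weight_nonneg) auto

lemma walks_leaving_Suc:
  "walks_leaving (Suc t) a = (\<Sum>b\<in>V0. of_bool ({a, b} \<in> P) * walks_leaving t b + of_bool ({a, b} \<notin> P) * (p * (walks_leaving t b + walks_inside t b)))"
  unfolding walks_leaving_def walks_inside_def sum_walks_to_Suc sum_distrib_left sum.distrib[symmetric]
proof (intro sum.cong refl)
  fix b w assume "w \<in> walks_to V0 Z t"
  show "of_bool (\<not> pedges (a # b # w) \<subseteq> P) * cond_weight P p (a # b # w) =
       of_bool ({a, b} \<in> P) * (of_bool (\<not> pedges (b # w) \<subseteq> P) * cond_weight P p (b # w)) +
       of_bool ({a, b} \<notin> P) * (p * (of_bool (\<not> pedges (b # w) \<subseteq> P) * cond_weight P p (b # w) + of_bool (pedges (b # w) \<subseteq> P)))"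
    using cond_weight_eq_1[of "b # w" P p] by (cases "{a, b} \<in> P"; cases "pedges (b # w) \<subseteq> P") simp_all
qed

lemma walks_mixed_Suc:
  "walks_mixed (Suc t) a = (\<Sum>b\<in>V0. of_bool ({a, b} \<in> P) * walks_leaving t b + of_bool ({a, b} \<notin> P) * (p * (walks_mixed t b + walks_inside t b)))"
  unfolding walks_mixed_def walks_leaving_def walks_inside_def sum_walks_to_Suc sum_distrib_left sum.distrib[symmetric]
proof (intro sum.cong refl)
  fix b w assume "w \<in> walks_to V0 Z t"
  then have ne: "pedges (b # w) \<noteq> {}" using walks_to_ne by (cases w) auto
  show "of_bool (\<not> pedges (a # b # w) \<subseteq> P \<and> pedges (a # b # w) \<inter> P \<noteq> {}) * cond_weight P p (a # b # w) =
       of_bool ({a, b} \<in> P) * (of_bool (\<not> pedges (b # w) \<subseteq> P) * cond_weight P p (b # w)) +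
       of_bool ({a, b} \<notin> P) * (p * (of_bool (\<not> pedges (b # w) \<subseteq> P \<and> pedges (b # w) \<inter> P \<noteq> {}) * cond_weight P p (b # w)
           + of_bool (pedges (b # w) \<subseteq> P)))"
  proof (cases "{a, b} \<in> P")
    case False
    have "pedges (b # w) \<inter> P \<noteq> {}" if "pedges (b # w) \<subseteq> P" using that ne by blast
    then show ?thesis using False cond_weight_eq_1[of "b # w" P p]
      by (cases "pedges (b # w) \<subseteq> P") simp_all
  qed simp
qed

lemma const_step:
  "real m * (real (2 * m + 1)) ^ (t + 2) + real (2 * m + 1) ^ (t + 2) + real m ^ Suc (Suc t) \<le> real (2 * m + 1) ^ (Suc t + 2)"
proof -
  have "real m ^ Suc (Suc t) \<le> real (2 * m + 1) ^ (t + 2)"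
    by (simp only: add_2_eq_Suc') (intro power_mono, auto)
  moreover have "real m ^ Suc (Suc t) \<le> real m * real (2 * m + 1) ^ (t + 2)"
  proof -
    have "real m ^ Suc t \<le> real (2 * m + 1) ^ Suc t" by (intro power_mono) auto
    also have "\<dots> \<le> real (2 * m + 1) ^ (t + 2)" by (intro power_increasing) auto
    finally show ?thesis by (simp add: mult_left_mono)
  qed
  ultimately show ?thesis by (simp add: algebra_simps)
qed

lemma walks_leaving_le: "walks_leaving t a \<le> real (2 * m + 1) ^ (t + 2) * (real (card Z) * p * D ^ t)"
proof (induction t arbitrary: a)
  case 0
  have "walks_leaving 0 a = (\<Sum>z\<in>Z. of_bool ({a, z} \<notin> P) * p)"
    unfolding walks_leaving_def walks_to.simps by (subst sum.reindex) (auto simp: inj_on_def intro!: sum.cong)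
  also have "\<dots> \<le> (\<Sum>z\<in>Z. p)" using p by (intro sum_mono) auto
  also have "\<dots> = 1 * (real (card Z) * p * D ^ 0)" by simp
  also have "\<dots> \<le> real (2 * m + 1) ^ (0 + 2) * (real (card Z) * p * D ^ 0)"
    using p by (intro mult_right_mono one_le_power) auto
  finally show ?case .
next
  case (Suc t)
  let ?c = "real (2 * m + 1) ^ (t + 2)" and ?X = "real (card Z) * p * D ^ t"
  have X: "0 \<le> ?X" "p \<le> ?X * D" "?X \<le> ?X * D"
  proof -
    show X0: "0 \<le> ?X" using p D by simp
    then show "?X \<le> ?X * D" using D mult_left_mono[of 1 D ?X] by simp
    have "1 * p * 1 \<le> real (card Z) * p * (D ^ Suc t)"
      using J p D one_le_power[OF D(2), of "Suc t"] by (intro mult_mono) auto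
    then show "p \<le> ?X * D" by (simp add: ac_simps)
  qed
  have "walks_leaving (Suc t) a \<le> real m * (?c * ?X) + D * (?c * ?X) + p * real m ^ Suc (Suc t)"
    unfolding walks_leaving_Suc using Suc.IH X by (intro step_le walks_leaving_nonneg) auto
  also have "\<dots> \<le> real m * (?c * (?X * D)) + ?c * (?X * D) + (?X * D) * real m ^ Suc (Suc t)"
    using X by (intro add_mono mult_left_mono mult_right_mono) (auto simp: ac_simps)
  also have "\<dots> = (real m * ?c + ?c + real m ^ Suc (Suc t)) * (?X * D)" by (simp add: algebra_simps)
  also have "\<dots> \<le> real (2 * m + 1) ^ (Suc t + 2) * (?X * D)"
    using X by (intro mult_right_mono const_step) auto
  finally show ?case by (simp add: ac_simps)
qed

lemma walks_mixed_le: "D * walks_mixed t a \<le> real (2 * m + 1) ^ (t + 2) * (real (card Z) * p * D ^ t)"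
proof (induction t arbitrary: a)
  case 0
  have "walks_mixed 0 a = 0"
    unfolding walks_mixed_def walks_to.simps by (subst sum.reindex) (auto simp: inj_on_def)
  then show ?case using p by simp
next
  case (Suc t)
  let ?c = "real (2 * m + 1) ^ (t + 2)" and ?X = "real (card Z) * p * D ^ t"
  have D0: "0 < D" using D by simp
  have X: "0 \<le> ?X" "p \<le> ?X"
  proof -
    show X0: "0 \<le> ?X" using p D by simp
    have "1 * p * 1 \<le> real (card Z) * p * (D ^ t)"
      using J p D one_le_power[OF D(2), of "t"] by (intro mult_mono) auto
    then show "p \<le> ?X" by simp
  qed
  have "walks_mixed t b \<le> ?c * ?X / D" for b using Suc.IH[of b] D0 by (simp add: field_simps)
  then have "walks_mixed (Suc t) a \<le> real m * (?c * ?X) + D * (?c * ?X / D) + p * real m ^ Suc (Suc t)"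
    unfolding walks_mixed_Suc using walks_leaving_le X D0 by (intro step_le walks_mixed_nonneg) auto
  also have "D * (?c * ?X / D) = ?c * ?X" using D0 by simp
  also have "real m * (?c * ?X) + ?c * ?X + p * real m ^ Suc (Suc t)
     \<le> real m * (?c * ?X) + ?c * ?X + ?X * real m ^ Suc (Suc t)"
    using X by (intro add_left_mono mult_right_mono) auto
  also have "\<dots> = (real m * ?c + ?c + real m ^ Suc (Suc t)) * ?X" by (simp add: algebra_simps)
  also have "\<dots> \<le> real (2 * m + 1) ^ (Suc t + 2) * ?X"
    using X by (intro mult_right_mono const_step) auto
  finally have "D * walks_mixed (Suc t) a \<le> D * (real (2 * m + 1) ^ (Suc t + 2) * ?X)"
    using D0 by (intro mult_left_mono) auto
  then show ?case by (simp add: ac_simps)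
qed

end

text \<open>Janson's inequality for the paths from \<open>u\<close> to \<open>Z\<close> with \<open>l\<close> inner
  vertices in \<open>V0\<close>. Their mean number is at least the first term, and the pairs of overlapping paths
  contribute at most \<open>(J p D\<^sup>l)\<^sup>2 / D\<close> up to a constant by \<open>walks_mixed_le\<close>. A
  set \<open>Z\<close> of ends instead of a single one is needed for the size of balls.\<close>

theorem prob_no_path_le:
  fixes p D :: real
  assumes fin: "finite V0" "finite Z" and p: "0 \<le> p" "p \<le> 1"
    and D: "D = real (card V0) * p" "1 \<le> D" and J: "1 \<le> card Z"
    and dis: "u \<notin> V0" "u \<notin> Z" "V0 \<inter> Z = {}" and l: "l \<le> card V0"
    and E: "finite E" "pairs (insert u (V0 \<union> Z)) \<subseteq> E"
  shows "bexp p E (\<lambda>G. of_bool (\<not> (\<exists>w\<in>walks_to V0 Z l. distinct (u # w) \<and> pedges (u # w) \<subseteq> G)))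
    \<le> exp (- (real (card Z) * p * (real (card V0 - l) * p) ^ l)
         + real (2 * l + 5) ^ (l + 2) * (real (card Z) * p * D ^ l)\<^sup>2 / D)"
proof -
  let ?I = "{w \<in> walks_to V0 Z l. distinct (u # w)}"
  let ?F = "\<lambda>w. pedges (u # w)"
  let ?J = "real (card Z)"
  let ?C = "real (2 * l + 5) ^ (l + 2)"
  have D0: "0 < D" using D by simp
  have finI: "finite ?I" using finite_walks_to[OF fin] by simp
  have FE: "?F w \<subseteq> E" if "w \<in> ?I" for w
  proof -
    have "set (u # w) \<subseteq> insert u (V0 \<union> Z)" using that by (auto simp: walks_to_iff)
    then show ?thesis using pedges_subset_pairs that E(2) by blast
  qed
  have cF: "card (?F w) = Suc l" if "w \<in> ?I" for w
    using that card_pedges[of "u # w"] length_walks_to[of w V0 Z l] by auto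
  have cI_ge: "?J * real (card V0 - l) ^ l \<le> real (card ?I)"
  proof -
    let ?A = "{xs. length xs = l \<and> distinct xs \<and> set xs \<subseteq> V0}"
    have img: "(\<lambda>(xs, z). xs @ [z]) ` (?A \<times> Z) \<subseteq> ?I"
    proof
      fix w assume "w \<in> (\<lambda>(xs, z). xs @ [z]) ` (?A \<times> Z)"
      then obtain xs z where w: "w = xs @ [z]" "length xs = l" "distinct xs" "set xs \<subseteq> V0" "z \<in> Z" by auto
      then have "w \<in> walks_to V0 Z l" unfolding walks_to_iff by blast
      moreover have "distinct (u # w)" using w dis by auto
      ultimately show "w \<in> ?I" by simp
    qed
    have finA: "finite ?A" by (rule finite_subset[OF _ finite_lists_length_eq[OF fin(1), of l]]) auto
    have "(card V0 - l) ^ l = (\<Prod>i\<in>{card V0 - l + 1..card V0}. card V0 - l)" using l by simp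
    also have "\<dots> \<le> \<Prod>{card V0 - l + 1..card V0}" by (intro prod_mono) auto
    also have "\<dots> = card ?A" using card_lists_distinct_length_eq[OF fin(1) l] by simp
    finally have "(card V0 - l) ^ l * card Z \<le> card ?A * card Z" by simp
    also have "\<dots> = card (?A \<times> Z)" by (simp add: card_cartesian_product)
    also have "\<dots> = card ((\<lambda>(xs, z). xs @ [z]) ` (?A \<times> Z))"
      by (rule card_image[symmetric]) (auto simp: inj_on_def)
    also have "\<dots> \<le> card ?I" by (rule card_mono[OF finI img])
    finally have "real ((card V0 - l) ^ l * card Z) \<le> real (card ?I)" by (simp only: of_nat_le_iff)
    then show ?thesis by (simp add: mult.commute)
  qed
  have cI_le: "real (card ?I) \<le> real (card V0) ^ l * ?J"
  proof -
    have "card ?I \<le> card (walks_to V0 Z l)" by (rule card_mono) (use finite_walks_to[OF fin] in auto)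
    also have "\<dots> \<le> card V0 ^ l * card Z" by (rule card_walks_to_le[OF fin])
    finally have "real (card ?I) \<le> real (card V0 ^ l * card Z)" by (simp only: of_nat_le_iff)
    then show ?thesis by simp
  qed
  have Delta: "(\<Sum>j\<in>{j\<in>?I. j \<noteq> w \<and> ?F w \<inter> ?F j \<noteq> {}}. p ^ card (?F w \<union> ?F j))
      \<le> p ^ Suc l * (?C * (?J * p * D ^ l) / D)" if w: "w \<in> ?I" for w
  proof -
    let ?P = "?F w"
    have P: "\<forall>e\<in>?P. e \<subseteq> set (u # w)" "finite (set (u # w))" "card (set (u # w)) \<le> l + 2"
      using pedges_subset_Pow[of _ "u # w"] card_length[of "u # w"] w length_walks_to[of w V0 Z l] by auto
    have "(\<Sum>j\<in>{j\<in>?I. j \<noteq> w \<and> ?P \<inter> ?F j \<noteq> {}}. p ^ card (?P \<union> ?F j))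
       \<le> (\<Sum>j\<in>{j\<in>?I. j \<noteq> w \<and> ?P \<inter> ?F j \<noteq> {}}. p ^ Suc l * (of_bool (\<not> ?F j \<subseteq> ?P \<and> ?F j \<inter> ?P \<noteq> {}) * cond_weight ?P p (u # j)))"
    proof (rule sum_mono)
      fix j assume j: "j \<in> {j\<in>?I. j \<noteq> w \<and> ?P \<inter> ?F j \<noteq> {}}"
      have "\<not> ?F j \<subseteq> ?P"
        using path_determined_by_edges[of u w j] j w length_walks_to[of w V0 Z l] length_walks_to[of j V0 Z l] by auto
      moreover have "?F j \<inter> ?P \<noteq> {}" using j by blast
      moreover have "p ^ card (?P \<union> ?F j) = p ^ Suc l * cond_weight ?P p (u # j)"
      proof -
        have "card (?P \<union> ?F j) = card ?P + card (?F j - ?P)"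
          by (metis Diff_disjoint Un_Diff_cancel card_Un_disjoint finite_Diff finite_pedges)
        then show ?thesis using cF[OF w] cond_weight_distinct[of "u # j" p ?P] j by (simp add: power_add)
      qed
      ultimately show "p ^ card (?P \<union> ?F j) \<le> p ^ Suc l * (of_bool (\<not> ?F j \<subseteq> ?P \<and> ?F j \<inter> ?P \<noteq> {}) * cond_weight ?P p (u # j))"
        by simp
    qed
    also have "\<dots> \<le> (\<Sum>j\<in>walks_to V0 Z l. p ^ Suc l * (of_bool (\<not> ?F j \<subseteq> ?P \<and> ?F j \<inter> ?P \<noteq> {}) * cond_weight ?P p (u # j)))"
      by (rule sum_mono2) (use finite_walks_to[OF fin] p in \<open>auto intro!: mult_nonneg_nonneg cond_weight_nonneg\<close>)
    also have "\<dots> = p ^ Suc l * walks_mixed V0 Z ?P p l u"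
    proof -
      have "walks_mixed V0 Z ?P p l u = (\<Sum>j\<in>walks_to V0 Z l. of_bool (\<not> ?F j \<subseteq> ?P \<and> ?F j \<inter> ?P \<noteq> {}) * cond_weight ?P p (u # j))"
        by (rule walks_mixed_def[OF fin p D J P])
      then show ?thesis by (simp only: sum_distrib_left)
    qed
    also have "\<dots> \<le> p ^ Suc l * (?C * (?J * p * D ^ l) / D)"
    proof (rule mult_left_mono)
      have "2 * (l + 2) + 1 = 2 * l + 5" by simp
      then have "D * walks_mixed V0 Z ?P p l u \<le> ?C * (?J * p * D ^ l)"
        using walks_mixed_le[OF fin p D J P, of l u] by (simp only:)
      then show "walks_mixed V0 Z ?P p l u \<le> ?C * (?J * p * D ^ l) / D" using D0 by (simp add: field_simps)
    qed (use p in simp)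
    finally show ?thesis .
  qed
  have "bexp p E (\<lambda>G. of_bool (\<not> (\<exists>w\<in>walks_to V0 Z l. distinct (u # w) \<and> pedges (u # w) \<subseteq> G)))
      = bexp p E (\<lambda>G. of_bool (\<forall>w\<in>?I. \<not> ?F w \<subseteq> G))"
    by (rule bexp_cong) auto
  also have "\<dots> \<le> exp (- (\<Sum>w\<in>?I. p ^ card (?F w))
           + (\<Sum>w\<in>?I. \<Sum>j\<in>{j\<in>?I. j \<noteq> w \<and> ?F w \<inter> ?F j \<noteq> {}}. p ^ card (?F w \<union> ?F j)))"
    by (rule janson_inequality[OF p E(1) finI FE])
  also have "\<dots> \<le> exp (- (?J * p * (real (card V0 - l) * p) ^ l) + ?C * (?J * p * D ^ l)\<^sup>2 / D)"
  proof -
    have "(\<Sum>w\<in>?I. p ^ card (?F w)) = real (card ?I) * p ^ Suc l" by (simp add: cF)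
    moreover have "?J * p * (real (card V0 - l) * p) ^ l \<le> real (card ?I) * p ^ Suc l"
      using mult_right_mono[OF cI_ge, of "p ^ Suc l"] p by (simp add: power_mult_distrib ac_simps)
    moreover have "(\<Sum>w\<in>?I. \<Sum>j\<in>{j\<in>?I. j \<noteq> w \<and> ?F w \<inter> ?F j \<noteq> {}}. p ^ card (?F w \<union> ?F j))
        \<le> ?C * (?J * p * D ^ l)\<^sup>2 / D"
    proof -
      have "(\<Sum>w\<in>?I. \<Sum>j\<in>{j\<in>?I. j \<noteq> w \<and> ?F w \<inter> ?F j \<noteq> {}}. p ^ card (?F w \<union> ?F j))
         \<le> (\<Sum>w\<in>?I. p ^ Suc l * (?C * (?J * p * D ^ l) / D))" by (intro sum_mono Delta)
      also have "\<dots> = real (card ?I) * (p ^ Suc l * (?C * (?J * p * D ^ l) / D))" by simp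
      also have "\<dots> \<le> (real (card V0) ^ l * ?J) * (p ^ Suc l * (?C * (?J * p * D ^ l) / D))"
        using p D0 by (intro mult_right_mono cI_le) auto
      also have "\<dots> = ?C * (?J * p * D ^ l)\<^sup>2 / D"
        by (simp add: D(1) power_mult_distrib power2_eq_square)
      finally show ?thesis .
    qed
    ultimately show ?thesis by simp
  qed
  finally show ?thesis .
qed

section \<open>Two sufficient conditions for an undetected pair\<close>

text \<open>No pair of \<open>Q\<close> is within total distance \<open>k\<close> of \<open>x\<close> and
  \<open>y\<close>, expressed through the edges at \<open>x\<close> and \<open>y\<close> and the graph
  \<open>H\<close> on the remaining vertices. The last two clauses treat pairs of \<open>Q\<close> that contain
  \<open>x\<close> or \<open>y\<close>.\<close>

definition clear_small :: "nat \<Rightarrow> nat set set \<Rightarrow> nat set \<Rightarrow> nat \<Rightarrow> nat \<Rightarrow> nat set set \<Rightarrow> bool" where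
  "clear_small k Q V x y G \<longleftrightarrow> (let H = G \<inter> pairs V in
     (\<forall>u\<in>V. \<forall>v\<in>V. \<forall>a\<in>V. \<forall>b\<in>V. \<forall>i j. {u, v} \<in> Q \<longrightarrow> {x, a} \<in> G \<longrightarrow> {y, b} \<in> G \<longrightarrow>
        near H i u a \<longrightarrow> near H j v b \<longrightarrow> \<not> i + j + 2 \<le> k) \<and>
     (\<forall>v\<in>V. \<forall>b\<in>V. {x, v} \<in> Q \<longrightarrow> {y, b} \<in> G \<longrightarrow> \<not> near H (k - 1) v b) \<and>
     (\<forall>u\<in>V. \<forall>a\<in>V. {y, u} \<in> Q \<longrightarrow> {x, a} \<in> G \<longrightarrow> \<not> near H (k - 1) u a))"

text \<open>The vertices \<open>b\<close> such that an edge \<open>{y, b}\<close> would produce a possible witness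
  \<open>{u, v}\<close> with \<open>v \<noteq> y\<close>. Such a pair has \<open>d(u, x) + d(v, y) \<le> i + j +
  1\<close>. If this is less than \<open>k\<close>, the pair is excluded whatever its distance; these pairs are so few
  that nothing is lost. If it equals \<open>k\<close>, only a pair at distance greater than \<open>k + 1\<close> is
  dangerous.\<close>

definition blocked :: "nat \<Rightarrow> nat set set \<Rightarrow> nat set \<Rightarrow> nat \<Rightarrow> nat set set \<Rightarrow> nat set" where
  "blocked k Q V x K = {b\<in>V. \<exists>u\<in>insert x V. \<exists>v\<in>V. \<exists>i j. {u, v} \<in> Q \<and> near K i u x \<and> near K j v b \<and>
      (i + j + 2 \<le> k \<or> i + j + 1 \<le> k \<and> \<not> near K (k + 1) u v)}"

text \<open>The second clause concerns the pairs \<open>{u, y} \<in> Q\<close> with \<open>d(u, x) \<le> k\<close>: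
  they are harmless if \<open>d(u, x) = k\<close> and \<open>d(u, y) \<le> k + 1\<close>, and the latter holds as soon
  as \<open>y\<close> is joined to a vertex of the ball of radius \<open>k\<close> around \<open>u\<close>.\<close>

definition clear_large :: "nat \<Rightarrow> nat set set \<Rightarrow> nat set \<Rightarrow> nat \<Rightarrow> nat \<Rightarrow> nat set set \<Rightarrow> bool" where
  "clear_large k Q V x y G \<longleftrightarrow> (let K = G \<inter> pairs (insert x V) in
     (\<forall>b\<in>blocked k Q V x K. {y, b} \<notin> G) \<and>
     (\<forall>u\<in>V. {y, u} \<in> Q \<longrightarrow> near K k u x \<longrightarrow> \<not> near K (k - 1) u x \<and> (\<exists>b\<in>V. {y, b} \<in> G \<and> near K k u b)))"

text \<open>\<open>D1\<close> disposes of all \<open>{u, v}\<close> with \<open>i + j > k\<close>. For the others,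
  \<open>D2\<close> confines the walks to \<open>x\<close> and \<open>y\<close> to the vertices outside
  \<open>W\<close>, where one of the two clearness conditions applies.\<close>

lemma not_reconstructible_if_clear:
  assumes k: "k \<ge> 1" and G: "G \<subseteq> vertex_pairs n" and W: "W \<subseteq> {1..n}" "x \<in> W" "y \<in> W" "x \<noteq> y"
    and D2: "\<And>w w'. w \<in> W \<Longrightarrow> w' \<in> W \<Longrightarrow> w \<noteq> w' \<Longrightarrow> \<not> near G k w w'"
    and D1: "\<And>u v. {u, v} \<in> Q \<Longrightarrow> near G (k + 2) u v"
    and xyQ: "{x, y} \<notin> Q"
    and clear: "clear_small k Q ({1..n} - W) x y G \<or> clear_large k Q ({1..n} - W) x y G"
  shows "\<not> reconstructible n Q G"
proof (rule not_reconstructible_if_unwitnessed[OF G])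
  let ?V = "{1..n}"
  let ?V' = "?V - W"
  let ?H = "G \<inter> pairs ?V'" and ?K = "G \<inter> pairs (insert x ?V')"
  have GV: "G \<subseteq> pairs ?V" using G by (simp add: vertex_pairs_eq)
  have HK: "?H \<subseteq> ?K" using pairs_mono[of ?V' "insert x ?V'"] by auto
  show "x \<in> ?V" "y \<in> ?V" "x \<noteq> y" using W by auto
  show "{x, y} \<notin> G"
    using D2[OF W(2-4)] k near_mono_length[OF near_edge[of x y G], of k] by auto
  fix u v i j assume Q: "{u, v} \<in> Q" and i: "near G i u x" and j: "near G j v y"
  show "near G (i + j + 1) u v"
  proof (cases "i + j \<le> k")
    case False
    then show ?thesis using D1[OF Q] near_mono_length[of G "k + 2" u v "i + j + 1"] by (simp del: near.simps)
  next
    case True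
    then have ijk: "i \<le> k" "j \<le> k" by auto
    have Ki: "near ?K i u x" and uV: "u \<in> insert x ?V'"
      using near_restrict[OF i ijk(1) GV W(2,1)] D2 W(2) by blast+
    have last_x: "\<exists>i' a. i = Suc i' \<and> a \<in> ?V' \<and> {x, a} \<in> G \<and> near ?H i' u a \<and> u \<in> ?V'" if "u \<noteq> x"
      using near_last_step[OF i ijk(1) GV W(2,1)] D2 W(2) that by blast
    have last_y: "\<exists>j' b. j = Suc j' \<and> b \<in> ?V' \<and> {y, b} \<in> G \<and> near ?H j' v b \<and> v \<in> ?V'" if "v \<noteq> y"
      using near_last_step[OF j ijk(2) GV W(3,1)] D2 W(3) that by blast
    from clear show ?thesis
    proof
      assume cl: "clear_small k Q ?V' x y G"
      have False
      proof (cases "v = y")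
        case True
        then have "u \<noteq> x" using Q xyQ by auto
        from last_x[OF this] obtain i' a where a: "i = Suc i'" "a \<in> ?V'" "{x, a} \<in> G" "near ?H i' u a" "u \<in> ?V'"
          by auto
        have "near ?H (k - 1) u a" by (rule near_mono_length[OF a(4)]) (use a ijk in auto)
        moreover have "{y, u} \<in> Q" using Q True by (simp add: insert_commute)
        ultimately show False using cl a by (auto simp: clear_small_def Let_def)
      next
        case vy: False
        from last_y[OF this] obtain j' b where b: "j = Suc j'" "b \<in> ?V'" "{y, b} \<in> G" "near ?H j' v b" "v \<in> ?V'"
          by auto
        show False
        proof (cases "u = x")
          case True
          have "near ?H (k - 1) v b" by (rule near_mono_length[OF b(4)]) (use b ijk in auto)
          then show False using cl b Q True by (auto simp: clear_small_def Let_def)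
        next
          case False
          from last_x[OF this] obtain i' a where a: "i = Suc i'" "a \<in> ?V'" "{x, a} \<in> G" "near ?H i' u a" "u \<in> ?V'"
            by auto
          have "i' + j' + 2 \<le> k" using \<open>i + j \<le> k\<close> a b by simp
          then show False using cl a b Q unfolding clear_small_def Let_def by blast
        qed
      qed
      then show ?thesis ..
    next
      assume cl: "clear_large k Q ?V' x y G"
      show ?thesis
      proof (cases "v = y")
        case True
        then have "u \<noteq> x" using Q xyQ by auto
        then have u: "u \<in> ?V'" using uV by auto
        have "near ?K k u x" by (rule near_mono_length[OF Ki ijk(1)])
        moreover have "{y, u} \<in> Q" using Q True by (simp add: insert_commute)
        ultimately have *: "\<not> near ?K (k - 1) u x" "\<exists>b\<in>?V'. {y, b} \<in> G \<and> near ?K k u b"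
          using cl u unfolding clear_large_def Let_def by blast+
        have "\<not> i \<le> k - 1" using *(1) near_mono_length[OF Ki] by blast
        then have "i = k" using ijk by auto
        obtain b where b: "{y, b} \<in> G" "near ?K k u b" using *(2) by auto
        have "near G k u b" by (rule near_mono_graph[OF b(2)]) auto
        moreover have "near G 1 b y" using near_edge[of b y G] b(1) by (simp add: insert_commute)
        ultimately have "near G (k + 1) u y" by (rule near_trans)
        then show ?thesis using near_mono_length[of G "k + 1" u y "i + j + 1"] \<open>i = k\<close> True
          by (simp del: near.simps)
      next
        case vy: False
        from last_y[OF this] obtain j' b where b: "j = Suc j'" "b \<in> ?V'" "{y, b} \<in> G" "near ?H j' v b" "v \<in> ?V'"
          by auto
        have Kj: "near ?K j' v b" by (rule near_mono_graph[OF b(4) HK])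
        have le: "i + j' + 1 \<le> k" using \<open>i + j \<le> k\<close> b by simp
        have nb: "b \<notin> blocked k Q ?V' x ?K" using cl b(3) unfolding clear_large_def Let_def by blast
        have n2: "\<not> i + j' + 2 \<le> k \<and> near ?K (k + 1) u v"
        proof (rule ccontr)
          assume "\<not> (\<not> i + j' + 2 \<le> k \<and> near ?K (k + 1) u v)"
          then have "i + j' + 2 \<le> k \<or> i + j' + 1 \<le> k \<and> \<not> near ?K (k + 1) u v" using le by blast
          then have "b \<in> blocked k Q ?V' x ?K"
            unfolding blocked_def using b(2,5) uV Q Ki Kj by blast
          then show False using nb by simp
        qed
        then have "near G (k + 1) u v" using near_mono_graph[of ?K "k + 1" u v G] by blast
        moreover have "i + j + 1 = k + 1" using n2 le b(1) by simp
        ultimately show ?thesis by (simp only:)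
      qed
    qed
  qed
qed

text \<open>The loss \<open>1 / (1 - p)\<close> in the exponent tends to \<open>1\<close>, so that products of
  \<open>1 - t\<close> with small \<open>t\<close> are exponentials of sums up to a negligible factor.\<close>

lemma one_minus_ge_exp:
  fixes t p :: real
  assumes "0 \<le> t" "t \<le> p" "p < 1"
  shows "exp (- t / (1 - p)) \<le> 1 - t"
proof -
  have "exp (- t / (1 - p)) \<le> exp (- t / (1 - t))"
    using assms by (simp add: divide_left_mono mult_pos_pos)
  also have "\<dots> \<le> 1 - t"
  proof -
    have "1 / (1 - t) = 1 + t / (1 - t)" using assms by (simp add: field_simps)
    then have "1 / (1 - t) \<le> exp (t / (1 - t))" using exp_ge_add_one_self[of "t / (1 - t)"] by simp
    then have "inverse (exp (t / (1 - t))) \<le> inverse (1 / (1 - t))"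
      using assms by (intro le_imp_inverse_le) auto
    then show ?thesis by (simp add: exp_minus)
  qed
  finally show ?thesis .
qed

lemma prod_one_minus_ge_exp:
  fixes f :: "'a \<Rightarrow> real"
  assumes "\<And>i. i \<in> I \<Longrightarrow> 0 \<le> f i \<and> f i \<le> p" "p < 1" "finite I"
  shows "exp (- (\<Sum>i\<in>I. f i) / (1 - p)) \<le> (\<Prod>i\<in>I. 1 - f i)"
proof -
  have "exp (- (\<Sum>i\<in>I. f i) / (1 - p)) = (\<Prod>i\<in>I. exp (- f i / (1 - p)))"
    using assms(3) by (simp add: exp_sum[symmetric] sum_divide_distrib sum_negf)
  also have "\<dots> \<le> (\<Prod>i\<in>I. 1 - f i)"
    by (intro prod_mono conjI one_minus_ge_exp) (use assms in auto)
  finally show ?thesis .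
qed

text \<open>Witnesses are oriented: \<open>u\<close> is close to \<open>x\<close> and \<open>v\<close> to
  \<open>y\<close>. This accounts for the factor \<open>2\<close> in front of \<open>|Q|\<close>.\<close>

definition ordered_pairs :: "nat set set \<Rightarrow> (nat \<times> nat) set" where
  "ordered_pairs Q = {(u, v). {u, v} \<in> Q}"

lemma ordered_pairs_bound:
  assumes "Q \<subseteq> pairs V" "finite V"
  shows "finite (ordered_pairs Q)" "card (ordered_pairs Q) \<le> 2 * card Q"
proof -
  have fQ: "finite Q" using assms finite_subset finite_pairs by blast
  let ?f = "\<lambda>e. (Min e, Max e)" and ?g = "\<lambda>e. (Max e, Min e)"
  have sub: "ordered_pairs Q \<subseteq> ?f ` Q \<union> ?g ` Q"
  proof
    fix t assume "t \<in> ordered_pairs Q"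
    then obtain u v where t: "t = (u, v)" "{u, v} \<in> Q" by (auto simp: ordered_pairs_def)
    show "t \<in> ?f ` Q \<union> ?g ` Q"
    proof (cases "u \<le> v")
      case True
      then have "t = ?f {u, v}" using t by simp
      then show ?thesis using t(2) by blast
    next
      case False
      then have "t = ?g {u, v}" using t by simp
      then show ?thesis using t(2) by blast
    qed
  qed
  have fin: "finite (?f ` Q \<union> ?g ` Q)" using fQ by blast
  show "finite (ordered_pairs Q)" by (rule finite_subset[OF sub fin])
  have "card (ordered_pairs Q) \<le> card (?f ` Q \<union> ?g ` Q)" by (rule card_mono[OF fin sub])
  also have "\<dots> \<le> card (?f ` Q) + card (?g ` Q)" by (rule card_Un_le)
  also have "\<dots> \<le> card Q + card Q" by (intro add_mono card_image_le fQ)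
  finally show "card (ordered_pairs Q) \<le> 2 * card Q" by simp
qed

lemma card_ball_le_power:
  fixes m \<delta> :: real
  assumes G: "G \<subseteq> pairs S" "finite S" and m: "\<And>v. real (deg G v) \<le> m" and "0 < \<delta>" "1 + \<delta> \<le> \<delta> * m"
  shows "finite {b. near G j v b}" "real (card {b. near G j v b}) \<le> (1 + \<delta>) * m ^ j"
  using card_ball_le[OF G m, of j v] geometric_sum_le[OF assms(4,5), of j] by auto

text \<open>Given \<open>H\<close>, clearness says that the edges at \<open>x\<close> and \<open>y\<close> avoid the
  sets \<open>{{x, a}, {y, b}}\<close> for the dangerous pairs \<open>(a, b)\<close>, and the singletons that come
  from pairs of \<open>Q\<close> containing \<open>x\<close> or \<open>y\<close>. By \<open>harris_avoid\<close> only
  the sum of \<open>p\<^bsup>|F|\<^esup>\<close> matters. An oriented pair of \<open>Q\<close> contributes about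
  \<open>d\<^bsup>k-2\<^esup> p\<^sup>2 = d\<^sup>k / n\<^sup>2\<close> for each of the \<open>k - 1\<close>
  splittings of \<open>k - 2\<close>, and each of the two families of singletons, because \<open>x\<close> and
  \<open>y\<close> have low degree in \<open>Q\<close>, contributes \<open>2 |Q| d\<^sup>k / n\<^sup>2\<close>. This
  adds up to the factor \<open>2 (k + 1)\<close>.\<close>

theorem prob_clear_small_ge:
  fixes n m \<delta> p :: real and x y :: nat
  assumes p: "0 \<le> p" "p < 1" and n: "0 < n" and V: "finite V" "x \<notin> V" "y \<notin> V" "x \<noteq> y"
    and Q: "Q \<subseteq> pairs V0" "finite V0" and k: "k \<ge> 1"
    and H: "H \<subseteq> pairs V" "\<And>v. real (deg H v) \<le> m"
    and \<delta>: "0 < \<delta>" "1 + \<delta> \<le> \<delta> * m" and m: "m = (1 + \<delta>) * (n * p)"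
    and degQ: "real (deg Q x) \<le> (1 + \<delta>) * (2 * real (card Q) / n)" "real (deg Q y) \<le> (1 + \<delta>) * (2 * real (card Q) / n)"
    and E: "E = (\<lambda>v. {x, v}) ` V \<union> (\<lambda>v. {y, v}) ` V"
  shows "exp (- ((1 + \<delta>) ^ (k + 1) * (2 * (real k + 1) * real (card Q) * (n * p) ^ k / n\<^sup>2)) / (1 - p))
     \<le> bexp p E (\<lambda>G. of_bool (clear_small k Q V x y (H \<union> G)))"
proof -
  let ?q = "real (card Q)" and ?d = "n * p"
  define I1 where "I1 = {(a, b). \<exists>u v i j. {u, v} \<in> Q \<and> near H i u a \<and> near H j v b \<and> i + j + 2 \<le> k}"
  define I2 where "I2 z = {b. \<exists>v. {z, v} \<in> Q \<and> near H (k - 1) v b}" for z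
  let ?F1 = "(\<lambda>(a, b). {{x, a}, {y, b}}) ` (I1 \<inter> V \<times> V)"
  let ?F2 = "(\<lambda>b. {{y, b}}) ` (I2 x \<inter> V)"
  let ?F3 = "(\<lambda>a. {{x, a}}) ` (I2 y \<inter> V)"
  let ?F = "?F1 \<union> ?F2 \<union> ?F3"
  have fE: "finite E" using E V by simp
  have mpos: "0 < m" using \<delta> by (smt (verit) zero_less_mult_iff)
  note ball = card_ball_le_power[OF H(1) V(1) H(2) \<delta>]
  have fin: "finite ?F" using V by simp
  have card1: "real (card (I1 \<inter> V \<times> V)) \<le> 2 * ?q * (real k - 1) * ((1 + \<delta>)\<^sup>2 * m ^ (k - 2))"
  proof -
    let ?J = "ordered_pairs Q \<times> {..<k - 1}"
    let ?S = "\<lambda>((u, v), i). {a. near H i u a} \<times> {b. near H (k - 2 - i) v b}"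
    have fJ: "finite ?J" using ordered_pairs_bound[OF Q] by simp
    have sub: "I1 \<inter> V \<times> V \<subseteq> (\<Union>t\<in>?J. ?S t)"
    proof
      fix ab assume "ab \<in> I1 \<inter> V \<times> V"
      then obtain a b u v i j where ab: "ab = (a, b)" "{u, v} \<in> Q" "near H i u a" "near H j v b" "i + j + 2 \<le> k"
        by (auto simp: I1_def)
      have "near H (k - 2 - i) v b" by (rule near_mono_length[OF ab(4)]) (use ab in auto)
      then have "ab \<in> ?S ((u, v), i)" using ab by simp
      moreover have "((u, v), i) \<in> ?J" using ab by (auto simp: ordered_pairs_def)
      ultimately show "ab \<in> (\<Union>t\<in>?J. ?S t)" by blast
    qed
    have finS: "finite (?S t)" for t using ball(1) by (cases t) (auto split: prod.splits)
    have "card (I1 \<inter> V \<times> V) \<le> card (\<Union>t\<in>?J. ?S t)"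
      by (rule card_mono[OF _ sub]) (use fJ finS in blast)
    also have "\<dots> \<le> (\<Sum>t\<in>?J. card (?S t))" by (rule card_UN_le[OF fJ])
    finally have "real (card (I1 \<inter> V \<times> V)) \<le> real (\<Sum>t\<in>?J. card (?S t))" by (simp only: of_nat_le_iff)
    also have "\<dots> = (\<Sum>t\<in>?J. real (card (?S t)))" by simp
    also have "\<dots> \<le> (\<Sum>t\<in>?J. (1 + \<delta>)\<^sup>2 * m ^ (k - 2))"
    proof (rule sum_mono)
      fix t assume t: "t \<in> ?J"
      obtain u v i where [simp]: "t = ((u, v), i)" by (cases t) auto
      have i: "i + (k - 2 - i) = k - 2" using t by auto
      have "real (card (?S t)) = real (card {a. near H i u a}) * real (card {b. near H (k - 2 - i) v b})"
        by (simp add: card_cartesian_product)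
      also have "\<dots> \<le> ((1 + \<delta>) * m ^ i) * ((1 + \<delta>) * m ^ (k - 2 - i))"
        using \<delta> mpos by (intro mult_mono ball) auto
      also have "\<dots> = (1 + \<delta>)\<^sup>2 * m ^ (i + (k - 2 - i))" by (simp add: power_add power2_eq_square)
      finally show "real (card (?S t)) \<le> (1 + \<delta>)\<^sup>2 * m ^ (k - 2)" by (simp only: i)
    qed
    also have "\<dots> = real (card (ordered_pairs Q)) * (real k - 1) * ((1 + \<delta>)\<^sup>2 * m ^ (k - 2))"
      using k by (simp add: card_cartesian_product of_nat_diff)
    also have "\<dots> \<le> (2 * ?q) * (real k - 1) * ((1 + \<delta>)\<^sup>2 * m ^ (k - 2))"
    proof (intro mult_right_mono)
      show "real (card (ordered_pairs Q)) \<le> 2 * ?q" using ordered_pairs_bound(2)[OF Q] by linarith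
    qed (use k mpos in auto)
    finally show ?thesis .
  qed
  have card2: "real (card (I2 z \<inter> V)) \<le> (1 + \<delta>) * (2 * ?q / n) * ((1 + \<delta>) * m ^ (k - 1))"
    if z: "real (deg Q z) \<le> (1 + \<delta>) * (2 * ?q / n)" for z
  proof -
    let ?N = "{v. {z, v} \<in> Q}"
    have fN: "finite ?N" by (rule finite_nbrs[OF Q])
    have I2: "I2 z = (\<Union>v\<in>?N. {b. near H (k - 1) v b})" by (auto simp: I2_def)
    have finI2: "finite (I2 z)" unfolding I2 using fN ball(1) by blast
    have "card (I2 z \<inter> V) \<le> card (I2 z)" by (rule card_mono[OF finI2]) auto
    also have "\<dots> \<le> (\<Sum>v\<in>?N. card {b. near H (k - 1) v b})" unfolding I2 by (rule card_UN_le[OF fN])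
    finally have "real (card (I2 z \<inter> V)) \<le> real (\<Sum>v\<in>?N. card {b. near H (k - 1) v b})" by (simp only: of_nat_le_iff)
    also have "\<dots> = (\<Sum>v\<in>?N. real (card {b. near H (k - 1) v b}))" by simp
    also have "\<dots> \<le> (\<Sum>v\<in>?N. (1 + \<delta>) * m ^ (k - 1))" by (intro sum_mono ball)
    also have "\<dots> = real (deg Q z) * ((1 + \<delta>) * m ^ (k - 1))" by (simp add: deg_def)
    also have "\<dots> \<le> (1 + \<delta>) * (2 * ?q / n) * ((1 + \<delta>) * m ^ (k - 1))"
      using z mpos \<delta> by (intro mult_right_mono) auto
    finally show ?thesis .
  qed
  have sum_le: "(\<Sum>F\<in>?F. p ^ card F) \<le> (1 + \<delta>) ^ (k + 1) * (2 * (real k + 1) * ?q * ?d ^ k / n\<^sup>2)"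
  proof -
    have b0: "(\<Sum>F\<in>?F. p ^ card F) \<le> (\<Sum>F\<in>?F1. p ^ card F) + (\<Sum>F\<in>?F2. p ^ card F) + (\<Sum>F\<in>?F3. p ^ card F)"
      using sum_union_le[of "?F1 \<union> ?F2" ?F3 "\<lambda>F. p ^ card F"] sum_union_le[of ?F1 ?F2 "\<lambda>F. p ^ card F"] V p
      by simp
    have b1: "(\<Sum>F\<in>?F1. p ^ card F) \<le> real (card (I1 \<inter> V \<times> V)) * p\<^sup>2"
    proof -
      have "(\<Sum>F\<in>?F1. p ^ card F) \<le> (\<Sum>F\<in>?F1. p\<^sup>2)"
      proof (rule sum_mono)
        fix F assume "F \<in> ?F1"
        then obtain a b where F: "F = {{x, a}, {y, b}}" "a \<in> V" "b \<in> V" by auto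
        then have "{x, a} \<noteq> {y, b}" using V by (auto simp: doubleton_eq_iff)
        then show "p ^ card F \<le> p\<^sup>2" using F by (simp add: power2_eq_square)
      qed
      also have "\<dots> = real (card ?F1) * p\<^sup>2" by simp
      also have "card ?F1 \<le> card (I1 \<inter> V \<times> V)" by (rule card_image_le) (use V in simp)
      finally show ?thesis by (simp add: mult_right_mono)
    qed
    have b2: "(\<Sum>F\<in>?F2. p ^ card F) \<le> real (card (I2 x \<inter> V)) * p"
    proof -
      have "(\<Sum>F\<in>?F2. p ^ card F) = (\<Sum>F\<in>?F2. p)" by (intro sum.cong) auto
      also have "\<dots> = real (card ?F2) * p" by simp
      also have "card ?F2 \<le> card (I2 x \<inter> V)" by (rule card_image_le) (use V in simp)
      finally show ?thesis using p by (simp add: mult_right_mono)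
    qed
    have b3: "(\<Sum>F\<in>?F3. p ^ card F) \<le> real (card (I2 y \<inter> V)) * p"
    proof -
      have "(\<Sum>F\<in>?F3. p ^ card F) = (\<Sum>F\<in>?F3. p)" by (intro sum.cong) auto
      also have "\<dots> = real (card ?F3) * p" by simp
      also have "card ?F3 \<le> card (I2 y \<inter> V)" by (rule card_image_le) (use V in simp)
      finally show ?thesis using p by (simp add: mult_right_mono)
    qed
    have "real (card (I1 \<inter> V \<times> V)) * p\<^sup>2 \<le> (2 * ?q * (real k - 1) * ((1 + \<delta>)\<^sup>2 * m ^ (k - 2))) * p\<^sup>2"
      by (intro mult_right_mono card1) auto
    also have "\<dots> \<le> (1 + \<delta>) ^ (k + 1) * (2 * (real k - 1) * ?q * ?d ^ k / n\<^sup>2)"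
    proof (cases "k = 1")
      case False
      then obtain k' where k': "k = k' + 2" using k False by (intro that[of "k - 2"]) simp
      have "m ^ (k - 2) = (1 + \<delta>) ^ k' * ?d ^ k'" by (simp add: k' m power_mult_distrib)
      moreover have "?d ^ k / n\<^sup>2 = ?d ^ k' * p\<^sup>2" using n by (simp add: k' power_mult_distrib power2_eq_square)
      moreover have "(1 + \<delta>) ^ k = (1 + \<delta>) ^ k' * (1 + \<delta>)\<^sup>2" by (simp only: k' power_add)
      ultimately have "(1 + \<delta>)\<^sup>2 * m ^ (k - 2) * p\<^sup>2 = (1 + \<delta>) ^ k * (?d ^ k / n\<^sup>2)" by (simp only: ac_simps)
      also have "\<dots> \<le> (1 + \<delta>) ^ (k + 1) * (?d ^ k / n\<^sup>2)"
        using \<delta> p n by (intro mult_right_mono power_increasing) auto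
      finally have *: "(1 + \<delta>)\<^sup>2 * m ^ (k - 2) * p\<^sup>2 \<le> (1 + \<delta>) ^ (k + 1) * (?d ^ k / n\<^sup>2)" .
      have "2 * ?q * (real k - 1) * ((1 + \<delta>)\<^sup>2 * m ^ (k - 2)) * p\<^sup>2
          = (2 * ?q * (real k - 1)) * ((1 + \<delta>)\<^sup>2 * m ^ (k - 2) * p\<^sup>2)" by simp
      also have "\<dots> \<le> (2 * ?q * (real k - 1)) * ((1 + \<delta>) ^ (k + 1) * (?d ^ k / n\<^sup>2))"
        using k by (intro mult_left_mono *) auto
      finally show ?thesis by (simp add: ac_simps)
    qed simp
    finally have b4: "real (card (I1 \<inter> V \<times> V)) * p\<^sup>2 \<le> (1 + \<delta>) ^ (k + 1) * (2 * (real k - 1) * ?q * ?d ^ k / n\<^sup>2)" .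
    have b5: "real (card (I2 x \<inter> V)) * p \<le> (1 + \<delta>) * (2 * ?q / n) * ((1 + \<delta>) * m ^ (k - 1)) * p"
      using p by (intro mult_right_mono card2 degQ) auto
    have b6: "real (card (I2 y \<inter> V)) * p \<le> (1 + \<delta>) * (2 * ?q / n) * ((1 + \<delta>) * m ^ (k - 1)) * p"
      using p by (intro mult_right_mono card2 degQ) auto
    have b7: "(1 + \<delta>) * (2 * ?q / n) * ((1 + \<delta>) * m ^ (k - 1)) * p = (1 + \<delta>) ^ (k + 1) * (2 * ?q * ?d ^ k / n\<^sup>2)"
    proof -
      obtain k' where k': "k = Suc k'" using k by (cases k) auto
      have "m ^ (k - 1) = (1 + \<delta>) ^ k' * ?d ^ k'" by (simp add: k' m power_mult_distrib)
      moreover have "2 * ?q * ?d ^ k / n\<^sup>2 = (2 * ?q / n) * (?d ^ k' * p)" using n by (simp add: k' power2_eq_square)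
      moreover have "(1 + \<delta>) ^ (k + 1) = (1 + \<delta>) ^ k' * (1 + \<delta>) * (1 + \<delta>)" by (simp add: k')
      ultimately show ?thesis by (simp only: ac_simps)
    qed
    have b8: "(1 + \<delta>) ^ (k + 1) * (2 * (real k - 1) * ?q * ?d ^ k / n\<^sup>2) +
          (1 + \<delta>) ^ (k + 1) * (2 * ?q * ?d ^ k / n\<^sup>2) + (1 + \<delta>) ^ (k + 1) * (2 * ?q * ?d ^ k / n\<^sup>2)
        = (1 + \<delta>) ^ (k + 1) * (2 * (real k + 1) * ?q * ?d ^ k / n\<^sup>2)"
    proof -
      have "A * (2 * (K - 1) * q * D / N) + A * (2 * q * D / N) + A * (2 * q * D / N) = A * (2 * (K + 1) * q * D / N)"
        for A K q D N :: real
        by (simp add: algebra_simps add_divide_distrib diff_divide_distrib)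
      then show ?thesis by (simp only:)
    qed
    show ?thesis using b0 b1 b2 b3 b4 b5 b6 unfolding b7 using b8 by linarith
  qed
  have "exp (- ((1 + \<delta>) ^ (k + 1) * (2 * (real k + 1) * ?q * ?d ^ k / n\<^sup>2)) / (1 - p))
      \<le> exp (- (\<Sum>F\<in>?F. p ^ card F) / (1 - p))"
    unfolding exp_le_cancel_iff minus_divide_left[symmetric] neg_le_iff_le
    by (rule divide_right_mono[OF sum_le]) (use p in simp)
  also have "\<dots> \<le> (\<Prod>F\<in>?F. 1 - p ^ card F)"
  proof (rule prod_one_minus_ge_exp)
    fix F assume F: "F \<in> ?F"
    then have "card F \<noteq> 0" by auto
    then obtain c where "card F = Suc c" by (cases "card F") auto
    moreover have "p * p ^ c \<le> p * 1" using p by (intro mult_left_mono power_le_one) auto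
    ultimately show "0 \<le> p ^ card F \<and> p ^ card F \<le> p" using p by simp
  qed (use p fin in auto)
  also have "\<dots> \<le> bexp p E (\<lambda>G. of_bool (\<forall>F\<in>?F. \<not> F \<subseteq> G))"
    by (rule harris_avoid[where F = "\<lambda>F. F"]) (use p fE fin E in auto)
  also have "\<dots> \<le> bexp p E (\<lambda>G. of_bool (clear_small k Q V x y (H \<union> G)))"
  proof (rule bexp_mono)
    fix G assume G: "G \<subseteq> E"
    have HG: "(H \<union> G) \<inter> pairs V = H"
    proof -
      have "e \<notin> pairs V" if "e \<in> G" for e using that G E V by (auto simp: doubleton_in_pairs)
      then show ?thesis using H(1) by blast
    qed
    have xG: "{x, a} \<in> H \<union> G \<longleftrightarrow> {x, a} \<in> G" "{y, a} \<in> H \<union> G \<longleftrightarrow> {y, a} \<in> G" for a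
      using edge_in_vertices[OF H(1), of x a] edge_in_vertices[OF H(1), of y a] V by blast+
    have "clear_small k Q V x y (H \<union> G)" if none: "\<forall>F\<in>?F. \<not> F \<subseteq> G"
    proof -
      have c1: "\<not> i + j + 2 \<le> k" if "a \<in> V" "b \<in> V" "{u, v} \<in> Q" "{x, a} \<in> G" "{y, b} \<in> G" "near H i u a" "near H j v b" for u v a b i j
      proof
        assume "i + j + 2 \<le> k"
        then have "(a, b) \<in> I1 \<inter> V \<times> V" using that unfolding I1_def by blast
        then have "{{x, a}, {y, b}} \<in> ?F" by (intro UnI1 image_eqI[of _ _ "(a, b)"]) auto
        from bspec[OF none this] show False using that by simp
      qed
      have c2: "\<not> near H (k - 1) v b" if "b \<in> V" "{x, v} \<in> Q" "{y, b} \<in> G" for v b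
      proof
        assume "near H (k - 1) v b"
        then have "b \<in> I2 x \<inter> V" using that unfolding I2_def by blast
        then have "{{y, b}} \<in> ?F" by blast
        from bspec[OF none this] show False using that by simp
      qed
      have c3: "\<not> near H (k - 1) u a" if "a \<in> V" "{y, u} \<in> Q" "{x, a} \<in> G" for u a
      proof
        assume "near H (k - 1) u a"
        then have "a \<in> I2 y \<inter> V" using that unfolding I2_def by blast
        then have "{{x, a}} \<in> ?F" by blast
        from bspec[OF none this] show False using that by simp
      qed
      show ?thesis unfolding clear_small_def Let_def HG xG
      proof (intro conjI ballI allI impI)
        fix u v a b i j
        assume "a \<in> V" "b \<in> V" "{u, v} \<in> Q" "{x, a} \<in> G" "{y, b} \<in> G" "near H i u a" "near H j v b"
        then show "\<not> i + j + 2 \<le> k" by (rule c1)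
      next
        fix v b assume "b \<in> V" "{x, v} \<in> Q" "{y, b} \<in> G"
        then show "\<not> near H (k - 1) v b" by (rule c2)
      next
        fix u a assume "a \<in> V" "{y, u} \<in> Q" "{x, a} \<in> G"
        then show "\<not> near H (k - 1) u a" by (rule c3)
      qed
    qed
    then show "of_bool (\<forall>F\<in>?F. \<not> F \<subseteq> G) \<le> (of_bool (clear_small k Q V x y (H \<union> G)) :: real)" by auto
  qed (use p in auto)
  finally show ?thesis .
qed

section \<open>One pair, with all but the edges at one vertex exposed\<close>

lemma card_deg_sum_le:
  assumes "Q \<subseteq> pairs V0" "finite V0" "finite A"
  shows "(\<Sum>u\<in>A. deg Q u) \<le> 2 * card Q"
proof -
  have "(\<Sum>u\<in>A. deg Q u) = card (SIGMA u:A. {w. {u, w} \<in> Q})"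
    unfolding deg_def using assms(3) finite_nbrs[OF assms(1,2)] by (subst card_SigmaI) auto
  also have "\<dots> \<le> card (ordered_pairs Q)"
    by (rule card_mono[OF ordered_pairs_bound(1)[OF assms(1,2)]]) (auto simp: ordered_pairs_def)
  also have "\<dots> \<le> 2 * card Q" by (rule ordered_pairs_bound(2)[OF assms(1,2)])
  finally show ?thesis .
qed

text \<open>Here \<open>V\<close> is the set of vertices outside all test pairs, \<open>lam\<close> is
  \<open>\<lambda>\<close>, and \<open>\<delta>\<close> is a small constant that absorbs all lower order terms. The
  assumption \<open>far\<close>, an upper bound for the probability of distance greater than \<open>k + 1\<close>, is
  Janson's inequality; \<open>dlam\<close> says that \<open>1 / d\<close> is negligible compared with \<open>exp
  (-\<lambda>)\<close>. The graph \<open>K\<close> on \<open>V1\<close> is exposed, the edges from \<open>y\<close> to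
  \<open>V\<close> are not.\<close>

locale random_pair =
  fixes k n :: nat and p d \<delta> lam :: real and V V0 :: "nat set" and x y :: nat and Q :: "nat set set"
  assumes k: "1 \<le> k" and p: "0 < p" "p < 1" and n: "0 < n" and d: "d = real n * p"
    and lam: "lam = p * d ^ k"
    and \<delta>: "0 < \<delta>" "\<delta> \<le> 1" "1 + \<delta> \<le> \<delta> * d"
    and V: "finite V" "x \<notin> V" "y \<notin> V" "x \<noteq> y" "card (insert x V) \<le> n"
    and Q: "Q \<subseteq> pairs V0" "finite V0"
    and degx: "real (deg Q x) \<le> (1 + \<delta>) * (2 * real (card Q) / real n)"
    and degy: "real (deg Q y) \<le> (1 + \<delta>) * (2 * real (card Q) / real n)"
    and dlam: "1 \<le> \<delta> * exp (- lam) * d"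
    and far: "\<And>u v. u \<in> insert x V \<Longrightarrow> v \<in> insert x V \<Longrightarrow> u \<noteq> v \<Longrightarrow>
       bexp p (pairs (insert x V)) (\<lambda>K. of_bool (\<not> near K (k + 1) u v)) \<le> (1 + \<delta>) * exp (- lam)"
begin

abbreviation "V1 \<equiv> insert x V"
abbreviation "q \<equiv> real (card Q)"
abbreviation "m \<equiv> (1 + \<delta>) * d"
abbreviation "E1 \<equiv> pairs V1"
abbreviation "prob P \<equiv> bexp p E1 (\<lambda>K. of_bool (P K))"
definition "inner_queries = {(u, v). {u, v} \<in> Q \<and> u \<in> V1 \<and> v \<in> V}"
definition "partners = {u \<in> V. {y, u} \<in> Q}"
text \<open>For each \<open>i \<le> k\<close>, up to a factor \<open>2\<close>, the mean number of oriented pairs of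
  \<open>Q\<close> with \<open>d(u, x) = i\<close> and \<open>d(v, y) = k - i\<close>.\<close>

definition "load = q * d ^ k / (real n)\<^sup>2"

lemma p01: "0 \<le> p" "p \<le> 1" using p by auto
lemma finE1: "finite E1" using V by simp
lemma d1: "1 \<le> d" "0 < d"
proof -
  have "\<delta> * 1 \<le> \<delta> * d" using \<delta> by linarith
  then show "1 \<le> d" using \<delta>(1) by simp
  then show "0 < d" by linarith
qed
lemma m1: "0 < m" "d \<le> m" "1 + \<delta> \<le> \<delta> * m"
proof -
  show "0 < m" using d1 \<delta> by simp
  show dm: "d \<le> m" using d1 \<delta> by (simp add: algebra_simps)
  have "\<delta> * d \<le> \<delta> * m" using dm \<delta> by (intro mult_left_mono) auto
  then show "1 + \<delta> \<le> \<delta> * m" using \<delta> by linarith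
qed
lemma finite_inner_queries: "finite inner_queries" "inner_queries \<subseteq> ordered_pairs Q"
proof -
  show "inner_queries \<subseteq> ordered_pairs Q" by (auto simp: inner_queries_def ordered_pairs_def)
  then show "finite inner_queries" using ordered_pairs_bound(1)[OF Q] finite_subset by blast
qed
lemma inner_queries_neq: "(u, v) \<in> inner_queries \<Longrightarrow> u \<noteq> v"
  using Q by (auto simp: inner_queries_def dest: edge_in_vertices)
lemma finite_partners: "finite partners" using V by (simp add: partners_def)
lemma card_partners: "real (card partners) \<le> (1 + \<delta>) * (2 * q / real n)"
proof -
  have "card partners \<le> deg Q y" unfolding deg_def partners_def by (rule card_mono[OF finite_nbrs[OF Q]]) auto
  then show ?thesis using degy by linarith
qed
lemma load0: "0 \<le> load" using d1 by (simp add: load_def)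

lemma prob_near: "u \<noteq> v \<Longrightarrow> prob (\<lambda>K. near K s u v) \<le> (1 + \<delta>) * d ^ s / real n"
  by (rule prob_near_le_power[OF p01 d \<delta>(1,3) n _ V(5)]) (use V(1) in simp)

text \<open>The summand \<open>1 / m\<close> is the relative weight of the pairs with total distance less than
  \<open>k\<close>, one step fewer meaning one factor \<open>m\<close> less. Treating them together with the far pairs
  keeps the estimates of the blocked set uniform.\<close>

lemma far_plus: "u \<in> V1 \<Longrightarrow> v \<in> V1 \<Longrightarrow> u \<noteq> v \<Longrightarrow>
   bexp p E1 (\<lambda>K. of_bool (\<not> near K (k + 1) u v) + 1 / m) \<le> (1 + \<delta>)\<^sup>2 * exp (- lam)"
proof -
  assume uv: "u \<in> V1" "v \<in> V1" "u \<noteq> v"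
  have "1 / m \<le> 1 / d" using m1 d1 by (intro divide_left_mono) auto
  also have "\<dots> \<le> \<delta> * exp (- lam)" using dlam d1 by (simp add: field_simps)
  finally have "1 / m \<le> \<delta> * exp (- lam)" .
  moreover have "bexp p E1 (\<lambda>K. of_bool (\<not> near K (k + 1) u v) + 1 / m)
     = prob (\<lambda>K. \<not> near K (k + 1) u v) + 1 / m"
    using finE1 by (simp add: bexp_add)
  ultimately have "bexp p E1 (\<lambda>K. of_bool (\<not> near K (k + 1) u v) + 1 / m) \<le> (1 + \<delta>) * exp (- lam) + \<delta> * exp (- lam)"
    using far[OF uv] by linarith
  also have "\<dots> \<le> (1 + \<delta>)\<^sup>2 * exp (- lam)"
  proof -
    have "(1 + \<delta>) + \<delta> \<le> (1 + \<delta>)\<^sup>2" by (simp add: power2_eq_square algebra_simps)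
    then show ?thesis by (metis distrib_right exp_ge_zero mult_right_mono)
  qed
  finally show ?thesis .
qed

text \<open>An upper bound for the size of the blocked set, summed over the oriented pairs of \<open>Q\<close> and the
  distance \<open>i\<close> from \<open>u\<close> to \<open>x\<close>, with balls replaced by their maximal size.
  Unlike the blocked set, it is a sum of products of an increasing and a decreasing function of
  \<open>K\<close>.\<close>

definition "blocked_bound K = (\<Sum>(u, v)\<in>inner_queries. \<Sum>i<k. of_bool (near K i u x) * (of_bool (\<not> near K (k + 1) u v) + 1 / m)
    * ((1 + \<delta>) * m ^ (k - 1 - i)))"

lemma blocked_bound_nonneg: "0 \<le> blocked_bound K"
proof -
  have *: "0 \<le> of_bool P * (of_bool R + 1 / m) * ((1 + \<delta>) * m ^ j)" for P R j
    using m1(1) \<delta>(1) by (intro mult_nonneg_nonneg add_nonneg_nonneg) auto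
  show ?thesis unfolding blocked_bound_def case_prod_unfold by (intro sum_nonneg *)
qed

lemma card_blocked_le:
  assumes K: "K \<subseteq> E1" "\<And>v. real (deg K v) \<le> m"
  shows "finite (blocked k Q V x K)" "real (card (blocked k Q V x K)) \<le> blocked_bound K"
proof -
  note ball = card_ball_le_power[OF K(1) _ K(2) \<delta>(1) m1(3)]
  have finV1: "finite V1" using V by simp
  let ?S = "\<lambda>((u, v), i). if \<not> near K i u x then {} else if \<not> near K (k + 1) u v then {b. near K (k - 1 - i) v b}
      else if i + 2 \<le> k then {b. near K (k - 2 - i) v b} else {}"
  have sub: "blocked k Q V x K \<subseteq> (\<Union>t\<in>inner_queries \<times> {..<k}. ?S t)"
  proof
    fix b assume "b \<in> blocked k Q V x K"
    then obtain u v i j where b: "u \<in> V1" "v \<in> V" "{u, v} \<in> Q" "near K i u x" "near K j v b"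
      "i + j + 2 \<le> k \<or> i + j + 1 \<le> k \<and> \<not> near K (k + 1) u v"
      unfolding blocked_def by blast
    have t: "((u, v), i) \<in> inner_queries \<times> {..<k}" using b by (auto simp: inner_queries_def)
    have "b \<in> ?S ((u, v), i)"
    proof (cases "near K (k + 1) u v")
      case True
      then have "i + j + 2 \<le> k" using b by simp
      then have "near K (k - 2 - i) v b" using near_mono_length[OF b(5), of "k - 2 - i"] by simp
      then show ?thesis using True b(4) \<open>i + j + 2 \<le> k\<close> by simp
    next
      case False
      have "near K (k - 1 - i) v b" using near_mono_length[OF b(5), of "k - 1 - i"] b(6) by auto
      then show ?thesis using False b(4) by simp
    qed
    then show "b \<in> (\<Union>t\<in>inner_queries \<times> {..<k}. ?S t)" using t by blast
  qed
  have finS: "finite (?S t)" for t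
    by (cases t) (use ball(1)[OF finV1] in \<open>simp split: prod.splits\<close>)
  have fJ: "finite (inner_queries \<times> {..<k})" using finite_inner_queries by simp
  have finU: "finite (\<Union>t\<in>inner_queries \<times> {..<k}. ?S t)" by (rule finite_UN_I[OF fJ]) (rule finS)
  show "finite (blocked k Q V x K)" using V by (simp add: blocked_def)
  have "card (blocked k Q V x K) \<le> card (\<Union>t\<in>inner_queries \<times> {..<k}. ?S t)" by (rule card_mono[OF finU sub])
  also have "\<dots> \<le> (\<Sum>t\<in>inner_queries \<times> {..<k}. card (?S t))" by (rule card_UN_le[OF fJ])
  finally have "real (card (blocked k Q V x K)) \<le> real (\<Sum>t\<in>inner_queries \<times> {..<k}. card (?S t))" by (simp only: of_nat_le_iff)
  also have "\<dots> = (\<Sum>t\<in>inner_queries \<times> {..<k}. real (card (?S t)))" by simp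
  also have "\<dots> \<le> (\<Sum>((u, v), i)\<in>inner_queries \<times> {..<k}. of_bool (near K i u x) * (of_bool (\<not> near K (k + 1) u v) + 1 / m)
    * ((1 + \<delta>) * m ^ (k - 1 - i)))"
  proof (rule sum_mono)
    fix t assume t: "t \<in> inner_queries \<times> {..<k}"
    obtain u v i where [simp]: "t = ((u, v), i)" by (cases t) auto
    have pos: "0 \<le> (1 + \<delta>) * m ^ (k - 1 - i)" using m1 \<delta> by simp
    have "real (card (?S t)) \<le> of_bool (near K i u x) * (of_bool (\<not> near K (k + 1) u v) + 1 / m)
      * ((1 + \<delta>) * m ^ (k - 1 - i))"
    proof (cases "near K i u x")
      case ni: True
      show ?thesis
      proof (cases "near K (k + 1) u v")
        case False
        have "real (card {b. near K (k - 1 - i) v b}) \<le> 1 * ((1 + \<delta>) * m ^ (k - 1 - i))"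
          using ball(2)[OF finV1, of "k - 1 - i" v] by simp
        also have "\<dots> \<le> (1 + 1 / m) * ((1 + \<delta>) * m ^ (k - 1 - i))"
          using pos m1 by (intro mult_right_mono) auto
        finally show ?thesis using ni False by simp
      next
        case True
        show ?thesis
        proof (cases "i + 2 \<le> k")
          case ik: True
          have "k - 1 - i = Suc (k - 2 - i)" using ik by simp
          then have mm: "m ^ (k - 1 - i) = m * m ^ (k - 2 - i)" by (simp only: power_Suc)
          have "1 / M * (c * (M * X)) = c * X" if "0 < M" for M c X :: real using that by simp
          from this[OF m1(1)] have e: "1 / m * ((1 + \<delta>) * m ^ (k - 1 - i)) = (1 + \<delta>) * m ^ (k - 2 - i)"
            unfolding mm .
          have "real (card (?S t)) = real (card {b. near K (k - 2 - i) v b})" using ni True ik by simp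
          also have "\<dots> \<le> (1 + \<delta>) * m ^ (k - 2 - i)" by (rule ball(2)[OF finV1])
          also have "\<dots> = of_bool (near K i u x) * (of_bool (\<not> near K (k + 1) u v) + 1 / m) * ((1 + \<delta>) * m ^ (k - 1 - i))"
            unfolding e[symmetric] using ni True by (simp del: near.simps)
          finally show ?thesis .
        next
          case False
          then show ?thesis using ni True m1 d1 \<delta> by simp
        qed
      qed
    qed simp
    then show "real (card (?S t)) \<le> (\<lambda>((u, v), i). of_bool (near K i u x) * (of_bool (\<not> near K (k + 1) u v) + 1 / m)
      * ((1 + \<delta>) * m ^ (k - 1 - i))) t" by simp
  qed
  also have "\<dots> = blocked_bound K"
    unfolding blocked_bound_def sum.cartesian_product[symmetric] by (simp add: case_prod_unfold)
  finally show "real (card (blocked k Q V x K)) \<le> blocked_bound K" .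
qed

lemma power_m_le: "j + i = k - 1 \<Longrightarrow> d ^ i * m ^ j \<le> (1 + \<delta>) ^ k * d ^ (k - 1)"
proof -
  assume ij: "j + i = k - 1"
  have "d ^ i * m ^ j = (1 + \<delta>) ^ j * d ^ (k - 1)"
    using ij[symmetric] by (simp add: power_mult_distrib power_add)
  also have "\<dots> \<le> (1 + \<delta>) ^ k * d ^ (k - 1)"
    using ij \<delta> d1 by (intro mult_right_mono power_increasing) auto
  finally show ?thesis .
qed

text \<open>Closeness of \<open>u\<close> and \<open>x\<close> is increasing and distance of \<open>u\<close> and
  \<open>v\<close> is decreasing, so by Harris' inequality their joint probability is at most \<open>(d\<^sup>i / n)
  exp (-\<lambda>)\<close> up to powers of \<open>1 + \<delta>\<close>. For \<open>u \<noteq> x\<close> there are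
  \<open>k - 1\<close> values of \<open>i\<close>; the pairs with \<open>u = x\<close> lack the factor \<open>1 /
  n\<close>, but \<open>x\<close> has low degree in \<open>Q\<close>, so that they count like one more value.\<close>

lemma expectation_blocked_bound: "bexp p E1 blocked_bound \<le> (1 + \<delta>) ^ (k + 5) * (real k * (2 * q) * exp (- lam) * d ^ (k - 1) / real n)"
proof -
  let ?B = "(1 + \<delta>) ^ (k + 4) * (exp (- lam) * d ^ (k - 1))"
  have B0: "0 \<le> ?B" using \<delta> d1 by simp
  define t where "t u v i = bexp p E1 (\<lambda>K. of_bool (near K i u x) * (of_bool (\<not> near K (k + 1) u v) + 1 / m)
    * ((1 + \<delta>) * m ^ (k - 1 - i)))" for u v i
  have E: "bexp p E1 blocked_bound = (\<Sum>(u, v)\<in>inner_queries. \<Sum>i<k. t u v i)"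
  proof -
    have "blocked_bound = (\<lambda>K. \<Sum>uv\<in>inner_queries. \<Sum>i<k. (\<lambda>(u, v). of_bool (near K i u x) * (of_bool (\<not> near K (k + 1) u v) + 1 / m)
    * ((1 + \<delta>) * m ^ (k - 1 - i))) uv)"
      unfolding blocked_bound_def by (intro ext sum.cong refl) (auto split: prod.splits)
    then show ?thesis by (simp add: bexp_sum t_def case_prod_unfold)
  qed
  have far2: "bexp p E1 (\<lambda>K. of_bool (\<not> near K (k + 1) u v) + 1 / m) \<le> (1 + \<delta>)\<^sup>2 * exp (- lam)"
    if "(u, v) \<in> inner_queries" for u v using that inner_queries_neq[OF that] by (intro far_plus) (auto simp: inner_queries_def)
  have t_ne: "(\<Sum>i<k. t u v i) \<le> (real k - 1) * (?B / real n)" if uv: "(u, v) \<in> inner_queries" "u \<noteq> x" for u v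
  proof -
    have ti: "t u v i \<le> of_bool (i \<noteq> 0) * (?B / real n)" if i: "i < k" for i
    proof (cases "i = 0")
      case True
      then show ?thesis using uv finE1 by (simp add: t_def)
    next
      case False
      have c0: "0 \<le> (1 + \<delta>) * m ^ (k - 1 - i)" using m1 \<delta> by simp
      have "bexp p E1 (\<lambda>K. of_bool (near K i u x) * (of_bool (\<not> near K (k + 1) u v) + 1 / m))
         \<le> prob (\<lambda>K. near K i u x) * bexp p E1 (\<lambda>K. of_bool (\<not> near K (k + 1) u v) + 1 / m)"
      proof (rule harris_mixed[OF p01 finE1])
        fix G G' :: "nat set set" assume G: "G \<subseteq> G'"
        show "of_bool (near G i u x) \<le> (of_bool (near G' i u x) :: real)"
          using near_mono_graph[OF _ G, of i u x] by auto
        show "of_bool (\<not> near G' (k + 1) u v) + 1 / m \<le> of_bool (\<not> near G (k + 1) u v) + 1 / m"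
          using near_mono_graph[OF _ G, of "k + 1" u v] by (auto simp del: near.simps)
      qed
      also have "\<dots> \<le> ((1 + \<delta>) * d ^ i / real n) * ((1 + \<delta>)\<^sup>2 * exp (- lam))"
      proof (rule mult_mono)
        show "prob (\<lambda>K. near K i u x) \<le> (1 + \<delta>) * d ^ i / real n" by (rule prob_near[OF uv(2)])
        show "0 \<le> bexp p E1 (\<lambda>K. of_bool (\<not> near K (k + 1) u v) + 1 / m)"
          by (rule bexp_nonneg) (use p01 m1 in auto)
      qed (use far2[OF uv(1)] \<delta> d1 in auto)
      finally have "t u v i \<le> ((1 + \<delta>) * d ^ i / real n) * ((1 + \<delta>)\<^sup>2 * exp (- lam)) * ((1 + \<delta>) * m ^ (k - 1 - i))"
        unfolding t_def bexp_cmult_right using c0 by (rule mult_right_mono)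
      also have "\<dots> = (1 + \<delta>) ^ 4 * exp (- lam) / real n * (d ^ i * m ^ (k - 1 - i))"
        by (simp add: power2_eq_square power4_eq_xxxx)
      also have "\<dots> \<le> (1 + \<delta>) ^ 4 * exp (- lam) / real n * ((1 + \<delta>) ^ k * d ^ (k - 1))"
        using i \<delta> by (intro mult_left_mono power_m_le) auto
      also have "\<dots> = ?B / real n" by (simp add: power_add)
      finally show ?thesis using False by simp
    qed
    have "(\<Sum>i<k. t u v i) \<le> (\<Sum>i<k. of_bool (i \<noteq> 0) * (?B / real n))"
      by (intro sum_mono ti) auto
    also have "\<dots> = (real k - 1) * (?B / real n)"
    proof -
      have "{..<k} \<inter> {i. i \<noteq> 0} = {1..<k}" by auto
      then have "(\<Sum>i<k. of_bool (i \<noteq> 0) :: real) = real k - 1" using k by (simp add: sum_of_bool_eq of_nat_diff)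
      then show ?thesis unfolding sum_distrib_right[symmetric] by simp
    qed
    finally show ?thesis .
  qed
  have t_eq: "(\<Sum>i<k. t x v i) \<le> ?B" if uv: "(x, v) \<in> inner_queries" for v
  proof -
    have "(\<Sum>i<k. t x v i) \<le> (\<Sum>i<k. ((1 + \<delta>)\<^sup>2 * exp (- lam)) * ((1 + \<delta>) * m ^ (k - 1 - i)))"
    proof (rule sum_mono)
      fix i
      have c0: "0 \<le> (1 + \<delta>) * m ^ (k - 1 - i)" using m1 \<delta> by simp
      show "t x v i \<le> ((1 + \<delta>)\<^sup>2 * exp (- lam)) * ((1 + \<delta>) * m ^ (k - 1 - i))"
        unfolding t_def bexp_cmult_right using mult_right_mono[OF far2[OF uv] c0] by simp
    qed
    also have "\<dots> = (1 + \<delta>) ^ 3 * exp (- lam) * (\<Sum>i<k. m ^ (k - 1 - i))"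
      by (simp add: sum_distrib_left power2_eq_square power3_eq_cube ac_simps)
    also have "(\<Sum>i<k. m ^ (k - 1 - i)) = (\<Sum>i\<le>k - 1. m ^ i)"
    proof -
      have "{..<k} = {..k - 1}" using k by auto
      then show ?thesis using sum.nat_diff_reindex[of "\<lambda>i. m ^ i" k] by simp
    qed
    also have "(1 + \<delta>) ^ 3 * exp (- lam) * (\<Sum>i\<le>k - 1. m ^ i) \<le> (1 + \<delta>) ^ 3 * exp (- lam) * ((1 + \<delta>) * m ^ (k - 1))"
      using \<delta> by (intro mult_left_mono geometric_sum_le m1) auto
    also have "\<dots> = (1 + \<delta>) ^ 4 * exp (- lam) * (d ^ 0 * m ^ (k - 1))" by (simp add: power4_eq_xxxx power3_eq_cube)
    also have "\<dots> \<le> (1 + \<delta>) ^ 4 * exp (- lam) * ((1 + \<delta>) ^ k * d ^ (k - 1))"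
      using \<delta> by (intro mult_left_mono power_m_le) auto
    also have "\<dots> = ?B" by (simp add: power_add)
    finally show ?thesis .
  qed
  let ?Ox = "{t\<in>inner_queries. fst t = x}" and ?On = "{t\<in>inner_queries. fst t \<noteq> x}"
  have "(\<Sum>(u, v)\<in>inner_queries. \<Sum>i<k. t u v i) = (\<Sum>(u, v)\<in>?Ox. \<Sum>i<k. t u v i) + (\<Sum>(u, v)\<in>?On. \<Sum>i<k. t u v i)"
    using finite_inner_queries by (subst sum.union_disjoint[symmetric]) (auto intro!: sum.cong)
  also have "\<dots> \<le> (1 + \<delta>) * (2 * q / real n) * ?B + 2 * q * ((real k - 1) * (?B / real n))"
  proof (rule add_mono)
  have bx: "(\<Sum>(u, v)\<in>?Ox. \<Sum>i<k. t u v i) \<le> real (card ?Ox) * ?B"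
    by (rule sum_bounded_above) (use t_eq in auto)
  have bn: "(\<Sum>(u, v)\<in>?On. \<Sum>i<k. t u v i) \<le> real (card ?On) * ((real k - 1) * (?B / real n))"
    by (rule sum_bounded_above) (use t_ne in auto)
  have cx: "real (card ?Ox) \<le> (1 + \<delta>) * (2 * q / real n)"
  proof -
    have "card ?Ox \<le> card ((\<lambda>v. (x, v)) ` {v. {x, v} \<in> Q})"
      by (rule card_mono) (use finite_nbrs[OF Q] in \<open>auto simp: inner_queries_def\<close>)
    also have "\<dots> \<le> deg Q x" unfolding deg_def by (rule card_image_le[OF finite_nbrs[OF Q]])
    finally show ?thesis using degx by linarith
  qed
  have cn: "real (card ?On) \<le> 2 * q"
  proof -
    have "card ?On \<le> card (ordered_pairs Q)"
      by (rule card_mono[OF ordered_pairs_bound(1)[OF Q]]) (use finite_inner_queries in auto)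
    then show ?thesis using ordered_pairs_bound(2)[OF Q] by linarith
  qed
    show "(\<Sum>(u, v)\<in>?Ox. \<Sum>i<k. t u v i) \<le> (1 + \<delta>) * (2 * q / real n) * ?B"
      using bx mult_right_mono[OF cx B0] by linarith
    have "0 \<le> (real k - 1) * (?B / real n)" using B0 k by simp
    from mult_right_mono[OF cn this] show "(\<Sum>(u, v)\<in>?On. \<Sum>i<k. t u v i) \<le> 2 * q * ((real k - 1) * (?B / real n))"
      using bn by linarith
  qed
  also have "\<dots> \<le> (1 + \<delta>) * (2 * q / real n) * ?B + (1 + \<delta>) * (2 * q * ((real k - 1) * (?B / real n)))"
  proof -
    have "0 \<le> 2 * q * ((real k - 1) * (?B / real n))" using B0 k by simp
    then have "1 * (2 * q * ((real k - 1) * (?B / real n))) \<le> (1 + \<delta>) * (2 * q * ((real k - 1) * (?B / real n)))"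
      using \<delta> by (intro mult_right_mono) auto
    then show ?thesis by simp
  qed
  also have "\<dots> = (1 + \<delta>) ^ (k + 5) * (real k * (2 * q) * exp (- lam) * d ^ (k - 1) / real n)"
  proof -
    have "(1 + \<delta>) * (a / N) * B + (1 + \<delta>) * (a * ((K - 1) * (B / N))) = (1 + \<delta>) * B * (K * a / N)" for a B K N :: real
      by (simp add: algebra_simps add_divide_distrib diff_divide_distrib)
    then have "(1 + \<delta>) * (2 * q / real n) * ?B + (1 + \<delta>) * (2 * q * ((real k - 1) * (?B / real n)))
       = (1 + \<delta>) * ?B * (real k * (2 * q) / real n)" .
    then show ?thesis by (simp add: power_add ac_simps numeral_eq_Suc)
  qed
  finally show ?thesis unfolding E .
qed

text \<open>The vertices whose \<open>k\<close>-balls have to be hit by the edges at \<open>y\<close>.\<close>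

definition "close_partners K = {u \<in> partners. near K k u x}"
definition "kball K u = {b \<in> V. near K k u b}"
definition "visit_const = 5 * (3 * real k + 1) * fact (3 * k + 5)"
text \<open>Together with \<open>visit_const\<close> this bounds the weight of all conflicts, in units of
  \<open>d\<^sup>s\<close>. The quadratic term comes from independent choices of \<open>u\<close> and of \<open>(u',
  v')\<close>, the linear one from coincidences of \<open>u\<close> with \<open>u'\<close> or
  \<open>v'\<close>.\<close>

definition "conflict_scale = 24 * load\<^sup>2 + 8 * load"

lemma visit_const_pos: "0 < visit_const" unfolding visit_const_def by (simp add: add_pos_nonneg add_nonneg_pos)

lemma partners_ne: "u \<in> partners \<Longrightarrow> u \<in> V \<and> u \<noteq> x"
  using V by (auto simp: partners_def)

lemma finite_close_partners: "finite (close_partners K)" using finite_partners by (simp add: close_partners_def)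

lemma card_close_partners: "real (card (close_partners K)) = (\<Sum>u\<in>partners. of_bool (near K k u x))"
proof -
  have "close_partners K = partners \<inter> {u. near K k u x}" by (auto simp: close_partners_def)
  then show ?thesis using finite_partners by (simp add: sum_of_bool_eq)
qed

lemma expectation_card_close_partners: "bexp p E1 (\<lambda>K. real (card (close_partners K))) \<le> (1 + \<delta>)\<^sup>2 * (2 * q * d ^ k / (real n)\<^sup>2)"
proof -
  have "bexp p E1 (\<lambda>K. real (card (close_partners K))) = (\<Sum>u\<in>partners. prob (\<lambda>K. near K k u x))"
    unfolding card_close_partners by (rule bexp_sum)
  also have "\<dots> \<le> real (card partners) * ((1 + \<delta>) * d ^ k / real n)"
    by (rule sum_bounded_above) (use prob_near partners_ne in blast)
  also have "\<dots> \<le> ((1 + \<delta>) * (2 * q / real n)) * ((1 + \<delta>) * d ^ k / real n)"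
    using d1 \<delta> by (intro mult_right_mono card_partners) auto
  finally show ?thesis by (simp add: power2_eq_square ac_simps)
qed

text \<open>Summing over \<open>b\<close> cancels the factor \<open>1 / n\<close> for visiting \<open>b\<close>,
  except for the at most four \<open>b\<close> that are visited already.\<close>

lemma sum_prob_visits_le:
  assumes a: "a \<in> V1" "a \<notin> S" and S: "finite S" "card S \<le> 3" and L: "L \<le> 3 * k"
  shows "(\<Sum>b\<in>V. prob (\<lambda>K. \<exists>c. visits K L a c (insert b S))) \<le> visit_const * d ^ L / real n ^ card S"
proof -
  let ?c = "(real L + 1) * fact (L + 5) * d ^ L"
  have n0: "0 < real n" using n by simp
  have c0: "0 \<le> ?c" using d1 by simp
  have V1n: "real (card V1) \<le> real n" using V(5) by (simp only: of_nat_le_iff)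
  have finV1: "finite V1" using V by simp
  have inside: "prob (\<lambda>K. \<exists>c. visits K L a c (insert b S)) \<le> ?c / real n ^ card S" for b
  proof -
    have "prob (\<lambda>K. \<exists>c. visits K L a c (insert b S)) \<le> prob (\<lambda>K. \<exists>c. visits K L a c S)"
    proof (rule bexp_mono[OF p01])
      fix K
      have "(\<exists>c. visits K L a c (insert b S)) \<Longrightarrow> (\<exists>c. visits K L a c S)"
        using visits_mono[of K L a _ "insert b S" K L S] by blast
      then show "of_bool (\<exists>c. visits K L a c (insert b S)) \<le> (of_bool (\<exists>c. visits K L a c S) :: real)" by auto
    qed
    also have "\<dots> \<le> ?c / real n ^ card S"
      by (rule prob_visits_le[OF p01 finV1 V1n d d1(1) n0]) (use S a in auto)
    finally show ?thesis .
  qed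
  have outside: "prob (\<lambda>K. \<exists>c. visits K L a c (insert b S)) \<le> ?c / real n ^ Suc (card S)" if "b \<notin> insert a S" for b
  proof -
    have "prob (\<lambda>K. \<exists>c. visits K L a c (insert b S)) \<le> ?c / real n ^ card (insert b S)"
      by (rule prob_visits_le[OF p01 finV1 V1n d d1(1) n0]) (use S a that in \<open>auto simp: card_insert_if\<close>)
    then show ?thesis using that S by simp
  qed
  have "(\<Sum>b\<in>V. prob (\<lambda>K. \<exists>c. visits K L a c (insert b S)))
      = (\<Sum>b\<in>V \<inter> insert a S. prob (\<lambda>K. \<exists>c. visits K L a c (insert b S)))
      + (\<Sum>b\<in>V - insert a S. prob (\<lambda>K. \<exists>c. visits K L a c (insert b S)))"
    using V(1) by (rule sum.Int_Diff)
  also have "\<dots> \<le> 4 * (?c / real n ^ card S) + ?c / real n ^ card S"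
  proof (rule add_mono)
    have "(\<Sum>b\<in>V \<inter> insert a S. prob (\<lambda>K. \<exists>c. visits K L a c (insert b S))) \<le> real (card (V \<inter> insert a S)) * (?c / real n ^ card S)"
      by (rule sum_bounded_above) (rule inside)
    also have "\<dots> \<le> 4 * (?c / real n ^ card S)"
    proof (rule mult_right_mono)
      have "card (V \<inter> insert a S) \<le> card (insert a S)" by (rule card_mono) (use S in auto)
      also have "\<dots> \<le> 4" using S by (simp add: card_insert_if)
      finally show "real (card (V \<inter> insert a S)) \<le> 4" by simp
    qed (use c0 in simp)
    finally show "(\<Sum>b\<in>V \<inter> insert a S. prob (\<lambda>K. \<exists>c. visits K L a c (insert b S))) \<le> 4 * (?c / real n ^ card S)" .
    have "(\<Sum>b\<in>V - insert a S. prob (\<lambda>K. \<exists>c. visits K L a c (insert b S))) \<le> real (card (V - insert a S)) * (?c / real n ^ Suc (card S))"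
      by (rule sum_bounded_above) (use outside in blast)
    also have "\<dots> \<le> real n * (?c / real n ^ Suc (card S))"
    proof (rule mult_right_mono)
      have "card (V - insert a S) \<le> card V1" by (rule card_mono[OF finV1]) auto
      then show "real (card (V - insert a S)) \<le> real n" using V1n by linarith
    qed (use c0 in simp)
    also have "\<dots> = ?c / real n ^ card S" using n0 by simp
    finally show "(\<Sum>b\<in>V - insert a S. prob (\<lambda>K. \<exists>c. visits K L a c (insert b S))) \<le> ?c / real n ^ card S" .
  qed
  also have "\<dots> = 5 * (real L + 1) * fact (L + 5) * (d ^ L / real n ^ card S)" by simp
  also have "\<dots> \<le> visit_const * (d ^ L / real n ^ card S)"
  proof (rule mult_right_mono)
    have "fact (L + 5) \<le> (fact (3 * k + 5) :: real)" using L by (intro fact_mono) auto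
    then show "5 * (real L + 1) * fact (L + 5) \<le> visit_const"
      unfolding visit_const_def using L by (intro mult_mono) auto
  qed (use d1 in simp)
  finally show ?thesis by simp
qed

text \<open>The configuration in which \<open>b\<close> lies in the ball around \<open>u\<close> and is blocked
  because of \<open>(u', v')\<close>: paths from \<open>x\<close> to \<open>u\<close>, from \<open>u\<close> to
  \<open>b\<close>, from \<open>b\<close> to \<open>v'\<close> and from \<open>u'\<close> to \<open>x\<close>.\<close>

definition "conflict_at s u u' v' b K \<longleftrightarrow> near K k u x \<and> near K k u b \<and> (\<exists>i j. i + j \<le> s \<and> near K i u' x \<and> near K j v' b)"
definition "visit_mass s u u' v' = (\<Sum>b\<in>V. prob (conflict_at s u u' v' b))"

lemma visit_mass_le_visits:
  assumes "a \<in> V1" "a \<notin> S" "finite S" "card S \<le> 3" "L \<le> 3 * k"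
    and "\<And>K b. b \<in> V \<Longrightarrow> conflict_at s u u' v' b K \<Longrightarrow> \<exists>c. visits K L a c (insert b S)"
  shows "visit_mass s u u' v' \<le> visit_const * d ^ L / real n ^ card S"
proof -
  have "visit_mass s u u' v' \<le> (\<Sum>b\<in>V. prob (\<lambda>K. \<exists>c. visits K L a c (insert b S)))"
    unfolding visit_mass_def
  proof (rule sum_mono)
    fix b assume b: "b \<in> V"
    show "prob (conflict_at s u u' v' b) \<le> prob (\<lambda>K. \<exists>c. visits K L a c (insert b S))"
      by (rule bexp_mono[OF p01]) (use assms(6)[OF b] in auto)
  qed
  also have "\<dots> \<le> visit_const * d ^ L / real n ^ card S" by (rule sum_prob_visits_le) (use assms in auto)
  finally show ?thesis .
qed

text \<open>The paths of a conflict form one walk of length at most \<open>2 k + s\<close> through the vertices in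
  question. Every coincidence among \<open>x, u, u', v'\<close> lacks a factor \<open>1 / n\<close>, but then there
  are fewer pairs in \<open>Q\<close> to sum over, and if \<open>u\<close> itself is \<open>u'\<close> or
  \<open>v'\<close> the walk need not visit it twice, which shortens it by \<open>k\<close>.\<close>

lemma visit_mass_le:
  assumes u: "u \<in> partners" and O: "(u', v') \<in> inner_queries" and s: "s \<le> k"
  shows "visit_mass s u u' v' \<le> visit_const * (of_bool (u' = x) * (d ^ (2 * k + s) / (real n)\<^sup>2) + of_bool (u' = x \<and> v' = u) * (d ^ (k + s) / real n)
     + d ^ (2 * k + s) / real n ^ 3 + of_bool (v' = u) * (d ^ (k + s) / (real n)\<^sup>2) + of_bool (u' = u) * (d ^ (k + s) / (real n)\<^sup>2))"
proof -
  have uV: "u \<in> V" "u \<noteq> x" using partners_ne[OF u] by auto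
  have v': "v' \<in> V" "v' \<noteq> x" "u' \<in> V1" "u' \<noteq> v'" using O V(2) inner_queries_neq[OF O] by (auto simp: inner_queries_def)
  have pos: "0 \<le> visit_const * (d ^ L / real n ^ j)" for L j using visit_const_pos d1 by simp
  consider (a) "u' = x" "v' \<noteq> u" | (a') "u' = x" "v' = u" | (b) "u' \<noteq> x" "v' \<noteq> u" "u' \<noteq> u"
    | (c) "u' \<noteq> x" "v' = u" | (d) "u' = u" "v' \<noteq> u" by blast
  then show ?thesis
  proof cases
    case a
    have "visit_mass s u u' v' \<le> visit_const * d ^ (2 * k + s) / real n ^ card {u, v'}"
    proof (rule visit_mass_le_visits[where a = x])
      fix K b assume "conflict_at s u u' v' b K"
      then obtain i j where c: "near K k u x" "near K k u b" "i + j \<le> s" "near K j v' b" unfolding conflict_at_def by blast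
      have "visits K (0 + k + k + j) x v' (insert v' (insert b (insert u {x})))"
        by (rule visits_near[OF visits_near[OF visits_near[OF visits_start near_sym[OF c(1)]] c(2)] near_sym[OF c(4)]])
      then show "\<exists>c. visits K (2 * k + s) x c (insert b {u, v'})"
        by (intro exI[of _ v']) (rule visits_mono, use c in auto)
    qed (use uV v' a s in \<open>auto simp: card_insert_if\<close>)
    moreover have "card {u, v'} = 2" using a by simp
    ultimately show ?thesis using pos[of "2 * k + s" 3] a uV by (simp add: algebra_simps)
  next
    case a'
    have "visit_mass s u u' v' \<le> visit_const * d ^ (k + s) / real n ^ card {u}"
    proof (rule visit_mass_le_visits[where a = x])
      fix K b assume "conflict_at s u u' v' b K"
      then obtain i j where c: "near K k u x" "i + j \<le> s" "near K j v' b" unfolding conflict_at_def by blast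
      have "visits K (0 + k + j) x b (insert b (insert u {x}))"
        using visits_near[OF visits_near[OF visits_start near_sym[OF c(1)]], of j b] c(3) a' by simp
      then show "\<exists>c. visits K (k + s) x c (insert b {u})"
        by (intro exI[of _ b]) (rule visits_mono, use c in auto)
    qed (use uV v' a' s in auto)
    then show ?thesis using pos[of "2 * k + s" 3] pos[of "2 * k + s" 2] pos[of "k + s" 2] a' uV
      by (simp add: algebra_simps)
  next
    case b
    have "visit_mass s u u' v' \<le> visit_const * d ^ (2 * k + s) / real n ^ card {u, x, u'}"
    proof (rule visit_mass_le_visits[where a = v'])
      fix K b assume "conflict_at s u u' v' b K"
      then obtain i j where c: "near K k u x" "near K k u b" "i + j \<le> s" "near K i u' x" "near K j v' b" unfolding conflict_at_def by blast
      have "visits K (0 + j + k + k + i) v' u' (insert u' (insert x (insert u (insert b {v'}))))"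
        by (rule visits_near[OF visits_near[OF visits_near[OF visits_near[OF visits_start c(5)] near_sym[OF c(2)]] c(1)] near_sym[OF c(4)]])
      then show "\<exists>c. visits K (2 * k + s) v' c (insert b {u, x, u'})"
        by (intro exI[of _ u']) (rule visits_mono, use c in auto)
    qed (use uV v' b s in \<open>auto simp: card_insert_if\<close>)
    moreover have "card {u, x, u'} = 3" using b uV by simp
    ultimately show ?thesis using b by (simp add: algebra_simps)
  next
    case c
    have "visit_mass s u u' v' \<le> visit_const * d ^ (k + s) / real n ^ card {x, u}"
    proof (rule visit_mass_le_visits[where a = u'])
      fix K b assume "conflict_at s u u' v' b K"
      then obtain i j where *: "near K k u x" "i + j \<le> s" "near K i u' x" "near K j u b" unfolding conflict_at_def using c by blast
      have "visits K (0 + i + k + j) u' b (insert b (insert u (insert x {u'})))"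
        by (rule visits_near[OF visits_near[OF visits_near[OF visits_start *(3)] near_sym[OF *(1)]] *(4)])
      then show "\<exists>c. visits K (k + s) u' c (insert b {x, u})"
        by (intro exI[of _ b]) (rule visits_mono, use * in auto)
    qed (use uV v' c s in \<open>auto simp: card_insert_if\<close>)
    moreover have "card {x, u} = 2" using uV by auto
    ultimately show ?thesis using pos[of "2 * k + s" 3] pos[of "k + s" 2] c v'(4) by (simp add: algebra_simps)
  next
    case d
    have "visit_mass s u u' v' \<le> visit_const * d ^ (k + s) / real n ^ card {u, x}"
    proof (rule visit_mass_le_visits[where a = v'])
      fix K b assume "conflict_at s u u' v' b K"
      then obtain i j where *: "near K k u b" "i + j \<le> s" "near K i u x" "near K j v' b" unfolding conflict_at_def using d by blast
      have "visits K (0 + j + k + i) v' x (insert x (insert u (insert b {v'})))"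
        by (rule visits_near[OF visits_near[OF visits_near[OF visits_start *(4)] near_sym[OF *(1)]] *(3)])
      then show "\<exists>c. visits K (k + s) v' c (insert b {u, x})"
        by (intro exI[of _ x]) (rule visits_mono, use * in auto)
    qed (use uV v' d s in \<open>auto simp: card_insert_if\<close>)
    moreover have "card {u, x} = 2" using uV by simp
    ultimately show ?thesis using pos[of "2 * k + s" 3] d uV by (simp add: algebra_simps)
  qed
qed

lemma sum_visit_mass_le:
  assumes s: "s \<le> k"
  shows "(\<Sum>u\<in>partners. \<Sum>(u', v')\<in>inner_queries. visit_mass s u u' v') \<le> visit_const * (conflict_scale * d ^ s)"
proof -
  let ?A = "d ^ (2 * k + s) / (real n)\<^sup>2" and ?B = "d ^ (k + s) / real n" and ?C = "d ^ (2 * k + s) / real n ^ 3"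
    and ?D = "d ^ (k + s) / (real n)\<^sup>2"
  have nn: "0 \<le> ?A" "0 \<le> ?B" "0 \<le> ?C" "0 \<le> ?D" using d1 by auto
  have cnt: "(\<Sum>(u', v')\<in>inner_queries. of_bool (P u' v') :: real) = real (card {t\<in>inner_queries. P (fst t) (snd t)})" for P
  proof -
    have "{t\<in>inner_queries. P (fst t) (snd t)} = inner_queries \<inter> {t. P (fst t) (snd t)}" by auto
    then show ?thesis using finite_inner_queries(1) by (simp add: case_prod_unfold sum_of_bool_eq)
  qed
  have degle: "card {t\<in>inner_queries. fst t = z} \<le> deg Q z" "card {t\<in>inner_queries. snd t = z} \<le> deg Q z" for z
  proof -
    have "card {t\<in>inner_queries. fst t = z} \<le> card ((\<lambda>v. (z, v)) ` {v. {z, v} \<in> Q})"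
      by (rule card_mono) (use finite_nbrs[OF Q] in \<open>auto simp: inner_queries_def\<close>)
    also have "\<dots> \<le> deg Q z" unfolding deg_def by (rule card_image_le[OF finite_nbrs[OF Q]])
    finally show "card {t\<in>inner_queries. fst t = z} \<le> deg Q z" .
    have "card {t\<in>inner_queries. snd t = z} \<le> card ((\<lambda>v. (v, z)) ` {v. {z, v} \<in> Q})"
      by (rule card_mono[OF finite_imageI[OF finite_nbrs[OF Q]]]) (auto simp: inner_queries_def insert_commute)
    also have "\<dots> \<le> deg Q z" unfolding deg_def by (rule card_image_le[OF finite_nbrs[OF Q]])
    finally show "card {t\<in>inner_queries. snd t = z} \<le> deg Q z" .
  qed
  have D4: "(1 + \<delta>) * (2 * q / real n) \<le> 4 * q / real n"
  proof -
    have "(1 + \<delta>) * (2 * q / real n) \<le> 2 * (2 * q / real n)" using \<delta> by (intro mult_right_mono) auto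
    then show ?thesis by simp
  qed
  have per_u: "(\<Sum>(u', v')\<in>inner_queries. visit_mass s u u' v') \<le> visit_const * (4 * q / real n * ?A + ?B + 2 * q * ?C + 2 * real (deg Q u) * ?D)" if u: "u \<in> partners" for u
  proof -
    have "(\<Sum>(u', v')\<in>inner_queries. visit_mass s u u' v') \<le> (\<Sum>(u', v')\<in>inner_queries. visit_const * (of_bool (u' = x) * ?A + of_bool (u' = x \<and> v' = u) * ?B
     + ?C + of_bool (v' = u) * ?D + of_bool (u' = u) * ?D))"
      by (rule sum_mono) (use visit_mass_le[OF u _ s] in auto)
    also have "\<dots> = visit_const * ((\<Sum>(u', v')\<in>inner_queries. of_bool (u' = x)) * ?A + (\<Sum>(u', v')\<in>inner_queries. of_bool (u' = x \<and> v' = u)) * ?B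
       + real (card inner_queries) * ?C + (\<Sum>(u', v')\<in>inner_queries. of_bool (v' = u)) * ?D + (\<Sum>(u', v')\<in>inner_queries. of_bool (u' = u)) * ?D)"
      by (simp only: case_prod_unfold sum_distrib_left[symmetric] sum_distrib_right[symmetric] sum.distrib sum_constant)
    also have "\<dots> \<le> visit_const * (4 * q / real n * ?A + 1 * ?B + 2 * q * ?C + real (deg Q u) * ?D + real (deg Q u) * ?D)"
    proof (intro mult_left_mono add_mono mult_right_mono nn)
      show "(\<Sum>(u', v')\<in>inner_queries. of_bool (u' = x)) \<le> 4 * q / real n"
        unfolding cnt using degle(1)[of x] degx D4 by linarith
      have "card {t\<in>inner_queries. fst t = x \<and> snd t = u} \<le> card {(x, u)}" by (rule card_mono) auto
      then show "(\<Sum>(u', v')\<in>inner_queries. of_bool (u' = x \<and> v' = u)) \<le> (1::real)" unfolding cnt by simp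
      show "real (card inner_queries) \<le> 2 * q"
        using card_mono[OF ordered_pairs_bound(1)[OF Q] finite_inner_queries(2)] ordered_pairs_bound(2)[OF Q] by linarith
      show "(\<Sum>(u', v')\<in>inner_queries. of_bool (v' = u)) \<le> real (deg Q u)" unfolding cnt using degle(2)[of u] by simp
      show "(\<Sum>(u', v')\<in>inner_queries. of_bool (u' = u)) \<le> real (deg Q u)" unfolding cnt using degle(1)[of u] by simp
    qed (use visit_const_pos in simp)
    finally show ?thesis by (simp add: algebra_simps)
  qed
  have "(\<Sum>u\<in>partners. \<Sum>(u', v')\<in>inner_queries. visit_mass s u u' v') \<le> (\<Sum>u\<in>partners. visit_const * (4 * q / real n * ?A + ?B + 2 * q * ?C + 2 * real (deg Q u) * ?D))"
    by (intro sum_mono per_u)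
  also have "\<dots> = visit_const * (real (card partners) * (4 * q / real n * ?A + ?B + 2 * q * ?C) + 2 * (\<Sum>u\<in>partners. real (deg Q u)) * ?D)"
    by (simp add: sum_distrib_left[symmetric] sum_distrib_right[symmetric] sum.distrib sum_divide_distrib[symmetric])
  also have "\<dots> \<le> visit_const * ((4 * q / real n) * (4 * q / real n * ?A + ?B + 2 * q * ?C) + 2 * (2 * q) * ?D)"
  proof (intro mult_left_mono add_mono mult_right_mono nn add_nonneg_nonneg mult_nonneg_nonneg)
    show "real (card partners) \<le> 4 * q / real n" using card_partners D4 by linarith
    have "(\<Sum>u\<in>partners. deg Q u) \<le> 2 * card Q" by (rule card_deg_sum_le[OF Q finite_partners])
    then have "real (\<Sum>u\<in>partners. deg Q u) \<le> real (2 * card Q)" by (simp only: of_nat_le_iff)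
    then show "(\<Sum>u\<in>partners. real (deg Q u)) \<le> 2 * q" by simp
  qed (use visit_const_pos in auto)
  also have "(4 * q / real n) * (4 * q / real n * ?A + ?B + 2 * q * ?C) + 2 * (2 * q) * ?D = conflict_scale * d ^ s"
  proof -
    have "d ^ (2 * k + s) = d ^ k * d ^ k * d ^ s" by (simp add: power_add mult_2)
    moreover have "d ^ (k + s) = d ^ k * d ^ s" by (simp add: power_add)
    ultimately show ?thesis unfolding conflict_scale_def load_def using n
      by (simp add: power2_eq_square power3_eq_cube field_simps)
  qed
  finally show ?thesis .
qed

text \<open>If this is less than \<open>1\<close>, then no \<open>u \<in> partners\<close> is at distance less than
  \<open>k\<close> from \<open>x\<close>, and each relevant ball contains at most \<open>\<eta> / p\<close> blocked
  vertices. Both are read off from a single expectation by Markov's inequality.\<close>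

definition "conflict \<eta> K = (\<Sum>u\<in>partners. of_bool (near K (k - 1) u x)
    + p / \<eta> * (\<Sum>b\<in>V. of_bool (near K k u x \<and> near K k u b \<and> b \<in> blocked k Q V x K)))"

lemma prob_conflict_le:
  assumes u: "u \<in> partners" and b: "b \<in> V"
  shows "prob (\<lambda>K. near K k u x \<and> near K k u b \<and> b \<in> blocked k Q V x K)
     \<le> (\<Sum>(u', v')\<in>inner_queries. (1 + \<delta>) * exp (- lam) * prob (conflict_at (k - 1) u u' v' b) + of_bool (2 \<le> k) * prob (conflict_at (k - 2) u u' v' b))"
proof -
  let ?T = "\<lambda>(u', v') K. of_bool (conflict_at (k - 1) u u' v' b K) * of_bool (\<not> near K (k + 1) u' v') + of_bool (2 \<le> k) * of_bool (conflict_at (k - 2) u u' v' b K) :: real"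
  have T0: "0 \<le> ?T t K" for t K by (auto split: prod.splits)
  have "prob (\<lambda>K. near K k u x \<and> near K k u b \<and> b \<in> blocked k Q V x K) \<le> bexp p E1 (\<lambda>K. \<Sum>t\<in>inner_queries. ?T t K)"
  proof (rule bexp_mono[OF p01])
    fix K
    show "of_bool (near K k u x \<and> near K k u b \<and> b \<in> blocked k Q V x K) \<le> (\<Sum>t\<in>inner_queries. ?T t K)"
    proof (cases "near K k u x \<and> near K k u b \<and> b \<in> blocked k Q V x K")
      case True
      then obtain u' v' i j where *: "u' \<in> V1" "v' \<in> V" "{u', v'} \<in> Q" "near K i u' x" "near K j v' b"
        "i + j + 2 \<le> k \<or> i + j + 1 \<le> k \<and> \<not> near K (k + 1) u' v'"
        unfolding blocked_def by blast
      have O: "(u', v') \<in> inner_queries" using * by (auto simp: inner_queries_def)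
      have "1 \<le> ?T (u', v') K"
      proof (cases "i + j + 2 \<le> k")
        case le: True
        then have "i + j \<le> k - 2" "2 \<le> k" by auto
        then have "conflict_at (k - 2) u u' v' b K" "2 \<le> k" unfolding conflict_at_def using True * by blast+
        then show ?thesis by simp
      next
        case False
        then have "i + j \<le> k - 1" "\<not> near K (k + 1) u' v'" using *(6) by auto
        moreover have "conflict_at (k - 1) u u' v' b K" unfolding conflict_at_def using True * \<open>i + j \<le> k - 1\<close> by blast
        ultimately show ?thesis by (simp del: near.simps)
      qed
      also have "\<dots> \<le> (\<Sum>t\<in>inner_queries. ?T t K)"
        by (rule member_le_sum[OF O]) (use T0 finite_inner_queries in auto)
      finally show ?thesis using True by simp
    next
      case False
      then show ?thesis using sum_nonneg[of inner_queries "\<lambda>t. ?T t K"] T0 by auto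
    qed
  qed
  also have "\<dots> = (\<Sum>(u', v')\<in>inner_queries. bexp p E1 (\<lambda>K. of_bool (conflict_at (k - 1) u u' v' b K) * of_bool (\<not> near K (k + 1) u' v'))
     + of_bool (2 \<le> k) * prob (conflict_at (k - 2) u u' v' b))"
    by (simp add: bexp_sum case_prod_unfold bexp_add bexp_cmult del: near.simps)
  also have "\<dots> \<le> (\<Sum>(u', v')\<in>inner_queries. (1 + \<delta>) * exp (- lam) * prob (conflict_at (k - 1) u u' v' b) + of_bool (2 \<le> k) * prob (conflict_at (k - 2) u u' v' b))"
  proof -
    have each: "bexp p E1 (\<lambda>K. of_bool (conflict_at (k - 1) u u' v' b K) * of_bool (\<not> near K (k + 1) u' v'))
       \<le> (1 + \<delta>) * exp (- lam) * prob (conflict_at (k - 1) u u' v' b)" if O: "(u', v') \<in> inner_queries" for u' v'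
    proof -
      have "bexp p E1 (\<lambda>K. of_bool (conflict_at (k - 1) u u' v' b K) * of_bool (\<not> near K (k + 1) u' v'))
         \<le> prob (conflict_at (k - 1) u u' v' b) * prob (\<lambda>K. \<not> near K (k + 1) u' v')"
      proof (rule harris_mixed[OF p01 finE1])
        fix G G' :: "nat set set" assume G: "G \<subseteq> G'"
        have "conflict_at (k - 1) u u' v' b G \<Longrightarrow> conflict_at (k - 1) u u' v' b G'"
          unfolding conflict_at_def using near_mono_graph[OF _ G] by blast
        then show "of_bool (conflict_at (k - 1) u u' v' b G) \<le> (of_bool (conflict_at (k - 1) u u' v' b G') :: real)" by auto
        show "of_bool (\<not> near G' (k + 1) u' v') \<le> (of_bool (\<not> near G (k + 1) u' v') :: real)"
          using near_mono_graph[OF _ G, of "k + 1" u' v'] by (auto simp del: near.simps)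
      qed
      also have "\<dots> \<le> prob (conflict_at (k - 1) u u' v' b) * ((1 + \<delta>) * exp (- lam))"
      proof (rule mult_left_mono)
        show "prob (\<lambda>K. \<not> near K (k + 1) u' v') \<le> (1 + \<delta>) * exp (- lam)"
          using far[of u' v'] O inner_queries_neq[OF O] by (auto simp: inner_queries_def simp del: near.simps)
        show "0 \<le> prob (conflict_at (k - 1) u u' v' b)" by (rule bexp_nonneg) (use p01 in auto)
      qed
      finally show ?thesis by (simp only: ac_simps)
    qed
    show ?thesis by (rule sum_mono) (use each in auto)
  qed
  finally show ?thesis .
qed

lemma power_k_minus_2: "2 \<le> k \<Longrightarrow> d ^ (k - 2) \<le> \<delta> * exp (- lam) * d ^ (k - 1)"
proof -
  assume "2 \<le> k"
  then have "k - 1 = Suc (k - 2)" by simp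
  then have e: "d ^ (k - 1) = d * d ^ (k - 2)" by (simp only: power_Suc)
  have "1 * d ^ (k - 2) \<le> (\<delta> * exp (- lam) * d) * d ^ (k - 2)"
    using dlam d1 by (intro mult_right_mono) auto
  then show ?thesis unfolding e by (simp only: mult_1 ac_simps)
qed

lemma lam_over_d: "p * d ^ (k - 1) = lam / d"
proof -
  have "d ^ k = d * d ^ (k - 1)" using k by (cases k) auto
  then show ?thesis using d1 by (simp add: lam)
qed

text \<open>In the application both terms are of order \<open>exp \<lambda> / d\<close> up to powers of \<open>ln
  n\<close>, a negative power of \<open>n\<close>. The gain \<open>exp (-\<lambda>)\<close> in the second term, from
  the distance of \<open>u'\<close> and \<open>v'\<close>, compensates one of the two factors \<open>exp
  \<lambda>\<close> in \<open>load\<^sup>2\<close>.\<close>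

lemma expectation_conflict:
  assumes \<eta>: "0 < \<eta>"
  shows "bexp p E1 (conflict \<eta>) \<le> 8 * load / d + 3 * visit_const * conflict_scale * exp (- lam) * lam / (\<eta> * d)"
proof -
  have scale0: "0 \<le> conflict_scale" using load0 by (simp add: conflict_scale_def)
  have eq: "bexp p E1 (conflict \<eta>) = (\<Sum>u\<in>partners. prob (\<lambda>K. near K (k - 1) u x)) + p / \<eta> *
     (\<Sum>u\<in>partners. \<Sum>b\<in>V. prob (\<lambda>K. near K k u x \<and> near K k u b \<and> b \<in> blocked k Q V x K))"
  proof -
    have "bexp p E1 (conflict \<eta>) = (\<Sum>u\<in>partners. bexp p E1 (\<lambda>K. of_bool (near K (k - 1) u x)
       + p / \<eta> * (\<Sum>b\<in>V. of_bool (near K k u x \<and> near K k u b \<and> b \<in> blocked k Q V x K))))"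
      unfolding conflict_def by (rule bexp_sum)
    also have "\<dots> = (\<Sum>u\<in>partners. prob (\<lambda>K. near K (k - 1) u x)
       + p / \<eta> * (\<Sum>b\<in>V. prob (\<lambda>K. near K k u x \<and> near K k u b \<and> b \<in> blocked k Q V x K)))"
      by (simp only: bexp_add bexp_cmult bexp_sum)
    finally show ?thesis by (simp only: sum.distrib sum_distrib_left)
  qed
  have first: "(\<Sum>u\<in>partners. prob (\<lambda>K. near K (k - 1) u x)) \<le> 8 * load / d"
  proof -
    have "(\<Sum>u\<in>partners. prob (\<lambda>K. near K (k - 1) u x)) \<le> real (card partners) * ((1 + \<delta>) * d ^ (k - 1) / real n)"
      by (rule sum_bounded_above) (use prob_near partners_ne in blast)
    also have "\<dots> \<le> (4 * q / real n) * (2 * d ^ (k - 1) / real n)"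
    proof (intro mult_mono divide_right_mono mult_right_mono)
      have "(1 + \<delta>) * (2 * q / real n) \<le> 2 * (2 * q / real n)" using \<delta> by (intro mult_right_mono) auto
      then show "real (card partners) \<le> 4 * q / real n" using card_partners by simp
    qed (use \<delta> d1 in auto)
    also have "\<dots> = 8 * load / d"
    proof -
      have "d ^ k = d * d ^ (k - 1)" using k by (cases k) auto
      then show ?thesis using d1 by (simp add: load_def power2_eq_square)
    qed
    finally show ?thesis .
  qed
  have "(\<Sum>u\<in>partners. \<Sum>b\<in>V. prob (\<lambda>K. near K k u x \<and> near K k u b \<and> b \<in> blocked k Q V x K))
     \<le> (\<Sum>u\<in>partners. \<Sum>b\<in>V. \<Sum>(u', v')\<in>inner_queries. (1 + \<delta>) * exp (- lam) * prob (conflict_at (k - 1) u u' v' b) + of_bool (2 \<le> k) * prob (conflict_at (k - 2) u u' v' b))"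
    by (intro sum_mono prob_conflict_le)
  also have "\<dots> = (1 + \<delta>) * exp (- lam) * (\<Sum>u\<in>partners. \<Sum>(u', v')\<in>inner_queries. visit_mass (k - 1) u u' v')
       + of_bool (2 \<le> k) * (\<Sum>u\<in>partners. \<Sum>(u', v')\<in>inner_queries. visit_mass (k - 2) u u' v')"
  proof -
    have "(\<Sum>b\<in>V. \<Sum>t\<in>inner_queries. c1 * prob (conflict_at s1 u (fst t) (snd t) b) + c2 * prob (conflict_at s2 u (fst t) (snd t) b))
      = c1 * (\<Sum>t\<in>inner_queries. visit_mass s1 u (fst t) (snd t)) + c2 * (\<Sum>t\<in>inner_queries. visit_mass s2 u (fst t) (snd t))" for c1 c2 s1 s2 u
      unfolding visit_mass_def by (subst sum.swap) (simp only: sum.distrib sum_distrib_left)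
    then show ?thesis by (simp only: case_prod_unfold sum.distrib sum_distrib_left)
  qed
  also have "\<dots> \<le> (1 + \<delta>) * exp (- lam) * (visit_const * (conflict_scale * d ^ (k - 1))) + of_bool (2 \<le> k) * (visit_const * (conflict_scale * d ^ (k - 2)))"
    using \<delta> by (intro add_mono mult_left_mono sum_visit_mass_le) auto
  also have "\<dots> \<le> 2 * exp (- lam) * (visit_const * (conflict_scale * d ^ (k - 1))) + visit_const * (conflict_scale * (exp (- lam) * d ^ (k - 1)))"
  proof (rule add_mono)
    show "(1 + \<delta>) * exp (- lam) * (visit_const * (conflict_scale * d ^ (k - 1))) \<le> 2 * exp (- lam) * (visit_const * (conflict_scale * d ^ (k - 1)))"
      using \<delta> visit_const_pos scale0 d1 by (intro mult_right_mono) auto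
    show "of_bool (2 \<le> k) * (visit_const * (conflict_scale * d ^ (k - 2))) \<le> visit_const * (conflict_scale * (exp (- lam) * d ^ (k - 1)))"
    proof (cases "2 \<le> k")
      case True
      have "\<delta> * exp (- lam) * d ^ (k - 1) \<le> 1 * exp (- lam) * d ^ (k - 1)"
        using \<delta> d1 by (intro mult_right_mono) auto
      then have "d ^ (k - 2) \<le> exp (- lam) * d ^ (k - 1)" using power_k_minus_2[OF True] by linarith
      then have "visit_const * (conflict_scale * d ^ (k - 2)) \<le> visit_const * (conflict_scale * (exp (- lam) * d ^ (k - 1)))"
        using visit_const_pos scale0 by (intro mult_left_mono) auto
      then show ?thesis using True by simp
    next
      case False
      then show ?thesis using visit_const_pos scale0 d1 by simp
    qed
  qed
  also have "\<dots> = 3 * visit_const * conflict_scale * exp (- lam) * d ^ (k - 1)" by simp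
  finally have second: "p / \<eta> * (\<Sum>u\<in>partners. \<Sum>b\<in>V. prob (\<lambda>K. near K k u x \<and> near K k u b \<and> b \<in> blocked k Q V x K))
     \<le> p / \<eta> * (3 * visit_const * conflict_scale * exp (- lam) * d ^ (k - 1))"
    using \<eta> p by (intro mult_left_mono) auto
  also have "\<dots> = 3 * visit_const * conflict_scale * exp (- lam) * (p * d ^ (k - 1)) / \<eta>" by simp
  also have "\<dots> = 3 * visit_const * conflict_scale * exp (- lam) * lam / (\<eta> * d)" unfolding lam_over_d by simp
  finally show ?thesis using first unfolding eq by linarith
qed

definition "star = (\<lambda>b. {y, b}) ` V"
definition "clear_prob K = bexp p star (\<lambda>G. of_bool (clear_large k Q V x y (K \<union> G)))"

text \<open>Given a typical \<open>K\<close>, the edges at \<open>y\<close> have to avoid the blocked set and to hit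
  each ball outside it. These conditions concern disjoint sets of edges, hence are independent, and the hitting events
  are positively correlated. The edges at \<open>y\<close> miss a given ball with probability at most \<open>exp (2
  \<eta> - \<lambda>)\<close>.\<close>

lemma clear_prob_ge:
  assumes K: "K \<subseteq> E1" "\<And>v. real (deg K v) \<le> m"
    and \<eta>: "0 < \<eta>" "exp (2 * \<eta>) \<le> 1 + \<delta>" and small: "(1 + \<delta>) * exp (- lam) \<le> 7 / 10"
    and conf: "conflict \<eta> K < 1" and balls: "\<And>u. u \<in> V \<Longrightarrow> lam - \<eta> \<le> p * real (card (kball K u))"
  shows "exp (- (p / (1 - p) * blocked_bound K + 2 * ((1 + \<delta>) * exp (- lam)) * real (card (close_partners K)))) \<le> clear_prob K"
proof -
  let ?T = "blocked k Q V x K" and ?q = "(1 + \<delta>) * exp (- lam)"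
  let ?FT = "(\<lambda>b. {y, b}) ` ?T" and ?Fu = "\<lambda>u. (\<lambda>b. {y, b}) ` (kball K u - ?T)"
  have TV: "?T \<subseteq> V" by (auto simp: blocked_def)
  have inj: "inj_on (\<lambda>b. {y, b}) A" for A by (auto simp: inj_on_def doubleton_eq_iff)
  have fin: "finite star" "finite ?FT" "finite ?T" using V(1) TV finite_subset by (auto simp: star_def)
  define f where "f u = of_bool (near K (k - 1) u x) + p / \<eta> * (\<Sum>b\<in>V. of_bool (near K k u x \<and> near K k u b \<and> b \<in> ?T))" for u
  have terms0: "0 \<le> f u" for u
    unfolding f_def using p \<eta> by (intro add_nonneg_nonneg mult_nonneg_nonneg sum_nonneg) auto
  have each: "of_bool (near K (k - 1) u x) + p / \<eta> * (\<Sum>b\<in>V. of_bool (near K k u x \<and> near K k u b \<and> b \<in> ?T)) < 1"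
    if "u \<in> partners" for u
    using member_le_sum[of u partners f] that terms0 finite_partners conf unfolding conflict_def f_def by fastforce
  have tail0: "0 \<le> p / \<eta> * (\<Sum>b\<in>V. of_bool (near K k u x \<and> near K k u b \<and> b \<in> ?T))" for u
    using p \<eta> by (intro mult_nonneg_nonneg sum_nonneg) auto
  have c1: "\<not> near K (k - 1) u x" if "u \<in> partners" for u
  proof
    assume "near K (k - 1) u x"
    then show False using each[OF that] tail0[of u] by simp
  qed
  have c2: "p * real (card (kball K u \<inter> ?T)) \<le> \<eta>" if u: "u \<in> close_partners K" for u
  proof -
    have uQ: "u \<in> partners" "near K k u x" using u by (auto simp: close_partners_def)
    have "V \<inter> {b. near K k u x \<and> near K k u b \<and> b \<in> ?T} = kball K u \<inter> ?T"
      using uQ TV by (auto simp: kball_def)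
    then have eq: "(\<Sum>b\<in>V. of_bool (near K k u x \<and> near K k u b \<and> b \<in> ?T) :: real) = real (card (kball K u \<inter> ?T))"
      using V(1) by (simp only: sum_of_bool_eq)
    have "0 \<le> (of_bool (near K (k - 1) u x) :: real)" by simp
    then have "p / \<eta> * real (card (kball K u \<inter> ?T)) < 1" using each[OF uQ(1)] unfolding eq by linarith
    then show ?thesis using \<eta> by (simp add: field_simps)
  qed
  have miss: "(1 - p) ^ card (?Fu u) \<le> ?q" if u: "u \<in> close_partners K" for u
  proof -
    have uV: "u \<in> V" using u partners_ne by (auto simp: close_partners_def)
    have finB: "finite (kball K u)" using V(1) by (simp add: kball_def)
    have card: "card (kball K u) = card (kball K u - ?T) + card (kball K u \<inter> ?T)"
      using card_Diff_subset_Int[of "kball K u" ?T] card_mono[OF finB, of "kball K u \<inter> ?T"] finB by simp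
    have "lam - \<eta> \<le> p * real (card (kball K u - ?T)) + p * real (card (kball K u \<inter> ?T))"
      using balls[OF uV] unfolding card by (simp add: distrib_left)
    then have ge: "lam - 2 * \<eta> \<le> p * real (card (kball K u - ?T))" using c2[OF u] by linarith
    have "(1 - p) ^ card (?Fu u) = (1 - p) ^ card (kball K u - ?T)" by (simp add: card_image[OF inj])
    also have "\<dots> \<le> exp (- p) ^ card (kball K u - ?T)"
      using p exp_ge_add_one_self[of "- p"] by (intro power_mono) auto
    also have "\<dots> = exp (- (p * real (card (kball K u - ?T))))"
      by (simp add: exp_of_nat_mult[symmetric] ac_simps)
    also have "\<dots> \<le> exp (2 * \<eta> - lam)" using ge by simp
    also have "\<dots> = exp (2 * \<eta>) * exp (- lam)" by (simp add: exp_diff exp_minus field_simps)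
    also have "\<dots> \<le> ?q" using \<eta> by (intro mult_right_mono) auto
    finally show ?thesis .
  qed
  have KG: "(K \<union> G) \<inter> pairs V1 = K" if "G \<subseteq> star" for G
  proof -
    have "e \<notin> pairs V1" if "e \<in> G" for e
    proof -
      obtain b where "e = {y, b}" using \<open>e \<in> G\<close> \<open>G \<subseteq> star\<close> by (auto simp: star_def)
      then show ?thesis using V by (simp add: doubleton_in_pairs)
    qed
    then show ?thesis using K(1) by blast
  qed
  have yK: "{y, b} \<notin> K" for b
    using edge_in_vertices[OF K(1), of y b] V by auto
  have clear: "clear_large k Q V x y (K \<union> G)"
    if G: "G \<subseteq> star" and a1: "G \<inter> ?FT = {}" and a2: "\<forall>u\<in>close_partners K. G \<inter> ?Fu u \<noteq> {}" for G
    unfolding clear_large_def Let_def KG[OF G]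
  proof (intro conjI ballI impI)
    fix b assume "b \<in> ?T"
    then show "{y, b} \<notin> K \<union> G" using a1 yK by blast
  next
    fix u assume u: "u \<in> V" "{y, u} \<in> Q" "near K k u x"
    then have uQ: "u \<in> partners" "u \<in> close_partners K" by (auto simp: partners_def close_partners_def)
    show "\<not> near K (k - 1) u x" by (rule c1[OF uQ(1)])
    from a2 uQ(2) obtain b where "b \<in> kball K u" "{y, b} \<in> G" by blast
    then show "\<exists>b\<in>V. {y, b} \<in> K \<union> G \<and> near K k u b" by (auto simp: kball_def)
  qed
  have "exp (- (p / (1 - p) * blocked_bound K + 2 * ?q * real (card (close_partners K))))
      = exp (- (p * blocked_bound K) / (1 - p)) * exp (- 2 * ?q) ^ card (close_partners K)"
    by (simp add: exp_add[symmetric] exp_of_nat_mult[symmetric] algebra_simps)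
  also have "\<dots> \<le> (1 - p) ^ card ?FT * (1 - ?q) ^ card (close_partners K)"
  proof (intro mult_mono power_mono)
    have "real (card ?T) \<le> blocked_bound K" by (rule card_blocked_le(2)[OF K])
    then have "p * real (card ?T) / (1 - p) \<le> p * blocked_bound K / (1 - p)"
      using p by (intro divide_right_mono mult_left_mono) auto
    then have "exp (- (p * blocked_bound K) / (1 - p)) \<le> exp (- (\<Sum>i\<in>?T. p) / (1 - p))"
      by (simp add: ac_simps)
    also have "\<dots> \<le> (\<Prod>i\<in>?T. 1 - p)" by (rule prod_one_minus_ge_exp) (use p fin in auto)
    finally show "exp (- (p * blocked_bound K) / (1 - p)) \<le> (1 - p) ^ card ?FT"
      by (simp add: card_image[OF inj])
    \<comment> \<open>By convexity, \<open>exp (- 2 t) \<le> 1 - t\<close> on \<open>[0, 7/10]\<close> follows from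
      the end point \<open>t = 7/10\<close>.\<close>
    have "exp (7 / 5 :: real) \<ge> 10 / 3"
    proof -
      have "(1 + 7 / 50 :: real) ^ 10 \<le> exp (7 / 50) ^ 10" by (intro power_mono exp_ge_add_one_self) simp
      also have "exp (7 / 50 :: real) ^ 10 = exp (7 / 5)" by (simp add: exp_of_nat_mult[symmetric])
      finally show ?thesis by (simp add: power_divide)
    qed
    then have e: "exp (- (7 / 5) :: real) \<le> 3 / 10"
      unfolding exp_minus using le_imp_inverse_le[of "10 / 3" "exp (7 / 5 :: real)"] by simp
    have q0: "0 \<le> ?q" using \<delta> by simp
    show "exp (- 2 * ?q) \<le> 1 - ?q"
    proof -
      define t where "t = ?q / (7 / 10)"
      have t: "0 \<le> t" "t \<le> 1" using q0 small by (auto simp: t_def)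
      have "exp ((1 - t) * 0 + t * (- (7 / 5))) \<le> (1 - t) * exp 0 + t * exp (- (7 / 5))"
        using exp_convex[THEN convex_onD, of t 0 "- (7/5)"] t by simp
      also have "\<dots> \<le> (1 - t) * 1 + t * (3 / 10)"
        using t e by (intro add_mono mult_left_mono) auto
      also have "\<dots> = 1 - ?q" by (simp add: t_def)
      also have "(1 - t) * 0 + t * (- (7 / 5)) = - 2 * ?q" by (simp add: t_def)
      finally show ?thesis .
    qed
  qed (use p in auto)
  also have "(1 - ?q) ^ card (close_partners K) \<le> (\<Prod>u\<in>close_partners K. 1 - (1 - p) ^ card (?Fu u))"
  proof -
    have "(\<Prod>u\<in>close_partners K. 1 - ?q) \<le> (\<Prod>u\<in>close_partners K. 1 - (1 - p) ^ card (?Fu u))"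
      by (rule prod_mono) (use miss small in force)
    then show ?thesis by simp
  qed
  also have "(1 - p) ^ card ?FT * (\<Prod>u\<in>close_partners K. 1 - (1 - p) ^ card (?Fu u))
     \<le> bexp p ?FT (\<lambda>G. of_bool (G \<inter> ?FT = {})) * bexp p (star - ?FT) (\<lambda>G. of_bool (\<forall>u\<in>close_partners K. G \<inter> ?Fu u \<noteq> {}))"
  proof (rule mult_mono)
    show "(1 - p) ^ card ?FT \<le> bexp p ?FT (\<lambda>G. of_bool (G \<inter> ?FT = {}))"
      using bexp_disjoint[OF fin(2) order_refl, of p] by simp
    show "(\<Prod>u\<in>close_partners K. 1 - (1 - p) ^ card (?Fu u)) \<le> bexp p (star - ?FT) (\<lambda>G. of_bool (\<forall>u\<in>close_partners K. G \<inter> ?Fu u \<noteq> {}))"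
    proof (rule harris_hit[OF p01 _ finite_close_partners])
      fix u
      show "?Fu u \<subseteq> star - ?FT"
        by (auto simp: star_def kball_def doubleton_eq_iff)
    qed (use fin in simp)
    show "0 \<le> (\<Prod>u\<in>close_partners K. 1 - (1 - p) ^ card (?Fu u))"
      using p by (intro prod_nonneg) (simp add: power_le_one)
    show "0 \<le> bexp p ?FT (\<lambda>G. of_bool (G \<inter> ?FT = {}))"
      by (rule bexp_nonneg) (use p01 in auto)
  qed
  also have "\<dots> = bexp p ?FT (\<lambda>G1. bexp p (star - ?FT) (\<lambda>G2. of_bool (G1 \<inter> ?FT = {}) * of_bool (\<forall>u\<in>close_partners K. G2 \<inter> ?Fu u \<noteq> {})))"
    by (simp only: bexp_cmult bexp_cmult_right)
  also have "\<dots> \<le> bexp p ?FT (\<lambda>G1. bexp p (star - ?FT) (\<lambda>G2. of_bool (clear_large k Q V x y (K \<union> (G1 \<union> G2)))))"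
  proof (intro bexp_mono[OF p01])
    fix G1 G2 assume G: "G1 \<subseteq> ?FT" "G2 \<subseteq> star - ?FT"
    have FTs: "?FT \<subseteq> star" using TV by (auto simp: star_def)
    have "clear_large k Q V x y (K \<union> (G1 \<union> G2))" if "G1 \<inter> ?FT = {}" "\<forall>u\<in>close_partners K. G2 \<inter> ?Fu u \<noteq> {}"
    proof (rule clear)
      show "G1 \<union> G2 \<subseteq> star" using G FTs by blast
      show "(G1 \<union> G2) \<inter> ?FT = {}" using G that(1) by blast
      show "\<forall>u\<in>close_partners K. (G1 \<union> G2) \<inter> ?Fu u \<noteq> {}" using that(2) by blast
    qed
    then show "of_bool (G1 \<inter> ?FT = {}) * of_bool (\<forall>u\<in>close_partners K. G2 \<inter> ?Fu u \<noteq> {})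
       \<le> (of_bool (clear_large k Q V x y (K \<union> (G1 \<union> G2))) :: real)" by (simp add: of_bool_def)
  qed
  also have "\<dots> = clear_prob K"
  proof -
    have "star = ?FT \<union> (star - ?FT)" using TV by (auto simp: star_def)
    then show ?thesis unfolding clear_prob_def
      using bexp_union[of ?FT "star - ?FT" p "\<lambda>G. of_bool (clear_large k Q V x y (K \<union> G))"] fin by simp
  qed
  finally show ?thesis using p by (simp add: mult_left_mono)
qed

text \<open>Markov's inequality with factor \<open>s\<close> bounds the random exponent of
  \<open>clear_prob_ge\<close> by \<open>c\<close>. Since \<open>s\<close> has to be taken close to \<open>1\<close>,
  in order not to lose in the exponent, only a small positive probability remains; \<open>amplification\<close> is
  content with that.\<close>

theorem prob_clear_prob_ge:
  assumes \<eta>: "0 < \<eta>" "exp (2 * \<eta>) \<le> 1 + \<delta>" and small: "(1 + \<delta>) * exp (- lam) \<le> 7 / 10"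
    and pd: "1 \<le> (1 + \<delta>) * (1 - p)"
    and degrees: "prob (\<lambda>K. \<exists>v. m < real (deg K v)) \<le> e1"
    and balls: "prob (\<lambda>K. \<exists>u\<in>V. p * real (card (kball K u)) < lam - \<eta>) \<le> e2"
    and c: "0 < c" "s * ((1 + \<delta>) ^ (k + 6) * (2 * (real k + 2) * exp (- lam) * load)) \<le> c" and s: "0 < s"
  shows "1 - e1 - e2 - (8 * load / d + 3 * visit_const * conflict_scale * exp (- lam) * lam / (\<eta> * d)) - 1 / s
     \<le> prob (\<lambda>K. exp (- c) \<le> clear_prob K)"
proof -
  let ?q = "(1 + \<delta>) * exp (- lam)"
  define X where "X K = p / (1 - p) * blocked_bound K + 2 * ?q * real (card (close_partners K))" for K
  have conf0: "0 \<le> conflict \<eta> K" for K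
    unfolding conflict_def using p \<eta> by (intro sum_nonneg add_nonneg_nonneg mult_nonneg_nonneg) auto
  have X0: "0 \<le> X K" for K unfolding X_def using p \<delta> blocked_bound_nonneg by simp
  have EX: "bexp p E1 X \<le> (1 + \<delta>) ^ (k + 6) * (2 * (real k + 2) * exp (- lam) * load)"
  proof -
    have "bexp p E1 X = p / (1 - p) * bexp p E1 blocked_bound + 2 * ?q * bexp p E1 (\<lambda>K. real (card (close_partners K)))"
      unfolding X_def by (simp only: bexp_add bexp_cmult)
    also have "\<dots> \<le> ((1 + \<delta>) * p) * ((1 + \<delta>) ^ (k + 5) * (real k * (2 * q) * exp (- lam) * d ^ (k - 1) / real n))
       + 2 * ?q * ((1 + \<delta>)\<^sup>2 * (2 * q * d ^ k / (real n)\<^sup>2))"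
    proof (intro add_mono mult_mono mult_left_mono expectation_blocked_bound expectation_card_close_partners)
      show "p / (1 - p) \<le> (1 + \<delta>) * p"
      proof -
        have "p * 1 \<le> p * ((1 + \<delta>) * (1 - p))" using p pd by (intro mult_left_mono) auto
        then show ?thesis using p by (simp add: pos_divide_le_eq ac_simps)
      qed
      show "0 \<le> bexp p E1 blocked_bound" by (rule bexp_nonneg[OF p01 blocked_bound_nonneg])
      show "0 \<le> bexp p E1 (\<lambda>K. real (card (close_partners K)))" by (rule bexp_nonneg[OF p01]) simp
    qed (use p \<delta> in auto)
    also have "((1 + \<delta>) * p) * ((1 + \<delta>) ^ (k + 5) * (real k * (2 * q) * exp (- lam) * d ^ (k - 1) / real n))
       = (1 + \<delta>) ^ (k + 6) * (2 * real k * exp (- lam) * load)"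
    proof -
      have e1: "d ^ k = d * d ^ (k - 1)" using k by (cases k) auto
      have dn: "d / (real n)\<^sup>2 = p / real n" using n by (simp add: d power2_eq_square)
      have "load = q * d ^ (k - 1) * (d / (real n)\<^sup>2)" by (simp add: load_def e1)
      then have e2: "load = q * d ^ (k - 1) * p / real n" unfolding dn by simp
      have e3: "(1 + \<delta>) ^ (k + 6) = (1 + \<delta>) * (1 + \<delta>) ^ (k + 5)" by (simp add: numeral_eq_Suc)
      show ?thesis unfolding e2 e3 by (simp only: times_divide_eq_right ac_simps)
    qed
    also have "2 * ?q * ((1 + \<delta>)\<^sup>2 * (2 * q * d ^ k / (real n)\<^sup>2)) = (1 + \<delta>) ^ 3 * (4 * exp (- lam) * load)"
      by (simp add: load_def power2_eq_square power3_eq_cube)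
    also have "\<dots> \<le> (1 + \<delta>) ^ (k + 6) * (4 * exp (- lam) * load)"
      using \<delta> load0 by (intro mult_right_mono power_increasing) auto
    finally show ?thesis by (simp add: algebra_simps)
  qed
  let ?B1 = "\<lambda>K. \<exists>v. m < real (deg K v)" and ?B2 = "\<lambda>K. \<exists>u\<in>V. p * real (card (kball K u)) < lam - \<eta>"
  have "1 - prob (\<lambda>K. exp (- c) \<le> clear_prob K) = bexp p E1 (\<lambda>K. 1 - of_bool (exp (- c) \<le> clear_prob K))"
    using finE1 by (simp add: bexp_diff)
  also have "\<dots> \<le> bexp p E1 (\<lambda>K. of_bool (?B1 K) + of_bool (?B2 K) + of_bool (1 \<le> conflict \<eta> K) + of_bool (c \<le> X K))"
  proof (rule bexp_mono[OF p01])
    fix K assume K: "K \<subseteq> E1"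
    show "1 - of_bool (exp (- c) \<le> clear_prob K) \<le> (of_bool (?B1 K) + of_bool (?B2 K) + of_bool (1 \<le> conflict \<eta> K) + of_bool (c \<le> X K) :: real)"
    proof (cases "?B1 K \<or> ?B2 K \<or> 1 \<le> conflict \<eta> K \<or> c \<le> X K")
      case True
      then show ?thesis by (auto simp: of_bool_def)
    next
      case False
      then have g: "\<And>v. real (deg K v) \<le> m" "\<And>u. u \<in> V \<Longrightarrow> lam - \<eta> \<le> p * real (card (kball K u))"
        "conflict \<eta> K < 1" "X K < c" by (auto simp: not_less not_le)
      have "exp (- c) \<le> exp (- X K)" using g(4) by simp
      also have "\<dots> \<le> clear_prob K" unfolding X_def
        by (rule clear_prob_ge[OF K g(1) \<eta> small g(3,2)])
      finally show ?thesis by simp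
    qed
  qed
  also have "\<dots> = prob ?B1 + prob ?B2 + prob (\<lambda>K. 1 \<le> conflict \<eta> K) + prob (\<lambda>K. c \<le> X K)"
    by (simp only: bexp_add)
  also have "\<dots> \<le> e1 + e2 + (8 * load / d + 3 * visit_const * conflict_scale * exp (- lam) * lam / (\<eta> * d)) + 1 / s"
  proof (intro add_mono degrees balls)
    have "prob (\<lambda>K. 1 \<le> conflict \<eta> K) \<le> bexp p E1 (conflict \<eta>) / 1"
      by (rule bexp_markov) (use p01 finE1 conf0 in auto)
    then show "prob (\<lambda>K. 1 \<le> conflict \<eta> K) \<le> 8 * load / d + 3 * visit_const * conflict_scale * exp (- lam) * lam / (\<eta> * d)"
      using expectation_conflict[OF \<eta>(1)] by simp
    have "prob (\<lambda>K. c \<le> X K) \<le> bexp p E1 X / c"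
      by (rule bexp_markov) (use p01 finE1 X0 c in auto)
    also have "\<dots> \<le> (c / s) / c"
    proof (rule divide_right_mono)
      have "s * bexp p E1 X \<le> c" using mult_left_mono[OF EX, of s] s c(2) by linarith
      then show "bexp p E1 X \<le> c / s" using s by (simp add: pos_le_divide_eq mult.commute)
    qed (use c in simp)
    also have "\<dots> = 1 / s" using c by simp
    finally show "prob (\<lambda>K. c \<le> X K) \<le> 1 / s" .
  qed
  finally show ?thesis by linarith
qed

end

section \<open>Consequences of Janson's inequality for paths\<close>

lemma prob_not_near_le:
  fixes p D :: real
  assumes p: "0 \<le> p" "p \<le> 1" and S: "finite S" and uv: "u \<in> S" "v \<in> S" "u \<noteq> v"
    and V0: "V0 \<subseteq> S" "u \<notin> V0" "v \<notin> V0" and l: "l \<le> card V0" and D: "D = real (card V0) * p" "1 \<le> D"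
  shows "bexp p (pairs S) (\<lambda>G. of_bool (\<not> near G (l + 1) u v))
    \<le> exp (- (p * (real (card V0 - l) * p) ^ l) + real (2 * l + 5) ^ (l + 2) * (p * D ^ l)\<^sup>2 / D)"
proof -
  have fV0: "finite V0" using S V0 finite_subset by blast
  have "bexp p (pairs S) (\<lambda>G. of_bool (\<not> near G (l + 1) u v))
     \<le> bexp p (pairs S) (\<lambda>G. of_bool (\<not> (\<exists>w\<in>walks_to V0 {v} l. distinct (u # w) \<and> pedges (u # w) \<subseteq> G)))"
  proof (rule bexp_mono[OF p])
    fix G
    have "near G (l + 1) u v" if w: "w \<in> walks_to V0 {v} l" "distinct (u # w)" "pedges (u # w) \<subseteq> G" for w
    proof -
      have "w \<noteq> []" "length w = Suc l" using walks_to_ne[OF w(1)] length_walks_to[OF w(1)] by auto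
      moreover have "last w = v" using w(1) unfolding walks_to_iff by auto
      ultimately show ?thesis unfolding near_iff_path using w by (intro exI[of _ "u # w"]) auto
    qed
    then show "of_bool (\<not> near G (l + 1) u v)
       \<le> (of_bool (\<not> (\<exists>w\<in>walks_to V0 {v} l. distinct (u # w) \<and> pedges (u # w) \<subseteq> G)) :: real)"
      by (simp add: of_bool_def del: near.simps) blast
  qed
  also have "\<dots> \<le> exp (- (real (card {v}) * p * (real (card V0 - l) * p) ^ l)
         + real (2 * l + 5) ^ (l + 2) * (real (card {v}) * p * D ^ l)\<^sup>2 / D)"
    by (rule prob_no_path_le) (use fV0 p D uv V0 l S pairs_mono[of "insert u (V0 \<union> {v})" S] in auto)
  finally show ?thesis by simp
qed

text \<open>Attach \<open>J\<close> new vertices and join them to everything with probability \<open>p\<close>. If the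
  ball around \<open>u\<close> is small, then it sends no edge to the new vertices with probability at least
  \<open>exp (-J \<mu> / (1 - p))\<close>, and then there is no path of length \<open>k + 1\<close> from
  \<open>u\<close> to them. Comparing with Janson's inequality for such paths bounds the probability of a small ball,
  and large \<open>J\<close> amplifies the difference of the exponents.\<close>

lemma prob_small_ball_le:
  fixes p D \<mu> :: real
  assumes p: "0 \<le> p" "p < 1" and V: "finite V" "u \<in> V" and D: "D = real (card V - 1) * p" "1 \<le> D"
    and k: "k \<le> card V - 1" and J: "1 \<le> J" and V1: "V \<subseteq> V1" "finite V1"
  shows "bexp p (pairs V1) (\<lambda>K. of_bool (p * real (card {b\<in>V. near K k u b}) < \<mu>))
    \<le> exp (real J * \<mu> / (1 - p) - real J * p * (real (card V - 1 - k) * p) ^ k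
        + real (2 * k + 5) ^ (k + 2) * (real J * p * D ^ k)\<^sup>2 / D)"
proof -
  let ?X = "\<lambda>K. {b\<in>V. near K k u b}"
  have p1: "p \<le> 1" using p by simp
  obtain a where a: "\<forall>v\<in>V1. v < a" using finite_nat_set_iff_bounded[of V1] V1(2) by blast
  define Z where "Z = {a..<a + J}"
  have Z: "finite Z" "card Z = J" "V1 \<inter> Z = {}" using a by (auto simp: Z_def)
  define V0 where "V0 = V - {u}"
  have cV0: "card V0 = card V - 1" "finite V0" using V by (auto simp: V0_def)
  let ?E = "pairs (V1 \<union> Z)"
  have finE: "finite ?E" "pairs V1 \<subseteq> ?E" using V1 Z pairs_mono[of V1 "V1 \<union> Z"] by auto
  let ?F = "\<lambda>K. (\<lambda>(b, z). {b, z}) ` (?X K \<times> Z)"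
  have FE: "?F K \<subseteq> ?E - pairs V1" for K
  proof
    fix e assume "e \<in> ?F K"
    then obtain b z where e: "e = {b, z}" "b \<in> V" "z \<in> Z" by auto
    then have "b \<in> V1" "z \<notin> V1" "b \<noteq> z" using V1(1) Z(3) by blast+
    then show "e \<in> ?E - pairs V1" using e by (simp add: doubleton_in_pairs)
  qed
  have cF: "card (?F K) = J * card (?X K)" for K
  proof -
    have "inj_on (\<lambda>(b, z). {b, z}) (?X K \<times> Z)"
    proof (rule inj_onI)
      fix s t assume st: "s \<in> ?X K \<times> Z" "t \<in> ?X K \<times> Z" "(\<lambda>(b, z). {b, z}) s = (\<lambda>(b, z). {b, z}) t"
      obtain b z b' z' where e: "s = (b, z)" "t = (b', z')" by (cases s, cases t)
      then have "b \<noteq> z'" "{b, z} = {b', z'}" using st V1(1) Z(3) by auto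
      then show "s = t" using e by (auto simp: doubleton_eq_iff)
    qed
    then have "card (?F K) = card (?X K \<times> Z)" by (rule card_image)
    then show ?thesis using Z(2) by (simp add: card_cartesian_product)
  qed
  have lower: "bexp p (pairs V1) (\<lambda>K. (1 - p) ^ (J * card (?X K)))
     \<le> bexp p ?E (\<lambda>G. of_bool (\<not> (\<exists>w\<in>walks_to V0 Z k. distinct (u # w) \<and> pedges (u # w) \<subseteq> G)))"
  proof -
    have "bexp p (pairs V1) (\<lambda>K. (1 - p) ^ (J * card (?X K)))
       = bexp p (pairs V1) (\<lambda>K. bexp p (?E - pairs V1) (\<lambda>G. of_bool (G \<inter> ?F K = {})))"
    proof (rule bexp_cong)
      fix K
      show "(1 - p) ^ (J * card (?X K)) = bexp p (?E - pairs V1) (\<lambda>G. of_bool (G \<inter> ?F K = {}))"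
        unfolding cF[of K, symmetric] by (rule bexp_disjoint[symmetric]) (use finE FE in auto)
    qed
    also have "\<dots> \<le> bexp p (pairs V1) (\<lambda>K. bexp p (?E - pairs V1) (\<lambda>G.
        of_bool (\<not> (\<exists>w\<in>walks_to V0 Z k. distinct (u # w) \<and> pedges (u # w) \<subseteq> K \<union> G))))"
    proof (intro bexp_mono[OF p(1) p1])
      fix K G assume KG: "K \<subseteq> pairs V1" "G \<subseteq> ?E - pairs V1"
      have "G \<inter> ?F K \<noteq> {}" if w: "w \<in> walks_to V0 Z k" "distinct (u # w)" "pedges (u # w) \<subseteq> K \<union> G" for w
      proof -
        obtain xs z where xs: "w = xs @ [z]" "set xs \<subseteq> V0" "length xs = k" "z \<in> Z"
          using w(1) unfolding walks_to_iff by blast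
        let ?b = "last (u # xs)"
        have sub: "pedges (u # xs) \<subseteq> pedges (u # w)" and e: "{?b, z} \<in> pedges (u # w)"
        proof -
          have "pedges (ys @ [z]) = pedges ys \<union> (if ys = [] then {} else {{last ys, z}})" for ys
          proof (induction ys)
            case (Cons y ys)
            then show ?case by (cases ys) auto
          qed simp
          from this[of "u # xs"] show "pedges (u # xs) \<subseteq> pedges (u # w)" "{?b, z} \<in> pedges (u # w)"
            using xs(1) by auto
        qed
        have xsV: "set (u # xs) \<subseteq> V" using xs(2) V by (auto simp: V0_def)
        have "pedges (u # xs) \<subseteq> pairs V1"
          by (rule pedges_subset_pairs) (use w(2) xs(1) xsV V1 in auto)
        then have "pedges (u # xs) \<subseteq> K" using sub w(3) KG(2) by blast
        then have "near K k u ?b"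
          unfolding near_iff_path using xs w(2) by (intro exI[of _ "u # xs"]) auto
        moreover have "?b \<in> V" using xsV last_in_set[of "u # xs"] by blast
        ultimately have F: "{?b, z} \<in> ?F K" using xs(4) by (intro image_eqI[of _ _ "(?b, z)"]) auto
        have "{?b, z} \<notin> pairs V1" using subsetD[OF FE F] by (simp only: Diff_iff simp_thms)
        from contra_subsetD[OF KG(1) this] have "{?b, z} \<in> G" using subsetD[OF w(3) e] by (simp only: Un_iff simp_thms)
        then have "{?b, z} \<in> G \<inter> ?F K" using F by (rule IntI)
        then show ?thesis by (rule ex_in_conv[THEN iffD1, OF exI])
      qed
      then show "of_bool (G \<inter> ?F K = {}) \<le> (of_bool (\<not> (\<exists>w\<in>walks_to V0 Z k. distinct (u # w) \<and> pedges (u # w) \<subseteq> K \<union> G)) :: real)"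
        by (simp only: of_bool_def) (smt (verit))
    qed
    also have "\<dots> = bexp p ?E (\<lambda>G. of_bool (\<not> (\<exists>w\<in>walks_to V0 Z k. distinct (u # w) \<and> pedges (u # w) \<subseteq> G)))"
    proof -
      have "pairs V1 \<union> (?E - pairs V1) = ?E" using finE(2) by blast
      then show ?thesis
        using bexp_union[of "pairs V1" "?E - pairs V1" p "\<lambda>G. of_bool (\<not> (\<exists>w\<in>walks_to V0 Z k. distinct (u # w) \<and> pedges (u # w) \<subseteq> G))"]
          finE V1(2) by simp
    qed
    finally show ?thesis .
  qed
  let ?c = "exp (- (real J * \<mu> / (1 - p)))"
  have "?c * bexp p (pairs V1) (\<lambda>K. of_bool (p * real (card (?X K)) < \<mu>))
      = bexp p (pairs V1) (\<lambda>K. ?c * of_bool (p * real (card (?X K)) < \<mu>))"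
    by (rule bexp_cmult[symmetric])
  also have "\<dots> \<le> bexp p (pairs V1) (\<lambda>K. (1 - p) ^ (J * card (?X K)))"
  proof (rule bexp_mono[OF p(1) p1])
    fix K
    show "?c * of_bool (p * real (card (?X K)) < \<mu>) \<le> (1 - p) ^ (J * card (?X K))"
    proof (cases "p * real (card (?X K)) < \<mu>")
      case True
      have "real J * (p * real (card (?X K))) / (1 - p) \<le> real J * \<mu> / (1 - p)"
        using True p by (intro divide_right_mono mult_left_mono) auto
      then have "?c \<le> exp (- (real J * (p * real (card (?X K))) / (1 - p)))" by simp
      also have "\<dots> = exp (- p / (1 - p)) ^ (J * card (?X K))"
        by (simp add: exp_of_nat_mult[symmetric] ac_simps)
      also have "\<dots> \<le> (1 - p) ^ (J * card (?X K))"
        using one_minus_ge_exp[of p p] p by (intro power_mono) auto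
      finally show ?thesis using True by simp
    next
      case False
      then show ?thesis using p by simp
    qed
  qed
  also have "\<dots> \<le> bexp p ?E (\<lambda>G. of_bool (\<not> (\<exists>w\<in>walks_to V0 Z k. distinct (u # w) \<and> pedges (u # w) \<subseteq> G)))"
    by (rule lower)
  also have "\<dots> \<le> exp (- (real (card Z) * p * (real (card V0 - k) * p) ^ k)
         + real (2 * k + 5) ^ (k + 2) * (real (card Z) * p * D ^ k)\<^sup>2 / D)"
  proof (rule prob_no_path_le)
    show "D = real (card V0) * p" using D cV0 by simp
    show "1 \<le> D" by (rule D(2))
    show "pairs (insert u (V0 \<union> Z)) \<subseteq> ?E" by (rule pairs_mono) (use V V1 in \<open>auto simp: V0_def\<close>)
    show "u \<notin> Z" "V0 \<inter> Z = {}" using V V1 Z by (auto simp: V0_def)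
  qed (use cV0 Z p k J finE V in \<open>auto simp: V0_def\<close>)
  finally have *: "?c * bexp p (pairs V1) (\<lambda>K. of_bool (p * real (card (?X K)) < \<mu>))
     \<le> exp (- (real J * p * (real (card V - 1 - k) * p) ^ k) + real (2 * k + 5) ^ (k + 2) * (real J * p * D ^ k)\<^sup>2 / D)"
    by (simp only: cV0 Z)
  have "bexp p (pairs V1) (\<lambda>K. of_bool (p * real (card (?X K)) < \<mu>))
      = exp (real J * \<mu> / (1 - p)) * (?c * bexp p (pairs V1) (\<lambda>K. of_bool (p * real (card (?X K)) < \<mu>)))"
    by (simp add: exp_minus)
  also have "\<dots> \<le> exp (real J * \<mu> / (1 - p)) *
     exp (- (real J * p * (real (card V - 1 - k) * p) ^ k) + real (2 * k + 5) ^ (k + 2) * (real J * p * D ^ k)\<^sup>2 / D)"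
    by (rule mult_left_mono[OF *]) simp
  also have "\<dots> = exp (real J * \<mu> / (1 - p) - real J * p * (real (card V - 1 - k) * p) ^ k
        + real (2 * k + 5) ^ (k + 2) * (real J * p * D ^ k)\<^sup>2 / D)"
    by (simp add: exp_add[symmetric] algebra_simps)
  finally show ?thesis .
qed

lemma prob_some_deg_large:
  fixes \<delta> d p :: real
  assumes p: "0 \<le> p" "p \<le> 1" and S: "finite S" "card S \<le> n" and d: "real n * p \<le> d" and \<delta>: "0 < \<delta>"
  shows "bexp p (pairs S) (\<lambda>G. of_bool (\<exists>v. (1 + \<delta>) * d < real (deg G v)))
     \<le> real n * exp (- d * ((1 + \<delta>) * ln (1 + \<delta>) - \<delta>))"
proof -
  have d0: "0 \<le> d" using d p by (meson mult_nonneg_nonneg of_nat_0_le_iff order_trans)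
  have dS: "real (card S) * p \<le> d"
    using mult_right_mono[of "real (card S)" "real n" p] S p d by simp
  have "bexp p (pairs S) (\<lambda>G. of_bool (\<exists>v. (1 + \<delta>) * d < real (deg G v)))
     \<le> (\<Sum>v\<in>S. bexp p (pairs S) (\<lambda>G. of_bool ((1 + \<delta>) * d \<le> real (deg G v))))"
  proof (rule bexp_union_bound[OF p])
    fix G assume G: "G \<subseteq> pairs S" and "\<exists>v. (1 + \<delta>) * d < real (deg G v)"
    then obtain v where v: "(1 + \<delta>) * d < real (deg G v)" by auto
    have "0 \<le> (1 + \<delta>) * d" using d0 \<delta> by simp
    then have "0 < deg G v" using v by linarith
    then have "{w. {v, w} \<in> G} \<noteq> {}" unfolding deg_def by (metis card.empty less_irrefl)
    then have "v \<in> S" using edge_in_vertices[OF G] by blast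
    then show "\<exists>v\<in>S. (1 + \<delta>) * d \<le> real (deg G v)" using v by (intro bexI[of _ v]) auto
  qed (use S in auto)
  also have "\<dots> \<le> (\<Sum>v\<in>S. exp (- d * ((1 + \<delta>) * ln (1 + \<delta>) - \<delta>)))"
    by (intro sum_mono prob_deg_large p S dS \<delta>)
  also have "\<dots> \<le> real n * exp (- d * ((1 + \<delta>) * ln (1 + \<delta>) - \<delta>))"
    using S by (simp add: mult_right_mono)
  finally show ?thesis .
qed

section \<open>Many candidate pairs\<close>

locale candidate_pairs =
  fixes k n r :: nat and p :: real and Q :: "nat set set" and xs ys :: "nat \<Rightarrow> nat"
  assumes k: "1 \<le> k" and p: "0 < p" "p < 1"
    and Q: "Q \<subseteq> vertex_pairs n"
    and inj: "inj_on xs {..<r}" "inj_on ys {..<r}" "xs ` {..<r} \<inter> ys ` {..<r} = {}"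
    and in_n: "xs ` {..<r} \<subseteq> {1..n}" "ys ` {..<r} \<subseteq> {1..n}"
    and notQ: "\<And>i. i < r \<Longrightarrow> {xs i, ys i} \<notin> Q"
begin

definition "test_vertices = xs ` {..<r} \<union> ys ` {..<r}"
definition "other_vertices = {1..n} - test_vertices"
abbreviation "Pr P \<equiv> bexp p (vertex_pairs n) (\<lambda>G. of_bool (P G))"

lemma test_vertices: "test_vertices \<subseteq> {1..n}" "card test_vertices = 2 * r" "finite test_vertices"
proof -
  show "test_vertices \<subseteq> {1..n}" "finite test_vertices" using in_n by (auto simp: test_vertices_def)
  show "card test_vertices = 2 * r" unfolding test_vertices_def using inj by (subst card_Un_disjoint) (auto simp: card_image)
qed

lemma other_vertices: "finite other_vertices" "card other_vertices = n - 2 * r" "other_vertices \<subseteq> {1..n}" "xs i \<notin> other_vertices \<or> \<not> i < r" "ys i \<notin> other_vertices \<or> \<not> i < r"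
proof -
  show "finite other_vertices" "other_vertices \<subseteq> {1..n}" by (auto simp: other_vertices_def)
  show "card other_vertices = n - 2 * r" unfolding other_vertices_def using test_vertices by (simp add: card_Diff_subset)
  show "xs i \<notin> other_vertices \<or> \<not> i < r" "ys i \<notin> other_vertices \<or> \<not> i < r" by (auto simp: other_vertices_def test_vertices_def)
qed

lemma finV: "finite (vertex_pairs n)" by (simp add: vertex_pairs_eq)

text \<open>The common part of the edges is \<open>pairs other_vertices\<close> in the first alternative. In the
  second it also contains the edges at the \<open>xs i\<close>, and only the stars at the \<open>ys i\<close> are
  private.\<close>

theorem prob_reconstructible_le:
  assumes phi: "0 \<le> \<phi>" and g1: "g \<le> 1"
    and D1: "Pr (\<lambda>G. \<exists>u v. {u, v} \<in> Q \<and> \<not> near G (k + 2) u v) \<le> e1"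
    and D2: "Pr (\<lambda>G. \<exists>w\<in>test_vertices. \<exists>w'\<in>test_vertices. w \<noteq> w' \<and> near G k w w') \<le> e2"
    and ex: "(\<forall>i<r. g \<le> bexp p (pairs other_vertices) (\<lambda>H. of_bool (\<phi> \<le> bexp p ((\<lambda>v. {xs i, v}) ` other_vertices \<union> (\<lambda>v. {ys i, v}) ` other_vertices)
                (\<lambda>G. of_bool (clear_small k Q other_vertices (xs i) (ys i) (H \<union> G)))))) \<or>
      (\<forall>i<r. g \<le> bexp p (pairs (insert (xs i) other_vertices)) (\<lambda>K. of_bool (\<phi> \<le> bexp p ((\<lambda>v. {ys i, v}) ` other_vertices)
                (\<lambda>G. of_bool (clear_large k Q other_vertices (xs i) (ys i) (K \<union> G))))))"
  shows "Pr (reconstructible n Q) \<le> 1 - g / 2 + exp (- (g * \<phi> * real r / 2)) + e1 + e2"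
proof -
  have p01: "0 \<le> p" "p \<le> 1" using p by auto
  have main: "Pr (\<lambda>G. \<forall>i<r. \<not> (clear_small k Q other_vertices (xs i) (ys i) G \<or> clear_large k Q other_vertices (xs i) (ys i) G))
     \<le> 1 - g / 2 + exp (- (g * \<phi> * real r / 2))"
    using ex
  proof
    assume S: "\<forall>i<r. g \<le> bexp p (pairs other_vertices) (\<lambda>H. of_bool (\<phi> \<le> bexp p ((\<lambda>v. {xs i, v}) ` other_vertices \<union> (\<lambda>v. {ys i, v}) ` other_vertices)
                (\<lambda>G. of_bool (clear_small k Q other_vertices (xs i) (ys i) (H \<union> G)))))"
    let ?E = "\<lambda>i. (\<lambda>v. {xs i, v}) ` other_vertices \<union> (\<lambda>v. {ys i, v}) ` other_vertices"
    have "Pr (\<lambda>G. \<forall>i<r. \<not> (clear_small k Q other_vertices (xs i) (ys i) G \<or> clear_large k Q other_vertices (xs i) (ys i) G))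
       \<le> Pr (\<lambda>G. \<forall>i<r. \<not> clear_small k Q other_vertices (xs i) (ys i) G)"
      by (rule bexp_mono[OF p01]) auto
    also have "\<dots> \<le> 1 - g / 2 + exp (- (g * \<phi> * real r / 2))"
    proof (rule amplification[OF p01 finV])
      show "pairs other_vertices \<subseteq> vertex_pairs n" using pairs_mono[OF other_vertices(3)] by (simp add: vertex_pairs_eq)
      fix i assume i: "i < r"
      have xyi: "xs i \<notin> other_vertices" "ys i \<notin> other_vertices" "xs i \<in> {1..n}" "ys i \<in> {1..n}" using i other_vertices(4,5)[of i] in_n by auto
      show "?E i \<subseteq> vertex_pairs n"
        unfolding vertex_pairs_eq using xyi other_vertices(3) by (auto simp: doubleton_in_pairs)
      show "pairs other_vertices \<inter> ?E i = {}" using xyi by (auto simp: doubleton_in_pairs)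
      show "g \<le> bexp p (pairs other_vertices) (\<lambda>H. of_bool (\<phi> \<le> bexp p (?E i) (\<lambda>G. of_bool (clear_small k Q other_vertices (xs i) (ys i) (H \<union> G)))))"
        using S i by blast
      fix G
      have HH: "G \<inter> (pairs other_vertices \<union> ?E i) \<inter> pairs other_vertices = G \<inter> pairs other_vertices" by blast
      have xe: "{xs i, a} \<in> G \<inter> (pairs other_vertices \<union> ?E i) \<longleftrightarrow> {xs i, a} \<in> G"
        "{ys i, a} \<in> G \<inter> (pairs other_vertices \<union> ?E i) \<longleftrightarrow> {ys i, a} \<in> G" if "a \<in> other_vertices" for a using that by blast+
      show "clear_small k Q other_vertices (xs i) (ys i) G = clear_small k Q other_vertices (xs i) (ys i) (G \<inter> (pairs other_vertices \<union> ?E i))"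
        unfolding clear_small_def Let_def HH using xe by (simp cong: ball_cong)
    next
      fix i j assume ij: "i < r" "j < r" "i \<noteq> j"
      have ne: "xs i \<noteq> xs j" "ys i \<noteq> ys j" "xs i \<noteq> ys j" "ys i \<noteq> xs j"
        using ij inj by (auto dest: inj_onD)
      show "?E i \<inter> ?E j = {}"
        using ne ij other_vertices(4,5)[of i] other_vertices(4,5)[of j] by (auto simp: doubleton_eq_iff)
    qed (use phi g1 in auto)
    finally show ?thesis .
  next
    assume L: "\<forall>i<r. g \<le> bexp p (pairs (insert (xs i) other_vertices)) (\<lambda>K. of_bool (\<phi> \<le> bexp p ((\<lambda>v. {ys i, v}) ` other_vertices)
                (\<lambda>G. of_bool (clear_large k Q other_vertices (xs i) (ys i) (K \<union> G)))))"
    let ?E = "\<lambda>i. (\<lambda>v. {ys i, v}) ` other_vertices" and ?V0 = "other_vertices \<union> xs ` {..<r}"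
    have "Pr (\<lambda>G. \<forall>i<r. \<not> (clear_small k Q other_vertices (xs i) (ys i) G \<or> clear_large k Q other_vertices (xs i) (ys i) G))
       \<le> Pr (\<lambda>G. \<forall>i<r. \<not> clear_large k Q other_vertices (xs i) (ys i) G)"
      by (rule bexp_mono[OF p01]) auto
    also have "\<dots> \<le> 1 - g / 2 + exp (- (g * \<phi> * real r / 2))"
    proof (rule amplification[OF p01 finV])
      show "pairs ?V0 \<subseteq> vertex_pairs n" using pairs_mono[of ?V0 "{1..n}"] other_vertices(3) in_n by (simp add: vertex_pairs_eq)
      fix i assume i: "i < r"
      have xyi: "xs i \<notin> other_vertices" "ys i \<notin> other_vertices" "xs i \<in> {1..n}" "ys i \<in> {1..n}" "ys i \<notin> ?V0"
        using i other_vertices(4,5)[of i] in_n inj(3) by auto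
      let ?V1 = "insert (xs i) other_vertices"
      have sub: "pairs ?V1 \<subseteq> pairs ?V0" by (rule pairs_mono) (use i in auto)
      show "?E i \<subseteq> vertex_pairs n"
        unfolding vertex_pairs_eq using xyi other_vertices(3) by (auto simp: doubleton_in_pairs)
      show "pairs ?V0 \<inter> ?E i = {}" using xyi by (auto simp: doubleton_in_pairs)
      have loc: "clear_large k Q other_vertices (xs i) (ys i) G = clear_large k Q other_vertices (xs i) (ys i) G'"
        if "G \<inter> pairs ?V1 = G' \<inter> pairs ?V1" "G \<inter> ?E i = G' \<inter> ?E i" for G G'
      proof -
        have ye: "{ys i, b} \<in> G \<longleftrightarrow> {ys i, b} \<in> G'" if "b \<in> other_vertices" for b
          using that \<open>G \<inter> ?E i = G' \<inter> ?E i\<close> by blast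
        have yb: "{ys i, b} \<in> G \<longleftrightarrow> {ys i, b} \<in> G'" if "b \<in> blocked k Q other_vertices (xs i) K" for b K
          using that ye by (simp add: blocked_def)
        show ?thesis unfolding clear_large_def Let_def that(1) using ye yb by (simp cong: ball_cong bex_cong)
      qed
      show "clear_large k Q other_vertices (xs i) (ys i) G = clear_large k Q other_vertices (xs i) (ys i) (G \<inter> (pairs ?V0 \<union> ?E i))" for G
        by (rule loc) (use sub in blast)+
      have "g \<le> bexp p (pairs ?V1) (\<lambda>K. of_bool (\<phi> \<le> bexp p (?E i) (\<lambda>G. of_bool (clear_large k Q other_vertices (xs i) (ys i) (K \<union> G)))))"
        using L i by blast
      also have "\<dots> = bexp p (pairs ?V0) (\<lambda>K. of_bool (\<phi> \<le> bexp p (?E i) (\<lambda>G. of_bool (clear_large k Q other_vertices (xs i) (ys i) ((K \<inter> pairs ?V1) \<union> G)))))"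
        by (rule bexp_restrict[OF _ sub, symmetric]) (use other_vertices(1) in simp)
      also have "\<dots> = bexp p (pairs ?V0) (\<lambda>K. of_bool (\<phi> \<le> bexp p (?E i) (\<lambda>G. of_bool (clear_large k Q other_vertices (xs i) (ys i) (K \<union> G)))))"
      proof (intro bexp_cong arg_cong[where f = of_bool] arg_cong2[where f = "(\<le>)"] refl)
        fix K G assume KG: "K \<subseteq> pairs ?V0" "G \<subseteq> ?E i"
        have d: "pairs ?V0 \<inter> ?E i = {}" using xyi by (auto simp: doubleton_in_pairs)
        show "clear_large k Q other_vertices (xs i) (ys i) ((K \<inter> pairs ?V1) \<union> G) = clear_large k Q other_vertices (xs i) (ys i) (K \<union> G)"
          by (rule loc) (use KG d in blast)+
      qed
      finally show "g \<le> bexp p (pairs ?V0) (\<lambda>K. of_bool (\<phi> \<le> bexp p (?E i) (\<lambda>G. of_bool (clear_large k Q other_vertices (xs i) (ys i) (K \<union> G)))))" .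
    next
      fix i j assume ij: "i < r" "j < r" "i \<noteq> j"
      have ne: "ys i \<noteq> ys j" using ij inj by (auto dest: inj_onD)
      show "?E i \<inter> ?E j = {}"
        using ne ij other_vertices(5)[of i] other_vertices(5)[of j] by (auto simp: doubleton_eq_iff)
    qed (use phi g1 in auto)
    finally show ?thesis .
  qed
  have "Pr (reconstructible n Q) \<le> bexp p (vertex_pairs n) (\<lambda>G.
      of_bool (\<forall>i<r. \<not> (clear_small k Q other_vertices (xs i) (ys i) G \<or> clear_large k Q other_vertices (xs i) (ys i) G))
      + of_bool (\<exists>u v. {u, v} \<in> Q \<and> \<not> near G (k + 2) u v)
      + of_bool (\<exists>w\<in>test_vertices. \<exists>w'\<in>test_vertices. w \<noteq> w' \<and> near G k w w'))"
  proof (rule bexp_mono[OF p01])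
    fix G assume G: "G \<subseteq> vertex_pairs n"
    have "\<not> reconstructible n Q G"
      if i: "i < r" and cl: "clear_small k Q other_vertices (xs i) (ys i) G \<or> clear_large k Q other_vertices (xs i) (ys i) G"
        and d1: "\<not> (\<exists>u v. {u, v} \<in> Q \<and> \<not> near G (k + 2) u v)"
        and d2: "\<not> (\<exists>w\<in>test_vertices. \<exists>w'\<in>test_vertices. w \<noteq> w' \<and> near G k w w')" for i
    proof (rule not_reconstructible_if_clear[OF k G test_vertices(1)])
      show "xs i \<in> test_vertices" "ys i \<in> test_vertices" using i by (auto simp: test_vertices_def)
      show "xs i \<noteq> ys i" using i inj(3) by auto
      show "\<not> near G k w w'" if "w \<in> test_vertices" "w' \<in> test_vertices" "w \<noteq> w'" for w w' using d2 that by blast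
      show "near G (k + 2) u v" if "{u, v} \<in> Q" for u v using d1 that by blast
      show "{xs i, ys i} \<notin> Q" by (rule notQ[OF i])
      show "clear_small k Q ({1..n} - test_vertices) (xs i) (ys i) G \<or> clear_large k Q ({1..n} - test_vertices) (xs i) (ys i) G"
        using cl by (simp only: other_vertices_def)
    qed
    then show "of_bool (reconstructible n Q G) \<le>
      (of_bool (\<forall>i<r. \<not> (clear_small k Q other_vertices (xs i) (ys i) G \<or> clear_large k Q other_vertices (xs i) (ys i) G))
      + of_bool (\<exists>u v. {u, v} \<in> Q \<and> \<not> near G (k + 2) u v)
      + of_bool (\<exists>w\<in>test_vertices. \<exists>w'\<in>test_vertices. w \<noteq> w' \<and> near G k w w') :: real)"
      by (simp only: of_bool_def) (smt (verit))
  qed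
  also have "\<dots> = Pr (\<lambda>G. \<forall>i<r. \<not> (clear_small k Q other_vertices (xs i) (ys i) G \<or> clear_large k Q other_vertices (xs i) (ys i) G))
      + Pr (\<lambda>G. \<exists>u v. {u, v} \<in> Q \<and> \<not> near G (k + 2) u v)
      + Pr (\<lambda>G. \<exists>w\<in>test_vertices. \<exists>w'\<in>test_vertices. w \<noteq> w' \<and> near G k w w')"
    by (simp only: bexp_add)
  also have "\<dots> \<le> 1 - g / 2 + exp (- (g * \<phi> * real r / 2)) + e1 + e2"
    by (intro add_mono main D1 D2)
  finally show ?thesis .
qed

end

lemma many_low_degree_vertices:
  fixes \<delta> :: real
  assumes Q: "Q \<subseteq> vertex_pairs n" and n: "0 < n" and \<delta>: "0 < \<delta>"
  shows "\<delta> / (1 + \<delta>) * real n \<le> real (card {v\<in>{1..n}. real (deg Q v) \<le> (1 + \<delta>) * (2 * real (card Q) / real n)})"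
proof -
  let ?L = "{v\<in>{1..n}. real (deg Q v) \<le> (1 + \<delta>) * (2 * real (card Q) / real n)}"
  let ?B = "{1..n} - ?L"
  have cB: "real (card ?B) = real n - real (card ?L)"
  proof -
    have sub: "?L \<subseteq> {1..n}" and finL: "finite ?L" by auto
    have "card ?B = card {1..n} - card ?L" by (rule card_Diff_subset[OF finL sub])
    moreover have "card ?L \<le> card {1..n}" by (rule card_mono[OF _ sub]) simp
    ultimately show ?thesis by (simp only: of_nat_diff) simp
  qed
  have fin: "finite Q" using Q finite_subset vertex_pairs_eq finite_pairs by (metis finite_atLeastAtMost)
  show ?thesis
  proof (cases "card Q = 0")
    case True
    then have "Q = {}" using fin by simp
    then have "?L = {1..n}" using \<delta> by (auto simp: deg_def)
    moreover have "\<delta> / (1 + \<delta>) * real n \<le> 1 * real n" using \<delta> by (intro mult_right_mono) auto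
    ultimately show ?thesis by simp
  next
    case False
    let ?t = "(1 + \<delta>) * (2 * real (card Q) / real n)"
    have t: "0 < ?t" using False \<delta> n by simp
    have "real (card ?B) * ?t = (\<Sum>v\<in>?B. ?t)" by simp
    also have "\<dots> \<le> (\<Sum>v\<in>?B. real (deg Q v))" by (rule sum_mono) auto
    also have "\<dots> = real (\<Sum>v\<in>?B. deg Q v)" by simp
    also have "\<dots> \<le> real (2 * card Q)"
      by (simp only: of_nat_le_iff) (rule card_deg_sum_le[OF Q[unfolded vertex_pairs_eq]], auto)
    also have "real (2 * card Q) = (real n / (1 + \<delta>)) * ?t" using n \<delta> by simp
    finally have "real (card ?B) \<le> real n / (1 + \<delta>)" using t by (simp only: mult_le_cancel_right_pos)
    moreover have "real n - real n / (1 + \<delta>) = \<delta> / (1 + \<delta>) * real n" using \<delta> by (simp add: field_simps)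
    ultimately show ?thesis using cB by linarith
  qed
qed

text \<open>Greedily: among the unused vertices of \<open>L\<close>, at most \<open>D\<close> are
  \<open>Q\<close>-neighbours of the vertex \<open>x\<close> chosen first.\<close>

lemma choose_disjoint_pairs:
  assumes L: "finite L" and Q: "Q \<subseteq> pairs V0" "finite V0" and deg: "\<And>v. v \<in> L \<Longrightarrow> deg Q v \<le> D"
    and big: "2 * r + D < card L"
  shows "\<exists>xs ys. inj_on xs {..<r} \<and> inj_on ys {..<r} \<and> xs ` {..<r} \<inter> ys ` {..<r} = {} \<and>
     xs ` {..<r} \<subseteq> L \<and> ys ` {..<r} \<subseteq> L \<and> (\<forall>i<r. {xs i, ys i} \<notin> (Q :: nat set set))"
  using big
proof (induction r)
  case (Suc r)
  then obtain xs ys where IH: "inj_on xs {..<r}" "inj_on ys {..<r}" "xs ` {..<r} \<inter> ys ` {..<r} = {}"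
     "xs ` {..<r} \<subseteq> L" "ys ` {..<r} \<subseteq> L" "\<forall>i<r. {xs i, ys i} \<notin> Q" by auto
  let ?U = "xs ` {..<r} \<union> ys ` {..<r}"
  have cU: "card ?U \<le> 2 * r"
    using card_Un_le[of "xs ` {..<r}" "ys ` {..<r}"] card_image_le[of "{..<r}" xs] card_image_le[of "{..<r}" ys] by simp
  have "\<not> L \<subseteq> ?U" using card_mono[of ?U L] cU Suc.prems by auto
  then obtain x where x: "x \<in> L" "x \<notin> ?U" by blast
  let ?N = "insert x (?U \<union> {w. {x, w} \<in> Q})"
  have fN: "finite ?N" using finite_nbrs[OF Q, of x] by simp
  have "card ?N \<le> Suc (card ?U + deg Q x)"
    using card_insert_le_m1[of "Suc (card ?U + deg Q x)" "?U \<union> {w. {x, w} \<in> Q}" x] card_Un_le[of ?U "{w. {x, w} \<in> Q}"]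
    by (simp add: deg_def)
  also have "\<dots> < card L" using cU deg[OF x(1)] Suc.prems by simp
  finally have "\<not> L \<subseteq> ?N" using card_mono[OF fN, of L] by auto
  then obtain y where y: "y \<in> L" "y \<notin> ?N" by blast
  define xs' where "xs' = xs(r := x)"
  define ys' where "ys' = ys(r := y)"
  have im: "xs' ` {..<Suc r} = insert x (xs ` {..<r})" "ys' ` {..<Suc r} = insert y (ys ` {..<r})"
    by (auto simp: xs'_def ys'_def lessThan_Suc)
  show ?case
  proof (rule exI[of _ xs'], rule exI[of _ ys'], intro conjI allI impI)
    show "inj_on xs' {..<Suc r}" using IH(1) x by (auto simp: xs'_def inj_on_def less_Suc_eq)
    show "inj_on ys' {..<Suc r}" using IH(2) y by (auto simp: ys'_def inj_on_def less_Suc_eq)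
    show "xs' ` {..<Suc r} \<inter> ys' ` {..<Suc r} = {}" unfolding im using IH(3) x y by auto
    show "xs' ` {..<Suc r} \<subseteq> L" "ys' ` {..<Suc r} \<subseteq> L" unfolding im using IH x y by auto
    fix i assume "i < Suc r"
    then show "{xs' i, ys' i} \<notin> Q" using IH(6) y by (auto simp: xs'_def ys'_def less_Suc_eq)
  qed
qed simp

text \<open>The mean number of paths with \<open>k + 1\<close> inner vertices is at least \<open>2 ln n\<close>, but
  if it is much larger the error term of Janson's inequality is out of control. The paths are therefore restricted to
  a set of \<open>N\<close> inner vertices, where \<open>N\<close> is chosen such that the mean is just above \<open>t
  = 2 ln n - 1\<close>.\<close>

lemma prob_not_all_close_le:
  fixes p :: real
  assumes p: "0 < p" "p < 1" and Q: "Q \<subseteq> vertex_pairs n" and d: "d = real n * p"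
    and low: "2 * ln (real n) \<le> p * d ^ (k + 1)" and ln1: "1 \<le> ln (real n)"
    and nk: "(real k + 1) * (real k + 4) * (2 * ln (real n)) \<le> real n" "k + 4 \<le> n"
    and psmall: "p * (real (2 * k + 7) ^ (k + 3) * (2 ^ (k + 2) * ln (real n))\<^sup>2) ^ (k + 1) \<le> 1" "p * (real k + 2) \<le> 1"
  shows "bexp p (vertex_pairs n) (\<lambda>G. of_bool (\<exists>u v. {u, v} \<in> Q \<and> \<not> near G (k + 2) u v))
     \<le> 2 * real (card Q) * exp (2 - 2 * ln (real n))"
proof -
  let ?C = "real (2 * k + 7) ^ (k + 3)"
  have n0: "0 < n" using nk by simp
  have p01: "0 \<le> p" "p \<le> 1" using p by auto
  have fin: "finite (vertex_pairs n)" by (simp add: vertex_pairs_eq)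
  note Q' = Q[unfolded vertex_pairs_eq]
  define t where "t = 2 * ln (real n) - 1"
  have t: "1 \<le> t" "t \<le> 2 * ln (real n)" using ln1 by (auto simp: t_def)
  \<comment> \<open>the real solution of \<open>p (x p)\<^bsup>k+1\<^esup> = t\<close>; \<open>N\<close> is obtained
    from it by rounding\<close>
  define x where "x = root (k + 1) (t / p) / p"
  have xp: "x * p = root (k + 1) (t / p)" using p by (simp add: x_def)
  have tp: "1 \<le> t / p" using t p by (simp add: pos_le_divide_eq)
  have xppow: "(x * p) ^ (k + 1) = t / p" unfolding xp using tp by (subst real_root_pow_pos2) auto
  have xp1: "1 \<le> x * p"
  proof (rule ccontr)
    assume "\<not> 1 \<le> x * p"
    moreover have "0 \<le> x * p" unfolding xp using tp by (intro real_root_ge_zero) auto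
    ultimately have "x * p * (x * p) ^ k < 1"
      using mult_left_le[of "(x * p) ^ k" "x * p"] power_le_one[of "x * p" k] by linarith
    then have "(x * p) ^ (k + 1) < 1" by simp
    then show False using xppow tp by linarith
  qed
  have x0: "0 < x" using xp1 p by (metis less_le_trans zero_less_mult_pos2 zero_less_one)
  have xk: "real k + 2 \<le> x"
  proof -
    have "p * (real k + 2) \<le> x * p" using psmall(2) xp1 by linarith
    then show ?thesis using p by (simp add: mult.commute)
  qed
  \<comment> \<open>by Bernoulli's inequality, leaving out \<open>k + 4\<close> vertices decreases the mean by at most
    \<open>1\<close>\<close>
  have x_le: "x \<le> real n - (real k + 4)"
  proof (rule ccontr)
    assume "\<not> x \<le> real n - (real k + 4)"
    then have lt: "(real n - (real k + 4)) * p < x * p" using p by simp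
    have nn: "0 \<le> real n - (real k + 4)" using nk(2) by linarith
    have "((real n - (real k + 4)) * p) ^ (k + 1) < (x * p) ^ (k + 1)"
      using lt nn p by (intro power_strict_mono) auto
    then have 1: "p * ((real n - (real k + 4)) * p) ^ (k + 1) < t"
      unfolding xppow using p by (simp add: pos_less_divide_eq mult.commute)
    have "(real n - (real k + 4)) * p = d * (1 + - ((real k + 4) / real n))" using n0 by (simp add: d field_simps)
    then have "p * ((real n - (real k + 4)) * p) ^ (k + 1) = p * d ^ (k + 1) * (1 + - ((real k + 4) / real n)) ^ (k + 1)"
      by (simp add: power_mult_distrib)
    also have "\<dots> \<ge> p * d ^ (k + 1) * (1 + real (k + 1) * - ((real k + 4) / real n))"
    proof (rule mult_left_mono)
      have "- 1 \<le> - ((real k + 4) / real n)" using nk(2) n0 by simp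
      then show "1 + real (k + 1) * - ((real k + 4) / real n) \<le> (1 + - ((real k + 4) / real n)) ^ (k + 1)"
        by (rule Bernoulli_inequality)
    qed (use p d in simp)
    also have "p * d ^ (k + 1) * (1 + real (k + 1) * - ((real k + 4) / real n))
       \<ge> 2 * ln (real n) * (1 + real (k + 1) * - ((real k + 4) / real n))"
    proof (rule mult_right_mono[OF low])
      have "(real k + 1) * (real k + 4) * 1 \<le> (real k + 1) * (real k + 4) * (2 * ln (real n))"
        using ln1 by (intro mult_left_mono) auto
      then have "(real k + 1) * (real k + 4) \<le> real n" using nk(1) by linarith
      then have "(real k + 1) * (real k + 4) / real n \<le> 1" using n0 by simp
      then show "0 \<le> 1 + real (k + 1) * - ((real k + 4) / real n)" by (simp add: algebra_simps)
    qed
    finally have "2 * ln (real n) * (1 + real (k + 1) * - ((real k + 4) / real n)) < t" using 1 by linarith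
    moreover have "2 * ln (real n) * (1 + real (k + 1) * - ((real k + 4) / real n))
        = 2 * ln (real n) - (real k + 1) * (real k + 4) * (2 * ln (real n)) / real n"
      by (simp add: algebra_simps)
    moreover have "(real k + 1) * (real k + 4) * (2 * ln (real n)) / real n \<le> 1" using nk(1) n0 by simp
    ultimately show False by (simp add: t_def)
  qed
  define N where "N = nat \<lceil>x\<rceil> + (k + 1)"
  have Nx: "x \<le> real (N - (k + 1))" "real (N - (k + 1)) \<le> x + 1" unfolding N_def using x0 by linarith+
  have Nge: "k + 1 \<le> N" by (simp add: N_def)
  have Nn: "N \<le> n - 2" using Nx x_le Nge nk(2) by linarith
  define D where "D = real N * p"
  have D_ge: "x * p \<le> D" unfolding D_def using Nx(1) p by (intro mult_right_mono) auto
  have D1: "1 \<le> D" using D_ge xp1 by linarith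
  have D_le: "D \<le> 2 * (x * p)"
  proof -
    have "real N \<le> 2 * x" using Nx(2) Nge xk by linarith
    then show ?thesis unfolding D_def using p by (simp add: mult_right_mono)
  qed
  have B: "exp (- (p * (real (N - (k + 1)) * p) ^ (k + 1)) + ?C * (p * D ^ (k + 1))\<^sup>2 / D) \<le> exp (2 - 2 * ln (real n))"
  proof -
    have "t = p * (x * p) ^ (k + 1)" using xppow p by simp
    also have "\<dots> \<le> p * (real (N - (k + 1)) * p) ^ (k + 1)"
      using p x0 Nx by (intro mult_left_mono power_mono mult_right_mono) auto
    finally have 1: "t \<le> p * (real (N - (k + 1)) * p) ^ (k + 1)" .
    have "?C * (p * D ^ (k + 1))\<^sup>2 \<le> ?C * (2 ^ (k + 2) * ln (real n))\<^sup>2"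
    proof (intro mult_left_mono power_mono)
      have "p * D ^ (k + 1) \<le> p * (2 * (x * p)) ^ (k + 1)"
        using p D1 D_le by (intro mult_left_mono power_mono) auto
      also have "\<dots> = 2 ^ (k + 1) * (p * (x * p) ^ (k + 1))" by (simp add: power_mult_distrib)
      also have "\<dots> = 2 ^ (k + 1) * t" unfolding xppow using p by simp
      also have "\<dots> \<le> 2 ^ (k + 1) * (2 * ln (real n))" using t by (intro mult_left_mono) auto
      finally show "p * D ^ (k + 1) \<le> 2 ^ (k + 2) * ln (real n)" by simp
    qed (use p D1 in auto)
    also have "\<dots> \<le> D"
    proof (rule ccontr)
      let ?Y = "?C * (2 ^ (k + 2) * ln (real n))\<^sup>2"
      assume "\<not> ?Y \<le> D"
      then have "D ^ (k + 1) < ?Y ^ (k + 1)" using D1 by (intro power_strict_mono) auto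
      then have "p * D ^ (k + 1) < p * ?Y ^ (k + 1)" using p by simp
      also have "\<dots> \<le> 1" by (rule psmall(1))
      finally have "p * D ^ (k + 1) < 1" .
      moreover have "p * (x * p) ^ (k + 1) \<le> p * D ^ (k + 1)"
        using p D_ge xp1 by (intro mult_left_mono power_mono) auto
      moreover have "p * (x * p) ^ (k + 1) = t" unfolding xppow using p by simp
      ultimately show False using t by linarith
    qed
    finally have 2: "?C * (p * D ^ (k + 1))\<^sup>2 / D \<le> 1" using D1 by simp
    show ?thesis using 1 2 by (simp add: t_def)
  qed
  have each: "bexp p (vertex_pairs n) (\<lambda>G. of_bool (\<not> near G (k + 2) u v)) \<le> exp (2 - 2 * ln (real n))"
    if uv: "(u, v) \<in> ordered_pairs Q" for u v
  proof -
    have uv': "u \<in> {1..n}" "v \<in> {1..n}" "u \<noteq> v"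
      using edge_in_vertices[OF Q', of u v] uv by (auto simp: ordered_pairs_def)
    have "N \<le> card ({1..n} - {u, v})" using uv' Nn by (simp add: card_Diff_subset)
    then obtain V0 where V0: "V0 \<subseteq> {1..n} - {u, v}" "card V0 = N" using obtain_subset_with_card_n by metis
    have "bexp p (pairs {1..n}) (\<lambda>G. of_bool (\<not> near G ((k + 1) + 1) u v))
      \<le> exp (- (p * (real (card V0 - (k + 1)) * p) ^ (k + 1)) + real (2 * (k + 1) + 5) ^ ((k + 1) + 2) * (p * D ^ (k + 1))\<^sup>2 / D)"
      by (rule prob_not_near_le) (use p01 uv' V0 Nge D1 in \<open>auto simp: D_def\<close>)
    also have "\<dots> = exp (- (p * (real (N - (k + 1)) * p) ^ (k + 1)) + ?C * (p * D ^ (k + 1))\<^sup>2 / D)"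
      by (simp add: V0 numeral_eq_Suc)
    also have "\<dots> \<le> exp (2 - 2 * ln (real n))" by (rule B)
    finally show ?thesis by (simp add: vertex_pairs_eq del: near.simps)
  qed
  have "bexp p (vertex_pairs n) (\<lambda>G. of_bool (\<exists>u v. {u, v} \<in> Q \<and> \<not> near G (k + 2) u v))
     \<le> (\<Sum>t\<in>ordered_pairs Q. bexp p (vertex_pairs n) (\<lambda>G. of_bool (\<not> near G (k + 2) (fst t) (snd t))))"
  proof (rule bexp_union_bound[OF p01 fin ordered_pairs_bound(1)[OF Q']])
    fix G assume "\<exists>u v. {u, v} \<in> Q \<and> \<not> near G (k + 2) u v"
    then obtain u v where "{u, v} \<in> Q" "\<not> near G (k + 2) u v" by blast
    then show "\<exists>i\<in>ordered_pairs Q. \<not> near G (k + 2) (fst i) (snd i)"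
      by (intro bexI[of _ "(u, v)"]) (auto simp: ordered_pairs_def simp del: near.simps)
  qed simp
  also have "\<dots> \<le> real (card (ordered_pairs Q)) * exp (2 - 2 * ln (real n))"
    by (rule sum_bounded_above) (use each in \<open>auto simp del: near.simps\<close>)
  also have "\<dots> \<le> 2 * real (card Q) * exp (2 - 2 * ln (real n))"
  proof (rule mult_right_mono)
    have "card (ordered_pairs Q) \<le> 2 * card Q" by (rule ordered_pairs_bound(2)[OF Q']) simp
    then show "real (card (ordered_pairs Q)) \<le> 2 * real (card Q)" by linarith
  qed simp
  finally show ?thesis .
qed

section \<open>The bound for a fixed number of vertices\<close>

text \<open>All that is needed from the asymptotic regime, for one fixed \<open>n\<close>. Here \<open>l\<close> is
  \<open>\<lambda>\<close>, \<open>\<delta>\<close> is a small constant, and \<open>\<eta>\<close> is such that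
  \<open>exp (2 \<eta>) = 1 + \<delta>\<close>. The assumptions on \<open>r\<close> express \<open>n\<^bsup>c\<^esup>
  \<ll> r\<close> and \<open>r\<^sup>2 d\<^sup>k \<ll> n\<close>; the remaining ones say that the error terms of the
  various estimates are small.\<close>

locale threshold_window =
  fixes k n r :: nat and p d l \<delta> \<eta> :: real and Q :: "nat set set"
  assumes k: "1 \<le> k" and n: "0 < n" and Q: "Q \<subseteq> vertex_pairs n"
    and p0: "0 < p" and p\<delta>: "p \<le> \<delta> / 2"
    and \<delta>: "0 < \<delta>" "\<delta> \<le> 1" and \<delta>_pow: "(1 + \<delta>) ^ (k + 6) \<le> 102 / 100" and \<eta>: "\<eta> = ln (1 + \<delta>) / 2"
    and d: "d = real n * p" and l: "l = p * d ^ k" and l_le: "l \<le> ln (real n)"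
    and d_big: "1 + \<delta> \<le> \<delta> * d" "4 \<le> d" "1 \<le> \<delta> * exp (- l) * d"
    and Q_small: "real (card Q) * d ^ k / (real n)\<^sup>2 \<le> exp l * ln (real n) / (8 * (real k + 1)\<^sup>2)"
    and ln1: "1 \<le> ln (real n)"
    and r_small: "l * (real k * real (2 * r + 1 + k)) \<le> \<eta> / 4 * real n" "4 * r + 2 * k + 2 \<le> n"
      "real (2 * r) * real (2 * r) * ((1 + \<delta>) * d ^ k / real n) \<le> 1 / 200"
      "real (2 * r) + (1 + \<delta>) * (2 * real (card Q) / real n) < \<delta> / (1 + \<delta>) * real n"
    and r_big: "exp (- (1 / 12 * exp (- (37 / (80 * (real k + 1)) * ln (real n))) * real r / 2)) \<le> 1 / 200"
    and pl: "2 * p * l \<le> \<eta> / 4"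
    and janson: "2 * (real (2 * k + 5) ^ (k + 2) * l\<^sup>2) \<le> \<eta> * d"
      "2 * (real (2 * k + 5) ^ (k + 2) * ((8 * ln (real n) / \<eta> + 1) * l)\<^sup>2) \<le> d"
    and degrees: "real n * exp (- d * ((1 + \<delta>) * ln (1 + \<delta>) - \<delta>)) \<le> 1 / 200"
    and conflicts: "8 * (exp l * ln (real n)) / d
       + 3 * (5 * (3 * real k + 1) * fact (3 * k + 5)) * (32 * (exp l * (ln (real n)) ^ 3)) / (\<eta> * d) \<le> 1 / 30"
    and balls: "real n * exp (1 - 4 * ln (real n)) \<le> 1 / 200"
    and diameter: "2 * ln (real n) \<le> p * d ^ (k + 1)"
      "(real k + 1) * (real k + 4) * (2 * ln (real n)) \<le> real n" "k + 4 \<le> n"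
      "p * (real (2 * k + 7) ^ (k + 3) * (2 ^ (k + 2) * ln (real n))\<^sup>2) ^ (k + 1) \<le> 1" "p * (real k + 2) \<le> 1"
      "2 * real (card Q) * exp (2 - 2 * ln (real n)) \<le> 1 / 200"
begin

text \<open>\<open>C\<close> is the constant of the Janson bound for paths of length \<open>k + 1\<close>,
  \<open>N0\<close> is the number of vertices available as inner vertices of such paths, and \<open>exp (- c)\<close>
  is the success probability of a single pair.\<close>

abbreviation "C \<equiv> real (2 * k + 5) ^ (k + 2)"
definition "N0 = n - 2 * r - 1"
abbreviation "c \<equiv> 37 / (80 * (real k + 1)) * ln (real n)"

lemma p1: "p < 1" "0 \<le> p" "p \<le> 1" "p \<le> 1 / 2" using p0 p\<delta> \<delta> by auto

lemma pd: "1 \<le> (1 + \<delta>) * (1 - p)"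
proof -
  have "(1 + \<delta>) * p \<le> 2 * (\<delta> / 2)" using p\<delta> p0 \<delta> by (intro mult_mono) auto
  then show ?thesis by (simp add: algebra_simps)
qed

lemma eta: "0 < \<eta>" "exp (2 * \<eta>) = 1 + \<delta>" "\<eta> \<le> 1 / 2"
proof -
  show "0 < \<eta>" using \<delta> by (simp add: \<eta>)
  show "exp (2 * \<eta>) = 1 + \<delta>" using \<delta> by (simp add: \<eta>)
  have "ln (1 + \<delta>) \<le> \<delta>" using ln_le_minus_one[of "1 + \<delta>"] \<delta> by simp
  then show "\<eta> \<le> 1 / 2" using \<delta> by (simp add: \<eta>)
qed

lemma l0: "0 < l" using p0 d_big by (simp add: l)

lemma N0: "k \<le> N0" "real N0 = real n - real (2 * r + 1)" "real (N0 - k) = real n - real (2 * r + 1 + k)"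
    "d / 2 \<le> real N0 * p" "1 \<le> real N0 * p" "real N0 * p \<le> d"
proof -
  show *: "k \<le> N0" "real N0 = real n - real (2 * r + 1)" "real (N0 - k) = real n - real (2 * r + 1 + k)"
    using r_small(2) by (auto simp: N0_def of_nat_diff)
  have "real n / 2 \<le> real N0" using r_small(2) *(2) by linarith
  then have "real n / 2 * p \<le> real N0 * p" using p0 by (intro mult_right_mono) auto
  then show "d / 2 \<le> real N0 * p" by (simp add: d)
  then show "1 \<le> real N0 * p" using d_big(2) by linarith
  show "real N0 * p \<le> d" unfolding d using p0 by (intro mult_right_mono) (auto simp: N0_def)
qed

lemma mean_paths_ge: "l - \<eta> / 4 \<le> p * (real (N0 - k) * p) ^ k"
proof -
  let ?x = "- (real (2 * r + 1 + k) / real n)"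
  have x: "- 1 \<le> ?x" using r_small(2) n by simp
  have "real (N0 - k) * p = d * (1 + ?x)" unfolding N0(3) using n by (simp add: d field_simps)
  then have "p * (real (N0 - k) * p) ^ k = l * (1 + ?x) ^ k" by (simp add: power_mult_distrib l)
  moreover have "l * (1 + real k * ?x) \<le> l * (1 + ?x) ^ k"
    using l0 by (intro mult_left_mono Bernoulli_inequality x) auto
  moreover have "l * (1 + real k * ?x) = l - l * (real k * real (2 * r + 1 + k)) / real n" by (simp add: algebra_simps)
  moreover have "l * (real k * real (2 * r + 1 + k)) / real n \<le> \<eta> / 4"
    using r_small(1) n by (simp add: pos_divide_le_eq)
  ultimately show ?thesis by linarith
qed

lemma janson_term:
  assumes "0 \<le> J" "2 * (C * (J * l)\<^sup>2) \<le> B * d"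
  shows "C * (J * p * (real N0 * p) ^ k)\<^sup>2 / (real N0 * p) \<le> B"
proof -
  have D: "0 < real N0 * p" using N0(5) by linarith
  have "J * p * (real N0 * p) ^ k \<le> J * p * d ^ k"
    using N0 D assms p0 by (intro mult_left_mono power_mono) auto
  then have "C * (J * p * (real N0 * p) ^ k)\<^sup>2 \<le> C * (J * l)\<^sup>2"
    using assms p0 D by (intro mult_left_mono power_mono) (auto simp: l mult.assoc)
  also have "\<dots> \<le> B * (d / 2)" using assms(2) by simp
  also have "\<dots> \<le> B * (real N0 * p)"
  proof (rule mult_left_mono[OF N0(4)])
    have "0 \<le> B * d" using assms(2) zero_le_mult_iff[of 2 "C * (J * l)\<^sup>2"] by (smt (verit) mult_nonneg_nonneg of_nat_0_le_iff zero_le_power zero_le_power2)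
    then show "0 \<le> B" using d_big(2) by (simp add: zero_le_mult_iff)
  qed
  finally show ?thesis unfolding pos_divide_le_eq[OF D] .
qed

text \<open>The exponent is at most \<open>1 / (4 (k + 1))\<close> times \<open>exp \<lambda> ln n\<close>, and
  \<open>exp (1/2) < 1.65\<close>, so up to a factor \<open>1.02\<close> it is less than \<open>33 / (80 (k + 1)) ln
  n\<close>.\<close>

lemma exp_c_small:
  assumes "l \<le> 1 / 2"
  shows "((1 + \<delta>) ^ (k + 1) * (2 * (real k + 1) * real (card Q) * d ^ k / (real n)\<^sup>2)) / (1 - p) \<le> c"
proof -
  let ?w = "real (card Q) * d ^ k / (real n)\<^sup>2"
  have w0: "0 \<le> ?w" using d_big by simp
  have e: "exp (1 / 2 :: real) \<le> 165 / 100"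
  proof (rule ccontr)
    assume "\<not> ?thesis"
    then have "(165 / 100 :: real)\<^sup>2 \<le> (exp (1 / 2))\<^sup>2" by (intro power_mono) auto
    also have "(exp (1 / 2 :: real))\<^sup>2 = exp 1" by (simp add: power2_eq_square exp_add[symmetric])
    also have "\<dots> < 272 / 100" by (rule e_less_272)
    finally show False by (simp add: power2_eq_square)
  qed
  have inv: "1 / (1 - p) \<le> 1 + \<delta>" using pd p1 by (simp add: pos_divide_le_eq)
  have "((1 + \<delta>) ^ (k + 1) * (2 * (real k + 1) * real (card Q) * d ^ k / (real n)\<^sup>2)) / (1 - p)
      = (1 + \<delta>) ^ (k + 1) * (1 / (1 - p)) * (2 * (real k + 1) * ?w)"
  proof -
    have "(A * (2 * K * q * D / N)) / P = A * (1 / P) * (2 * K * (q * D / N))" for A K q D N P :: real by (simp add: ac_simps)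
    then show ?thesis .
  qed
  also have "\<dots> \<le> 102 / 100 * (2 * (real k + 1) * ((165 / 100) * ln (real n) / (8 * (real k + 1)\<^sup>2)))"
  proof (rule mult_mono)
    have "(1 + \<delta>) ^ (k + 1) * (1 / (1 - p)) \<le> (1 + \<delta>) ^ (k + 1) * (1 + \<delta>)"
      using inv \<delta> by (intro mult_left_mono) auto
    also have "\<dots> = (1 + \<delta>) ^ (k + 2)" by simp
    also have "(1 + \<delta>) ^ (k + 2) \<le> (1 + \<delta>) ^ (k + 6)" using \<delta> by (intro power_increasing) auto
    also have "\<dots> \<le> 102 / 100" by (rule \<delta>_pow)
    finally show "(1 + \<delta>) ^ (k + 1) * (1 / (1 - p)) \<le> 102 / 100" .
    have "exp l \<le> exp (1 / 2)" using assms by simp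
    then have "exp l \<le> 165 / 100" using e by linarith
    then have "exp l * ln (real n) \<le> 165 / 100 * ln (real n)" using ln1 by (intro mult_right_mono) auto
    then have "exp l * ln (real n) / (8 * (real k + 1)\<^sup>2) \<le> 165 / 100 * ln (real n) / (8 * (real k + 1)\<^sup>2)"
      by (rule divide_right_mono) simp
    then have "?w \<le> (165 / 100) * ln (real n) / (8 * (real k + 1)\<^sup>2)" using Q_small by linarith
    then show "2 * (real k + 1) * ?w \<le> 2 * (real k + 1) * ((165 / 100) * ln (real n) / (8 * (real k + 1)\<^sup>2))"
      by (intro mult_left_mono) auto
    show "0 \<le> 2 * (real k + 1) * ?w" by (intro mult_nonneg_nonneg w0) auto
  qed simp
  also have "\<dots> = (102 / 100 * 165 / 400) * (ln (real n) / (real k + 1))"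
  proof -
    have *: "102 / 100 * (2 * K * ((165 / 100) * L / (8 * K\<^sup>2))) = (102 / 100 * 165 / 400) * (L / K)" if "0 < K" for K L :: real
      using that by (simp add: power2_eq_square)
    show ?thesis by (rule *) simp
  qed
  also have "\<dots> \<le> 37 / 80 * (ln (real n) / (real k + 1))"
    using ln1 by (intro mult_right_mono) auto
  also have "\<dots> = c" by simp
  finally show ?thesis .
qed

theorem prob_reconstructible_bound:
  "bexp p (vertex_pairs n) (\<lambda>G. of_bool (reconstructible n Q G)) \<le> 39 / 40"
proof -
  let ?q = "real (card Q)"
  let ?L = "{v\<in>{1..n}. real (deg Q v) \<le> (1 + \<delta>) * (2 * ?q / real n)}"
  let ?Dq = "nat \<lfloor>(1 + \<delta>) * (2 * ?q / real n)\<rfloor>"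
  note Q' = Q[unfolded vertex_pairs_eq]
  have Dq0: "0 \<le> (1 + \<delta>) * (2 * ?q / real n)" using \<delta> by simp
  have "2 * r + ?Dq < card ?L"
  proof -
    have "real (2 * r) + real ?Dq \<le> real (2 * r) + (1 + \<delta>) * (2 * ?q / real n)" using Dq0 by simp
    also have "\<dots> < \<delta> / (1 + \<delta>) * real n" by (rule r_small(4))
    also have "\<dots> \<le> real (card ?L)" by (rule many_low_degree_vertices[OF Q n \<delta>(1)])
    finally show ?thesis by linarith
  qed
  moreover have "deg Q v \<le> ?Dq" if "v \<in> ?L" for v using that by (simp add: le_nat_floor)
  ultimately obtain xs ys where xy: "inj_on xs {..<r}" "inj_on ys {..<r}" "xs ` {..<r} \<inter> ys ` {..<r} = {}"
     "xs ` {..<r} \<subseteq> ?L" "ys ` {..<r} \<subseteq> ?L" "\<forall>i<r. {xs i, ys i} \<notin> Q"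
    using choose_disjoint_pairs[of ?L Q "{1..n}" ?Dq r] Q' by auto
  interpret cp: candidate_pairs k n r p Q xs ys
    by unfold_locales (use k p0 p1 Q xy in auto)
  have degL: "real (deg Q (xs i)) \<le> (1 + \<delta>) * (2 * ?q / real n)" "real (deg Q (ys i)) \<le> (1 + \<delta>) * (2 * ?q / real n)"
    if "i < r" for i using xy(4,5) that by auto
  have deg_bad: "bexp p (pairs S) (\<lambda>G. of_bool (\<exists>v. (1 + \<delta>) * d < real (deg G v))) \<le> 1 / 200"
    if "finite S" "card S \<le> n" for S
    using prob_some_deg_large[OF p1(2,3) that, of d \<delta>] \<delta> degrees by (simp add: d)
  have cVr: "card cp.other_vertices = n - 2 * r" "card cp.other_vertices \<le> n" using cp.other_vertices(2) by auto
  have D1: "cp.Pr (\<lambda>G. \<exists>u v. {u, v} \<in> Q \<and> \<not> near G (k + 2) u v) \<le> 1 / 200"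
    using prob_not_all_close_le[OF p0 p1(1) Q d diameter(1) ln1 diameter(2-5)] diameter(6) by linarith
  have D2: "cp.Pr (\<lambda>G. \<exists>w\<in>cp.test_vertices. \<exists>w'\<in>cp.test_vertices. w \<noteq> w' \<and> near G k w w') \<le> 1 / 200"
  proof -
    let ?P = "{t \<in> cp.test_vertices \<times> cp.test_vertices. fst t \<noteq> snd t}"
    have finP: "finite ?P" using cp.test_vertices(3) by simp
    have "cp.Pr (\<lambda>G. \<exists>w\<in>cp.test_vertices. \<exists>w'\<in>cp.test_vertices. w \<noteq> w' \<and> near G k w w')
       \<le> (\<Sum>t\<in>?P. cp.Pr (\<lambda>G. near G k (fst t) (snd t)))"
      by (rule bexp_union_bound[OF p1(2,3) cp.finV finP]) auto
    also have "\<dots> \<le> real (card ?P) * ((1 + \<delta>) * d ^ k / real n)"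
    proof (rule sum_bounded_above)
      fix t assume "t \<in> ?P"
      then show "cp.Pr (\<lambda>G. near G k (fst t) (snd t)) \<le> (1 + \<delta>) * d ^ k / real n"
        unfolding vertex_pairs_eq by (intro prob_near_le_power p1 d \<delta> d_big n) auto
    qed
    also have "\<dots> \<le> (real (2 * r) * real (2 * r)) * ((1 + \<delta>) * d ^ k / real n)"
    proof (rule mult_right_mono)
      have "card ?P \<le> card (cp.test_vertices \<times> cp.test_vertices)" by (rule card_mono) (use cp.test_vertices(3) in auto)
      also have "\<dots> = (2 * r) * (2 * r)" using cp.test_vertices(2) by (simp add: card_cartesian_product)
      finally have "real (card ?P) \<le> real ((2 * r) * (2 * r))" by (simp only: of_nat_le_iff)
      then show "real (card ?P) \<le> real (2 * r) * real (2 * r)" by (simp only: of_nat_mult)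
    qed (use \<delta> d_big in auto)
    also have "\<dots> \<le> 1 / 200" using r_small(3) by simp
    finally show ?thesis .
  qed
  have ex: "(\<forall>i<r. 1 / 12 \<le> bexp p (pairs cp.other_vertices) (\<lambda>H. of_bool (exp (- c) \<le> bexp p ((\<lambda>v. {xs i, v}) ` cp.other_vertices \<union> (\<lambda>v. {ys i, v}) ` cp.other_vertices)
                (\<lambda>G. of_bool (clear_small k Q cp.other_vertices (xs i) (ys i) (H \<union> G)))))) \<or>
      (\<forall>i<r. 1 / 12 \<le> bexp p (pairs (insert (xs i) cp.other_vertices)) (\<lambda>K. of_bool (exp (- c) \<le> bexp p ((\<lambda>v. {ys i, v}) ` cp.other_vertices)
                (\<lambda>G. of_bool (clear_large k Q cp.other_vertices (xs i) (ys i) (K \<union> G))))))"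
  \<comment> \<open>few paths of length \<open>k + 1\<close>: the first clearness condition; many: the second\<close>
  proof (cases "l \<le> 1 / 2")
    case True
    have "1 / 12 \<le> bexp p (pairs cp.other_vertices) (\<lambda>H. of_bool (exp (- c) \<le> bexp p ((\<lambda>v. {xs i, v}) ` cp.other_vertices \<union> (\<lambda>v. {ys i, v}) ` cp.other_vertices)
                (\<lambda>G. of_bool (clear_small k Q cp.other_vertices (xs i) (ys i) (H \<union> G)))))" if i: "i < r" for i
    proof -
      let ?h = "\<lambda>H. bexp p ((\<lambda>v. {xs i, v}) ` cp.other_vertices \<union> (\<lambda>v. {ys i, v}) ` cp.other_vertices)
                (\<lambda>G. of_bool (clear_small k Q cp.other_vertices (xs i) (ys i) (H \<union> G)))"
      have finE: "finite (pairs cp.other_vertices)" using cp.other_vertices(1) by simp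
      have "1 - 1 / 200 \<le> 1 - bexp p (pairs cp.other_vertices) (\<lambda>G. of_bool (\<exists>v. (1 + \<delta>) * d < real (deg G v)))"
        using deg_bad[OF cp.other_vertices(1) cVr(2)] by simp
      also have "\<dots> = bexp p (pairs cp.other_vertices) (\<lambda>G. 1 - of_bool (\<exists>v. (1 + \<delta>) * d < real (deg G v)))"
        using finE by (simp add: bexp_diff)
      also have "\<dots> \<le> bexp p (pairs cp.other_vertices) (\<lambda>H. of_bool (exp (- c) \<le> ?h H))"
      proof (rule bexp_mono[OF p1(2,3)])
        fix H assume H: "H \<subseteq> pairs cp.other_vertices"
        have "exp (- c) \<le> ?h H" if dg: "\<not> (\<exists>v. (1 + \<delta>) * d < real (deg H v))"
        proof -
          have "exp (- c) \<le> exp (- ((1 + \<delta>) ^ (k + 1) * (2 * (real k + 1) * ?q * d ^ k / (real n)\<^sup>2)) / (1 - p))"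
            using exp_c_small[OF True] by (simp only: exp_le_cancel_iff minus_divide_left[symmetric] neg_le_iff_le)
          also have "\<dots> \<le> ?h H"
            unfolding d
          proof (rule prob_clear_small_ge[where m = "(1 + \<delta>) * d"])
            show "real (deg H v) \<le> (1 + \<delta>) * d" for v using dg by (auto simp: not_less)
            have "1 * d \<le> (1 + \<delta>) * d" using \<delta> d_big by (intro mult_right_mono) auto
            then have "\<delta> * d \<le> \<delta> * ((1 + \<delta>) * d)" using \<delta> by (intro mult_left_mono) auto
            then show "1 + \<delta> \<le> \<delta> * ((1 + \<delta>) * d)" using d_big(1) by linarith
            show "(1 + \<delta>) * d = (1 + \<delta>) * (real n * p)" by (simp add: d)
            show "xs i \<notin> cp.other_vertices" "ys i \<notin> cp.other_vertices" using cp.other_vertices(4,5)[of i] i by auto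
            show "xs i \<noteq> ys i" using xy(3) i by auto
            show "finite {1..n}" by simp
          qed (use p1 n k cp.other_vertices Q' H \<delta> degL[OF i] in auto)
          finally show ?thesis .
        qed
        then show "1 - of_bool (\<exists>v. (1 + \<delta>) * d < real (deg H v)) \<le> (of_bool (exp (- c) \<le> ?h H) :: real)"
          by (cases "\<exists>v. (1 + \<delta>) * d < real (deg H v)") simp_all
      qed
      finally show ?thesis by simp
    qed
    then show ?thesis by blast
  next
    case False
    have "1 / 12 \<le> bexp p (pairs (insert (xs i) cp.other_vertices)) (\<lambda>K. of_bool (exp (- c) \<le> bexp p ((\<lambda>v. {ys i, v}) ` cp.other_vertices)
                (\<lambda>G. of_bool (clear_large k Q cp.other_vertices (xs i) (ys i) (K \<union> G)))))" if i: "i < r" for i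
    proof -
      let ?V1 = "insert (xs i) cp.other_vertices"
      have xi: "xs i \<notin> cp.other_vertices" "ys i \<notin> cp.other_vertices" using cp.other_vertices(4,5)[of i] i by auto
      have cV1: "card ?V1 = n - 2 * r + 1" using xi cVr cp.other_vertices(1) by simp
      have cV1n: "card ?V1 \<le> n" using cV1 i r_small(2) by linarith
      interpret rp: random_pair k n p d \<delta> l cp.other_vertices "{1..n}" "xs i" "ys i" Q
      proof unfold_locales
        fix u v assume uv: "u \<in> ?V1" "v \<in> ?V1" "u \<noteq> v"
        let ?V0 = "?V1 - {u, v}"
        have cV0: "card ?V0 = N0"
          using uv cV1 cp.other_vertices(1) r_small(2) by (subst card_Diff_subset) (auto simp: N0_def)
        have "bexp p (pairs ?V1) (\<lambda>K. of_bool (\<not> near K (k + 1) u v))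
          \<le> exp (- (p * (real (card ?V0 - k) * p) ^ k) + C * (p * (real N0 * p) ^ k)\<^sup>2 / (real N0 * p))"
          by (rule prob_not_near_le) (use p1 cp.other_vertices(1) uv N0 cV0 in auto)
        also have "\<dots> \<le> exp (2 * \<eta> - l)"
          unfolding cV0 exp_le_cancel_iff using mean_paths_ge janson_term[of 1 \<eta>] janson(1) eta by simp
        also have "\<dots> = (1 + \<delta>) * exp (- l)" unfolding eta(2)[symmetric] by (simp add: exp_add[symmetric])
        finally show "bexp p (pairs ?V1) (\<lambda>K. of_bool (\<not> near K (k + 1) u v)) \<le> (1 + \<delta>) * exp (- l)" .
      next
        show "xs i \<noteq> ys i" using xy(3) i by auto
        show "card ?V1 \<le> n" by (rule cV1n)
        show "l = p * d ^ k" by (rule l)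
      qed (use k p0 p1 n d \<delta> d_big cp.other_vertices xi Q' degL[OF i] in auto)
      have w: "0 \<le> rp.load" "exp (- l) * rp.load \<le> ln (real n) / (8 * (real k + 1)\<^sup>2)" "rp.load \<le> exp l * ln (real n)"
      proof -
        show "0 \<le> rp.load" by (rule rp.load0)
        have ww: "rp.load \<le> exp l * ln (real n) / (8 * (real k + 1)\<^sup>2)" using Q_small by (simp add: rp.load_def)
        then have "exp (- l) * rp.load \<le> exp (- l) * (exp l * ln (real n) / (8 * (real k + 1)\<^sup>2))"
          by (intro mult_left_mono) auto
        then show "exp (- l) * rp.load \<le> ln (real n) / (8 * (real k + 1)\<^sup>2)" 
          by (simp add: mult.assoc[symmetric] mult_exp_exp)
        have "1 \<le> 8 * (real k + 1)\<^sup>2" by (simp add: power2_eq_square algebra_simps)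
        then have "exp l * ln (real n) / (8 * (real k + 1)\<^sup>2) \<le> exp l * ln (real n) / 1"
          using ln1 by (intro divide_left_mono) auto
        then show "rp.load \<le> exp l * ln (real n)" using ww by simp
      qed
      have finE: "finite (pairs ?V1)" using cp.other_vertices(1) by simp
      have ball: "bexp p (pairs ?V1) (\<lambda>K. of_bool (\<exists>u\<in>cp.other_vertices. p * real (card (rp.kball K u)) < l - \<eta>)) \<le> 1 / 200"
      proof -
        \<comment> \<open>the exponent \<open>- J \<eta> / 2\<close> has to beat the union bound over \<open>n\<close>
          centres\<close>
        define J where "J = nat \<lceil>8 * ln (real n) / \<eta>\<rceil>"
        have J: "8 * ln (real n) / \<eta> \<le> real J" "real J \<le> 8 * ln (real n) / \<eta> + 1"
        proof -
          have "0 \<le> 8 * ln (real n) / \<eta>" using eta(1) ln1 by (intro divide_nonneg_pos) auto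
          then show "8 * ln (real n) / \<eta> \<le> real J" "real J \<le> 8 * ln (real n) / \<eta> + 1"
            unfolding J_def by linarith+
        qed
        have "0 < 8 * ln (real n) / \<eta>" using eta(1) ln1 by simp
        then have J1: "1 \<le> J" using J(1) by (cases J) auto
        have each: "bexp p (pairs ?V1) (\<lambda>K. of_bool (p * real (card (rp.kball K u)) < l - \<eta>)) \<le> exp (1 - 4 * ln (real n))"
          if u: "u \<in> cp.other_vertices" for u
        proof -
          have cV: "card cp.other_vertices - 1 = N0" using cVr by (simp add: N0_def)
          have "bexp p (pairs ?V1) (\<lambda>K. of_bool (p * real (card {b\<in>cp.other_vertices. near K k u b}) < l - \<eta>))
            \<le> exp (real J * (l - \<eta>) / (1 - p) - real J * p * (real (card cp.other_vertices - 1 - k) * p) ^ k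
              + C * (real J * p * (real N0 * p) ^ k)\<^sup>2 / (real N0 * p))"
            by (rule prob_small_ball_le) (use p1 cp.other_vertices(1) u cV N0 J1 in auto)
          also have "\<dots> \<le> exp (1 - 4 * ln (real n))"
          proof -
            have "(l - \<eta>) / (1 - p) \<le> (l - \<eta>) * (1 + 2 * p)"
            proof -
              have "0 \<le> p * (1 - 2 * p)" using p1 by simp
              then have "1 \<le> (1 + 2 * p) * (1 - p)" by (simp add: algebra_simps)
              then have "(l - \<eta>) * 1 \<le> (l - \<eta>) * ((1 + 2 * p) * (1 - p))" using False eta by (intro mult_left_mono) auto
              then show ?thesis using p1 by (simp add: pos_divide_le_eq mult.assoc)
            qed
            also have "\<dots> \<le> l - \<eta> + \<eta> / 4"
            proof -
              have "0 \<le> 2 * p * \<eta>" using p0 eta by simp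
              moreover have "(l - \<eta>) * (1 + 2 * p) = l - \<eta> + 2 * p * l - 2 * p * \<eta>" by (simp add: algebra_simps)
              ultimately show ?thesis using pl by linarith
            qed
            finally have br: "(l - \<eta>) / (1 - p) - p * (real (N0 - k) * p) ^ k \<le> - (\<eta> / 2)"
              using mean_paths_ge by linarith
            have "real J * (l - \<eta>) / (1 - p) - real J * p * (real (N0 - k) * p) ^ k
               = real J * ((l - \<eta>) / (1 - p) - p * (real (N0 - k) * p) ^ k)" by (simp add: algebra_simps)
            also have "\<dots> \<le> real J * (- (\<eta> / 2))" by (rule mult_left_mono[OF br]) simp
            also have "\<dots> \<le> - 4 * ln (real n)"
            proof -
              have "8 * ln (real n) \<le> real J * \<eta>" using J(1) eta(1) by (simp add: pos_divide_le_eq)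
              then show ?thesis by simp
            qed
            finally have 1: "real J * (l - \<eta>) / (1 - p) - real J * p * (real (N0 - k) * p) ^ k \<le> - 4 * ln (real n)" .
            have "C * (real J * p * (real N0 * p) ^ k)\<^sup>2 / (real N0 * p) \<le> 1"
            proof (rule janson_term)
              have "2 * (C * (real J * l)\<^sup>2) \<le> 2 * (C * ((8 * ln (real n) / \<eta> + 1) * l)\<^sup>2)"
                using J(2) l0 by (intro mult_left_mono power_mono mult_right_mono) auto
              also have "\<dots> \<le> d" by (rule janson(2))
              finally show "2 * (C * (real J * l)\<^sup>2) \<le> 1 * d" by simp
            qed simp
            then show ?thesis using 1 unfolding cV by simp
          qed
          finally show ?thesis by (simp only: rp.kball_def)
        qed
        have "bexp p (pairs ?V1) (\<lambda>K. of_bool (\<exists>u\<in>cp.other_vertices. p * real (card (rp.kball K u)) < l - \<eta>))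
          \<le> (\<Sum>u\<in>cp.other_vertices. bexp p (pairs ?V1) (\<lambda>K. of_bool (p * real (card (rp.kball K u)) < l - \<eta>)))"
          by (rule bexp_union_bound[OF p1(2,3) finE cp.other_vertices(1)]) auto
        also have "\<dots> \<le> real (card cp.other_vertices) * exp (1 - 4 * ln (real n))"
          by (rule sum_bounded_above) (rule each)
        also have "\<dots> \<le> real n * exp (1 - 4 * ln (real n))"
          using cVr(2) by (intro mult_right_mono) auto
        also have "\<dots> \<le> 1 / 200" by (rule balls)
        finally show ?thesis .
      qed
      have conf: "8 * rp.load / d + 3 * rp.visit_const * rp.conflict_scale * exp (- l) * l / (\<eta> * d) \<le> 1 / 30"
      proof -
        let ?y = "exp l * ln (real n)"
        have y1: "1 \<le> ?y"
        proof -
          have "1 * 1 \<le> exp l * ln (real n)" using l0 ln1 by (intro mult_mono) auto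
          then show ?thesis by simp
        qed
        have d0: "0 < d" using d_big by simp
        have W: "rp.conflict_scale \<le> 32 * ?y\<^sup>2"
        proof -
          have "(rp.load)\<^sup>2 \<le> ?y\<^sup>2" using w by (intro power_mono) auto
          moreover have "?y \<le> ?y\<^sup>2" using self_le_power[OF y1, of 2] by simp
          ultimately show ?thesis unfolding rp.conflict_scale_def using w(3) by linarith
        qed
        have "rp.conflict_scale * exp (- l) * l \<le> (32 * ?y\<^sup>2) * exp (- l) * ln (real n)"
          using W l_le l0 ln1 by (intro mult_mono) auto
        also have "\<dots> = 32 * (exp l * exp (- l)) * (exp l * ln (real n) ^ 3)"
          by (simp add: power2_eq_square power3_eq_cube)
        also have "\<dots> = 32 * (exp l * ln (real n) ^ 3)" by (simp add: exp_minus)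
        finally have "3 * rp.visit_const * (rp.conflict_scale * exp (- l) * l) \<le> 3 * rp.visit_const * (32 * (exp l * ln (real n) ^ 3))"
          using rp.visit_const_pos by (intro mult_left_mono) auto
        then have "3 * rp.visit_const * (rp.conflict_scale * exp (- l) * l) / (\<eta> * d) \<le> 3 * rp.visit_const * (32 * (exp l * ln (real n) ^ 3)) / (\<eta> * d)"
          using eta(1) d0 by (intro divide_right_mono) auto
        moreover have "8 * rp.load / d \<le> 8 * ?y / d" using w(3) d0 by (intro divide_right_mono) auto
        ultimately show ?thesis using conflicts by (simp add: rp.visit_const_def mult.assoc)
      qed
      have small: "(1 + \<delta>) * exp (- l) \<le> 7 / 10"
      proof -
        have "1 + 1 / 2 \<le> exp (1 / 2 :: real)" by (rule exp_ge_add_one_self)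
        then have "inverse (exp (1 / 2)) \<le> inverse (3 / 2 :: real)" by (intro le_imp_inverse_le) auto
        then have e: "exp (- (1 / 2)) \<le> (2 / 3 :: real)" by (simp add: exp_minus)
        have "exp (- l) \<le> exp (- (1 / 2))" using False by simp
        then have "exp (- l) \<le> 2 / 3" using e by linarith
        moreover have "1 + \<delta> \<le> 102 / 100"
        proof -
          have "(1 + \<delta>) ^ 1 \<le> (1 + \<delta>) ^ (k + 6)" using \<delta> by (intro power_increasing) auto
          then show ?thesis using \<delta>_pow by simp
        qed
        ultimately have "(1 + \<delta>) * exp (- l) \<le> 102 / 100 * (2 / 3)" using \<delta> by (intro mult_mono) auto
        then show ?thesis by simp
      qed
      have cbound: "6 / 5 * ((1 + \<delta>) ^ (k + 6) * (2 * (real k + 2) * exp (- l) * rp.load)) \<le> c"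
      proof -
        have "(1 + \<delta>) ^ (k + 6) * (2 * (real k + 2) * exp (- l) * rp.load)
           = (1 + \<delta>) ^ (k + 6) * (2 * (real k + 2) * (exp (- l) * rp.load))" by simp
        also have "\<dots> \<le> 102 / 100 * (2 * (real k + 2) * (ln (real n) / (8 * (real k + 1)\<^sup>2)))"
          using \<delta>_pow w \<delta> by (intro mult_mono) auto
        also have "\<dots> = (102 / 400 * ((real k + 2) / (real k + 1))) * (ln (real n) / (real k + 1))"
        proof -
          have "102 / 100 * (2 * A * (L / (8 * K\<^sup>2))) = (102 / 400 * (A / K)) * (L / K)" for A K L :: real
            by (simp add: power2_eq_square)
          then show ?thesis .
        qed
        also have "\<dots> \<le> (102 / 400 * (3 / 2)) * (ln (real n) / (real k + 1))"
          using k ln1 by (intro mult_right_mono mult_left_mono) (auto simp: field_simps)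
        finally have "6 / 5 * ((1 + \<delta>) ^ (k + 6) * (2 * (real k + 2) * exp (- l) * rp.load))
           \<le> 6 / 5 * ((102 / 400 * (3 / 2)) * (ln (real n) / (real k + 1)))" by (rule mult_left_mono) simp
        also have "\<dots> = (6 / 5 * (102 / 400 * (3 / 2))) * (ln (real n) / (real k + 1))" by (rule mult.assoc[symmetric])
        also have "\<dots> \<le> 37 / 80 * (ln (real n) / (real k + 1))"
          using ln1 by (intro mult_right_mono) auto
        also have "\<dots> = c" by simp
        finally show ?thesis .
      qed
      have c0: "0 < c" using ln1 by simp
      \<comment> \<open>Markov's inequality is applied with the factor \<open>6/5\<close>, so that \<open>(6/5) (3/2)
        / 4 = 36/80\<close> remains below \<open>37/80\<close> even after multiplication by
        \<open>1.02\<close>.\<close>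
      have "1 / 12 \<le> 1 - 1 / 200 - 1 / 200 - 1 / 30 - 1 / (6 / 5 :: real)" by simp
      also have "\<dots> \<le> 1 - 1 / 200 - 1 / 200 - (8 * rp.load / d + 3 * rp.visit_const * rp.conflict_scale * exp (- l) * l / (\<eta> * d)) - 1 / (6 / 5)"
        using conf by simp
      also have "\<dots> \<le> bexp p (pairs ?V1) (\<lambda>K. of_bool (exp (- c) \<le> rp.clear_prob K))"
        by (rule rp.prob_clear_prob_ge[OF eta(1) _ small pd _ ball c0 cbound])
           (use eta deg_bad[of ?V1] cp.other_vertices(1) cV1n in auto)
      finally show ?thesis by (simp only: rp.clear_prob_def rp.star_def)
    qed
    then show ?thesis by blast
  qed
  have "cp.Pr (reconstructible n Q) \<le> 1 - (1 / 12) / 2 + exp (- (1 / 12 * exp (- c) * real r / 2)) + 1 / 200 + 1 / 200"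
    by (rule cp.prob_reconstructible_le[OF _ _ D1 D2 ex]) auto
  then show ?thesis using r_big by simp
qed

end

section \<open>Asymptotics\<close>

lemma powr_power_eq: "0 < x \<Longrightarrow> (x powr a) ^ m = x powr (a * real m)" for x a :: real
  by (simp add: powr_realpow[symmetric] powr_powr)

text \<open>The sum of the constants that occur in the smallness conditions of \<open>threshold_window\<close>. Every
  condition reduces to the form \<open>K (ln n)\<^sup>j \<le> n\<^sup>e\<close> with \<open>e \<ge> e0\<close> and
  \<open>j \<le> 2 k + 5\<close>, so that one inequality with this sum in place of \<open>K\<close> implies all of
  them.\<close>

definition window_const :: "nat \<Rightarrow> real \<Rightarrow> real \<Rightarrow> real" where
  "window_const k \<delta> \<eta> = 2 / \<delta> + 8 / \<eta> + (real (2 * k + 7) ^ (k + 3) * (2 ^ (k + 2))\<^sup>2) ^ (k + 1) + (real k + 2)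
    + (1 + \<delta>) / \<delta> + 1600 + 2 * real (2 * k + 5) ^ (k + 2) / \<eta> + 2 * real (2 * k + 5) ^ (k + 2) * (8 / \<eta> + 1)\<^sup>2
    + 9 / ((1 + \<delta>) * ln (1 + \<delta>) - \<delta>) + 30 * (8 + 3 * (5 * (3 * real k + 1) * fact (3 * k + 5)) * 32 / \<eta>)
    + 400 * exp 2 + 4 * real k * (3 + real k) / \<eta> + (2 * real k + 6) + 32 / \<delta> + 2 * (real k + 1) * (real k + 4)"

text \<open>The exponents are as follows. The lower bound on \<open>p\<close> gives \<open>d \<ge>
  n\<^bsup>1/(k+2)\<^esup>\<close>, the upper bound gives \<open>d \<le> n\<^bsup>1/(k+1)\<^esup> ln n\<close>, thus
  \<open>p \<le> n\<^bsup>-1/2\<^esup> ln n\<close>. The \<open>\<epsilon>\<close> in the upper bound is used for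
  \<open>exp \<lambda> \<le> d n\<^bsup>-\<epsilon>1\<^esup>\<close>, that is, for \<open>1 / d\<close> being
  negligible compared with \<open>exp (-\<lambda>)\<close>.\<close>

lemma threshold_windowI:
  fixes k n r :: nat and p \<delta> \<epsilon> \<epsilon>1 e0 :: real and Q :: "nat set set"
  defines "N \<equiv> real n" and "L \<equiv> ln (real n)" and "d \<equiv> real n * p" and "l \<equiv> p * (real n * p) ^ k" and "\<eta> \<equiv> ln (1 + \<delta>) / 2"
  assumes k: "1 \<le> k" and Q: "Q \<subseteq> vertex_pairs n"
    and p0: "0 < p" and \<delta>: "0 < \<delta>" "\<delta> \<le> 1" and \<delta>_pow: "(1 + \<delta>) ^ (k + 6) \<le> 102 / 100"
    and low: "2 * L \<le> p * d ^ (k + 1)" and up: "l \<le> (1 / (real k + 1) - \<epsilon>) * L"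
    and card: "real (card Q) * d ^ k / N\<^sup>2 \<le> exp l * L / (8 * (real k + 1)\<^sup>2)"
    and \<epsilon>: "0 < \<epsilon>1" "\<epsilon>1 \<le> \<epsilon>" "\<epsilon>1 \<le> 1 / (2 * (real k + 2))"
    and r: "r = nat \<lfloor>N powr (19 / (40 * (real k + 1)))\<rfloor>"
    and e0: "0 < e0" "e0 \<le> \<epsilon>1" "e0 \<le> 1 / (80 * (real k + 1))"
    and L3: "3 \<le> L" and key: "window_const k \<delta> \<eta> * L ^ (2 * k + 5) \<le> N powr e0"
  shows "threshold_window k n r p d l \<delta> \<eta> Q"
proof -
  let ?C = "real (2 * k + 5) ^ (k + 2)" and ?C' = "real (2 * k + 7) ^ (k + 3)" and ?\<alpha> = "1 / (real k + 2)"
  let ?c = "(1 + \<delta>) * ln (1 + \<delta>) - \<delta>" and ?a = "real k + 1"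
  have n: "0 < n"
  proof (rule ccontr)
    assume "\<not> 0 < n"
    then show False using L3 by (simp add: L_def)
  qed
  have N1: "1 < N" "0 < N"
  proof -
    show "0 < N" using n by (simp add: N_def)
    then show "1 < N" using L3 ln_gt_zero_iff[of N] unfolding L_def N_def by linarith
  qed
  have L1: "1 \<le> L" "0 < L" using L3 by auto
  have NL: "exp L = N" using N1 by (simp add: L_def N_def)
  have Npow: "N powr e = exp (e * L)" for e using N1 by (simp add: powr_def L_def N_def)
  have \<eta>0: "0 < \<eta>" using \<delta> by (simp add: \<eta>_def)
  have c0: "0 < ?c"
  proof -
    have "ln (1 / (1 + \<delta>)) < 1 / (1 + \<delta>) - 1"
    proof -
      have "1 / (1 + \<delta>) \<noteq> 1" using \<delta> by simp
      then show ?thesis using ln_le_minus_one[of "1 / (1 + \<delta>)"] ln_eq_minus_one[of "1 / (1 + \<delta>)"] \<delta> by fastforce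
    qed
    then have "- ln (1 + \<delta>) < 1 / (1 + \<delta>) - 1" using \<delta> by (simp add: ln_div)
    then have "(1 + \<delta>) * (- ln (1 + \<delta>)) < (1 + \<delta>) * (1 / (1 + \<delta>) - 1)" using \<delta> by (intro mult_strict_left_mono) auto
    also have "\<dots> = - \<delta>" using \<delta> by (simp add: field_simps)
    finally show ?thesis by simp
  qed
  have use_key: "K * L ^ j \<le> N powr e" if "K \<le> window_const k \<delta> \<eta>" "0 \<le> K" "j \<le> 2 * k + 5" "e0 \<le> e" for K j e
  proof -
    have "K * L ^ j \<le> window_const k \<delta> \<eta> * L ^ (2 * k + 5)"
      using that L1 by (intro mult_mono power_increasing) auto
    also have "\<dots> \<le> N powr e0" by (rule key)
    also have "\<dots> \<le> N powr e" using that N1 by (intro powr_mono) auto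
    finally show ?thesis .
  qed
  have cpos: "2 / \<delta> \<ge> 0" "8 / \<eta> \<ge> 0" "(?C' * (2 ^ (k + 2))\<^sup>2) ^ (k + 1) \<ge> 0" "real k + 2 \<ge> 0"
    "(1 + \<delta>) / \<delta> \<ge> 0" "2 * ?C / \<eta> \<ge> 0" "2 * ?C * (8 / \<eta> + 1)\<^sup>2 \<ge> 0" "9 / ?c \<ge> 0"
    "30 * (8 + 3 * (5 * (3 * real k + 1) * fact (3 * k + 5)) * 32 / \<eta>) \<ge> 0" "400 * exp (2::real) \<ge> 0"
    "4 * real k * (3 + real k) / \<eta> \<ge> 0" "2 * real k + 6 \<ge> 0" "32 / \<delta> \<ge> 0" "2 * (real k + 1) * (real k + 4) \<ge> 0"
    using \<delta> \<eta>0 c0 by auto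
  have cle: "2 / \<delta> \<le> window_const k \<delta> \<eta>" "8 / \<eta> \<le> window_const k \<delta> \<eta>" "(?C' * (2 ^ (k + 2))\<^sup>2) ^ (k + 1) \<le> window_const k \<delta> \<eta>"
    "real k + 2 \<le> window_const k \<delta> \<eta>" "(1 + \<delta>) / \<delta> \<le> window_const k \<delta> \<eta>" "1600 \<le> window_const k \<delta> \<eta>"
    "2 * ?C / \<eta> \<le> window_const k \<delta> \<eta>" "2 * ?C * (8 / \<eta> + 1)\<^sup>2 \<le> window_const k \<delta> \<eta>" "9 / ?c \<le> window_const k \<delta> \<eta>"
    "30 * (8 + 3 * (5 * (3 * real k + 1) * fact (3 * k + 5)) * 32 / \<eta>) \<le> window_const k \<delta> \<eta>" "400 * exp 2 \<le> window_const k \<delta> \<eta>"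
    "4 * real k * (3 + real k) / \<eta> \<le> window_const k \<delta> \<eta>" "2 * real k + 6 \<le> window_const k \<delta> \<eta>" "32 / \<delta> \<le> window_const k \<delta> \<eta>"
    "2 * (real k + 1) * (real k + 4) \<le> window_const k \<delta> \<eta>"
    unfolding window_const_def using cpos by linarith+
  have ex: "e0 \<le> 1 / 2" "e0 \<le> ?\<alpha>" "e0 \<le> ?\<alpha> / 2" "e0 \<le> 1 / (20 * ?a)" "e0 \<le> 1"
  proof -
    have "1 / (2 * (real k + 2)) \<le> 1 / 2" by (simp add: field_simps)
    then show "e0 \<le> 1 / 2" "e0 \<le> 1" using e0 \<epsilon> by linarith+
    have "?\<alpha> / 2 = 1 / (2 * (real k + 2))" by (simp only: divide_divide_eq_left mult.commute)
    moreover have "e0 \<le> 1 / (2 * (real k + 2))" using e0(2) \<epsilon>(3) by (rule order_trans)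
    ultimately show "e0 \<le> ?\<alpha> / 2" by (simp only:)
    moreover have "?\<alpha> / 2 \<le> ?\<alpha>" by (simp add: field_simps)
    ultimately show "e0 \<le> ?\<alpha>" by (rule order_trans)
    have "1 / (80 * ?a) \<le> 1 / (20 * ?a)" by (simp add: field_simps)
    with e0(3) show "e0 \<le> 1 / (20 * ?a)" by (rule order_trans)
  qed
  have d0: "0 < d" using n p0 by (simp add: d_def)
  have l_d: "l = p * d ^ k" by (simp add: l_def d_def)
  have l0: "0 < l" using p0 d0 by (simp add: l_d)
  have dk1: "d ^ (k + 1) = N * l" by (simp add: l_d d_def N_def)
  have l_le: "l \<le> L"
  proof -
    have "1 / ?a - \<epsilon> \<le> 1" using \<epsilon> by (simp add: field_simps)
    then have "(1 / ?a - \<epsilon>) * L \<le> 1 * L" using L1 by (intro mult_right_mono) auto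
    then show ?thesis using up by linarith
  qed
  have d_ge: "N powr ?\<alpha> \<le> d"
  proof (rule ccontr)
    assume "\<not> N powr ?\<alpha> \<le> d"
    then have "d ^ (k + 2) < (N powr ?\<alpha>) ^ (k + 2)" using d0 by (intro power_strict_mono) auto
    also have "\<dots> = N" using N1 by (subst powr_power_eq) (auto simp: add.commute)
    finally have "d ^ (k + 2) < N" .
    moreover have "d ^ (k + 2) = N * (p * d ^ (k + 1))" by (simp add: d_def N_def)
    moreover have "N * 1 \<le> N * (p * d ^ (k + 1))" using low L1 N1 by (intro mult_left_mono) auto
    ultimately show False by linarith
  qed
  have d_le: "d \<le> N powr (1 / ?a) * L"
  proof (rule ccontr)
    assume "\<not> d \<le> N powr (1 / ?a) * L"
    then have "(N powr (1 / ?a) * L) ^ (k + 1) < d ^ (k + 1)" using L1 by (intro power_strict_mono) auto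
    moreover have "(N powr (1 / ?a) * L) ^ (k + 1) = N * L ^ (k + 1)"
      using N1 by (simp only: power_mult_distrib, subst powr_power_eq) (auto simp: add.commute)
    moreover have "N * L \<le> N * L ^ (k + 1)" using N1 self_le_power[OF L1(1), of "k + 1"] by (intro mult_left_mono) auto
    moreover have "N * l \<le> N * L" using N1 l_le by simp
    ultimately show False using dk1 by linarith
  qed
  have el: "exp l \<le> d * N powr (- \<epsilon>1)"
  \<comment> \<open>if \<open>\<lambda> \<ge> 1\<close> then \<open>d \<ge> n\<^bsup>1/(k+1)\<^esup>\<close>, while
    otherwise \<open>exp \<lambda>\<close> is bounded\<close>
  proof (cases "1 \<le> l")
    case True
    have "N powr (1 / ?a) \<le> d"
    proof (rule ccontr)
      assume "\<not> N powr (1 / ?a) \<le> d"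
      then have "d ^ (k + 1) < (N powr (1 / ?a)) ^ (k + 1)" using d0 by (intro power_strict_mono) auto
      also have "\<dots> = N" using N1 by (subst powr_power_eq) (auto simp: add.commute)
      finally have "N * l < N * 1" unfolding dk1 by simp
      then show False using True N1 by simp
    qed
    have "exp l \<le> exp ((1 / ?a - \<epsilon>) * L)" using up by simp
    also have "\<dots> = N powr (1 / ?a) * N powr (- \<epsilon>)" unfolding Npow by (simp add: exp_add[symmetric] algebra_simps)
    also have "\<dots> \<le> d * N powr (- \<epsilon>1)"
      using \<open>N powr (1 / ?a) \<le> d\<close> N1 \<epsilon> d0 by (intro mult_mono powr_mono) auto
    finally show ?thesis .
  next
    case False
    have "exp l \<le> exp 1" using False by simp
    also have "\<dots> \<le> 3" by (rule exp_le)
    also have "\<dots> = 3 * L ^ 0" by simp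
    also have "\<dots> \<le> N powr (?\<alpha> / 2)" by (rule use_key) (use cle ex in auto)
    also have "\<dots> = N powr ?\<alpha> * N powr (- (?\<alpha> / 2))"
    proof -
      have "t + - (t / 2) = t / 2" for t :: real by simp
      then show ?thesis by (simp only: powr_add[symmetric])
    qed
    also have "\<dots> \<le> d * N powr (- \<epsilon>1)"
    proof (intro mult_mono powr_mono le_imp_neg_le d_ge)
      have "?\<alpha> / 2 = 1 / (2 * (real k + 2))" by (simp only: divide_divide_eq_left mult.commute)
      then show "\<epsilon>1 \<le> ?\<alpha> / 2" using \<epsilon>(3) by (simp only:)
    qed (use N1 d0 in auto)
    finally show ?thesis .
  qed
  have el_d: "exp l / d \<le> N powr (- \<epsilon>1)" using el d0 by (simp add: pos_divide_le_eq mult.commute)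
  have inv_e1: "N powr (- \<epsilon>1) * N powr \<epsilon>1 = 1" using N1 by (simp add: powr_add[symmetric])
  have small: "K * L ^ j * N powr (- \<epsilon>1) \<le> 1" if "K \<le> window_const k \<delta> \<eta>" "0 \<le> K" "j \<le> 2 * k + 5" for K j
  proof -
    have "K * L ^ j * N powr (- \<epsilon>1) \<le> N powr \<epsilon>1 * N powr (- \<epsilon>1)"
      using use_key[OF that, of \<epsilon>1] e0 by (intro mult_right_mono) auto
    then show ?thesis using inv_e1 by (simp add: mult.commute)
  qed
  have p_le: "p \<le> L * N powr (- (1 / 2))"
  proof -
    have "p = d / N" using n by (simp add: d_def N_def)
    also have "\<dots> \<le> N powr (1 / ?a) * L / N" using d_le N1 by (intro divide_right_mono) auto
    also have "\<dots> = L * N powr (1 / ?a - 1)" using N1 by (simp add: powr_diff)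
    also have "\<dots> \<le> L * N powr (- (1 / 2))"
    proof (intro mult_left_mono powr_mono)
      have "1 / ?a \<le> 1 / 2" using k by (intro divide_left_mono) auto
      moreover have "t - 1 \<le> - (1 / 2)" if "t \<le> 1 / 2" for t :: real using that by simp
      ultimately show "1 / ?a - 1 \<le> - (1 / 2)" by blast
    qed (use N1 L1 in auto)
    finally show ?thesis .
  qed
  have small_p: "K * L ^ j * p \<le> 1" if K: "K \<le> window_const k \<delta> \<eta>" "0 \<le> K" "Suc j \<le> 2 * k + 5" for K j
  proof -
    have "K * L ^ j * p \<le> K * L ^ j * (L * N powr (- (1 / 2)))" using p_le K L1 by (intro mult_left_mono) auto
    also have "\<dots> = K * L ^ Suc j * N powr (- (1 / 2))" by simp
    also have "\<dots> \<le> N powr (1 / 2) * N powr (- (1 / 2))"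
      using use_key[OF K, of "1 / 2"] ex by (intro mult_right_mono) auto
    also have "\<dots> = 1" using N1 by (simp add: powr_add[symmetric])
    finally show ?thesis .
  qed
  have big_d: "K * L ^ j \<le> d" if K: "K \<le> window_const k \<delta> \<eta>" "0 \<le> K" "j \<le> 2 * k + 5" for K j
    using use_key[OF K, of ?\<alpha>] ex d_ge by linarith
  have half: "N powr (1 / 2) * N powr (1 / 2) = N" using N1 by (simp add: powr_add[symmetric])
  have big_half: "K * L ^ j * N powr (1 / 2) \<le> N" if K: "K \<le> window_const k \<delta> \<eta>" "0 \<le> K" "j \<le> 2 * k + 5" for K j
  proof -
    have "K * L ^ j * N powr (1 / 2) \<le> N powr (1 / 2) * N powr (1 / 2)"
      using use_key[OF K, of "1 / 2"] ex by (intro mult_right_mono) auto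
    then show ?thesis using half by simp
  qed
  have half1: "1 \<le> N powr (1 / 2)" using N1 by (intro ge_one_powr_ge_zero) auto
  let ?\<beta> = "19 / (40 * ?a)"
  have r_le: "real r \<le> N powr ?\<beta>" "N powr ?\<beta> - 1 \<le> real r"
    unfolding r using powr_ge_zero[of N ?\<beta>] by linarith+
  have r_half: "real r \<le> N powr (1 / 2)"
  proof -
    have "?\<beta> \<le> 1 / 2" using k by (simp add: field_simps)
    then have "N powr ?\<beta> \<le> N powr (1 / 2)" using N1 by (intro powr_mono) auto
    then show ?thesis using r_le by linarith
  qed
  have exp8: "exp (- 8 :: real) \<le> 1 / 200"
  proof -
    have "(2::real) ^ 8 \<le> exp 1 ^ 8" using exp_ge_add_one_self[of 1] by (intro power_mono) auto
    also have "exp 1 ^ 8 = exp (8::real)" by (simp add: exp_of_nat_mult[symmetric])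
    finally have "inverse (exp 8) \<le> inverse (256 :: real)" by (intro le_imp_inverse_le) auto
    then show ?thesis by (simp add: exp_minus)
  qed
  have q_le: "real (card Q) \<le> N\<^sup>2 * (L * N powr (- \<epsilon>1))"
  proof -
    have dk: "0 < d ^ k" "d \<le> d ^ k"
    proof -
      have "4 * L ^ 0 \<le> d" by (rule big_d) (use cle in auto)
      then show "d \<le> d ^ k" using k by (intro self_le_power) auto
      show "0 < d ^ k" using d0 by simp
    qed
    have "1 \<le> 8 * (real k + 1)\<^sup>2" by (simp add: power2_eq_square algebra_simps)
    then have "exp l * L / (8 * (real k + 1)\<^sup>2) \<le> exp l * L / 1" using L1 by (intro divide_left_mono) auto
    then have "real (card Q) * d ^ k / N\<^sup>2 \<le> exp l * L" using card by simp
    then have "real (card Q) * d ^ k \<le> exp l * L * N\<^sup>2" using N1 by (simp add: pos_divide_le_eq)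
    moreover have "real (card Q) * d \<le> real (card Q) * d ^ k" using dk by (intro mult_left_mono) auto
    ultimately have "real (card Q) * d \<le> exp l * L * N\<^sup>2" by linarith
    then have "real (card Q) \<le> exp l * L * N\<^sup>2 / d" using d0 by (simp add: pos_le_divide_eq)
    also have "\<dots> = N\<^sup>2 * (L * (exp l / d))" by simp
    also have "\<dots> \<le> N\<^sup>2 * (L * N powr (- \<epsilon>1))" using el_d L1 by (intro mult_left_mono) auto
    finally show ?thesis .
  qed
  show ?thesis
  proof unfold_locales
    show "1 \<le> k" "0 < n" "Q \<subseteq> vertex_pairs n" "0 < p" "0 < \<delta>" "\<delta> \<le> 1" "(1 + \<delta>) ^ (k + 6) \<le> 102 / 100"
      by fact+
    show "\<eta> = ln (1 + \<delta>) / 2" "d = real n * p" "l = p * d ^ k" by (simp_all add: \<eta>_def d_def l_def)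
    show "l \<le> ln (real n)" using l_le by (simp add: L_def)
    show "1 \<le> ln (real n)" using L1 by (simp add: L_def)
    show "p \<le> \<delta> / 2"
      using small_p[OF cle(1) cpos(1), of 0] \<delta> by (simp add: field_simps)
    show "1 + \<delta> \<le> \<delta> * d"
      using big_d[OF cle(5) cpos(5), of 0] \<delta> by (simp add: field_simps)
    show "4 \<le> d" using big_d[of 4 0] cle(6) by simp
    show "1 \<le> \<delta> * exp (- l) * d"
    proof -
      have "2 / \<delta> * N powr (- \<epsilon>1) \<le> 1" using small[OF cle(1) cpos(1), of 0] by simp
      then have "N powr (- \<epsilon>1) \<le> \<delta>" using \<delta> by (simp add: field_simps)
      then have "exp l / d \<le> \<delta>" using el_d by linarith
      then show ?thesis using d0 by (simp add: exp_minus field_simps)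
    qed
    show "real (card Q) * d ^ k / (real n)\<^sup>2 \<le> exp l * ln (real n) / (8 * (real k + 1)\<^sup>2)"
      using card by (simp add: N_def L_def)
    show "l * (real k * real (2 * r + 1 + k)) \<le> \<eta> / 4 * real n"
    proof -
      have "real (2 * r + 1 + k) \<le> 2 * N powr (1 / 2) + (1 + real k) * N powr (1 / 2)"
      proof -
        have "1 + real k \<le> (1 + real k) * N powr (1 / 2)"
          using mult_left_mono[OF half1, of "1 + real k"] by simp
        moreover have "2 * a + 1 + b \<le> 2 * x + y" if "a \<le> x" "1 + b \<le> y" for a b x y :: real using that by linarith
        ultimately show ?thesis using r_half by (simp only: of_nat_add of_nat_mult of_nat_numeral of_nat_1)
      qed
      also have "\<dots> = (3 + real k) * N powr (1 / 2)" by (simp add: algebra_simps)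
      finally have up: "l * (real k * real (2 * r + 1 + k)) \<le> L * (real k * ((3 + real k) * N powr (1 / 2)))"
        using l_le l0 L1 by (intro mult_mono) auto
      have "4 * real k * (3 + real k) / \<eta> * L ^ 1 * N powr (1 / 2) \<le> N"
        by (rule big_half[OF cle(12) cpos(11)]) simp
      moreover have "4 * a * b / e * l ^ 1 * x = 4 * (l * (a * (b * x))) / e" for a b e l x :: real by simp
      ultimately have "4 * (L * (real k * ((3 + real k) * N powr (1 / 2)))) / \<eta> \<le> N" by (simp only:)
      then have "4 * (L * (real k * ((3 + real k) * N powr (1 / 2)))) \<le> N * \<eta>"
        using \<eta>0 by (simp only: pos_divide_le_eq)
      then have "l * (real k * real (2 * r + 1 + k)) * 4 \<le> N * \<eta>" using up by linarith
      moreover have "x \<le> e / 4 * m" if "x * 4 \<le> m * e" for x e m :: real using that by (simp add: mult.commute)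
      ultimately show ?thesis unfolding N_def by blast
    qed
    show "4 * r + 2 * k + 2 \<le> n"
    proof -
      have "real (4 * r + 2 * k + 2) \<le> 4 * N powr (1 / 2) + (2 * real k + 2) * N powr (1 / 2)"
      proof -
        have "2 * real k + 2 \<le> (2 * real k + 2) * N powr (1 / 2)"
          using mult_left_mono[OF half1, of "2 * real k + 2"] by simp
        moreover have "4 * a + 2 * b + 2 \<le> 4 * x + y" if "a \<le> x" "2 * b + 2 \<le> y" for a b x y :: real
          using that by linarith
        ultimately show ?thesis using r_half by (simp only: of_nat_add of_nat_mult of_nat_numeral of_nat_1)
      qed
      also have "\<dots> = (2 * real k + 6) * L ^ 0 * N powr (1 / 2)" by (simp add: algebra_simps)
      also have "\<dots> \<le> N" by (rule big_half[OF cle(13) cpos(12)]) simp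
      finally show ?thesis by (simp only: N_def of_nat_le_iff)
    qed
    show "real (2 * r) * real (2 * r) * ((1 + \<delta>) * d ^ k / real n) \<le> 1 / 200"
    proof -
      have "d ^ k \<le> (N powr (1 / ?a) * L) ^ k" using d_le d0 by (intro power_mono) auto
      also have "\<dots> = N powr (real k / ?a) * L ^ k" using N1 by (simp add: power_mult_distrib powr_power_eq)
      finally have dk: "d ^ k / N \<le> N powr (real k / ?a) * L ^ k / N" using N1 by (intro divide_right_mono) auto
      also have "\<dots> = L ^ k * N powr (real k / ?a - 1)" using N1 by (simp add: powr_diff)
      also have "real k / ?a - 1 = - (1 / ?a)" by (simp add: field_simps)
      finally have dk: "d ^ k / N \<le> L ^ k * N powr (- (1 / ?a))" .
      have "real (2 * r) * real (2 * r) * ((1 + \<delta>) * d ^ k / real n) = 4 * (real r * real r) * ((1 + \<delta>) * (d ^ k / N))"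
        by (simp add: N_def)
      also have "\<dots> \<le> 4 * (N powr ?\<beta> * N powr ?\<beta>) * (2 * (L ^ k * N powr (- (1 / ?a))))"
        using r_le dk \<delta> d0 N1 L1 by (intro mult_mono) auto
      also have "\<dots> = 8 * L ^ k * N powr (?\<beta> + ?\<beta> + - (1 / ?a))"
      proof -
        have "4 * (x * x) * (2 * (l * y)) = 8 * l * (x * x * y)" for l x y :: real by algebra
        then show ?thesis by (simp only: powr_add)
      qed
      also have "?\<beta> + ?\<beta> + - (1 / ?a) = - (1 / (20 * ?a))"
      proof -
        have sum_eq: "19 / (40 * a) + 19 / (40 * a) + - (1 / a) = - (1 / (20 * a))" if "a \<noteq> 0" for a :: real
          using that by (simp add: field_simps)
        show ?thesis by (rule sum_eq) simp
      qed
      finally have "real (2 * r) * real (2 * r) * ((1 + \<delta>) * d ^ k / real n) \<le> 8 * L ^ k * N powr (- (1 / (20 * ?a)))" .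
      moreover have "1600 * L ^ k * N powr (- (1 / (20 * ?a))) \<le> N powr (1 / (20 * ?a)) * N powr (- (1 / (20 * ?a)))"
        using use_key[OF cle(6), of k "1 / (20 * ?a)"] ex by (intro mult_right_mono) auto
      moreover have "N powr (1 / (20 * ?a)) * N powr (- (1 / (20 * ?a))) = 1" using N1 by (simp add: powr_add[symmetric])
      ultimately show ?thesis by linarith
    qed
    show "real (2 * r) + (1 + \<delta>) * (2 * real (card Q) / real n) < \<delta> / (1 + \<delta>) * real n"
    proof -
      have b: "32 / \<delta> * L ^ 0 * N powr (1 / 2) \<le> N" by (rule big_half[OF cle(14) cpos(13)]) simp
      then have 1: "32 * N powr (1 / 2) \<le> N * \<delta>" using \<delta> by (simp add: pos_divide_le_eq)
      have "32 / \<delta> * L ^ 1 * N powr (- \<epsilon>1) \<le> 1" by (rule small[OF cle(14) cpos(13)]) simp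
      then have "32 * (L * N powr (- \<epsilon>1)) \<le> \<delta>" using \<delta> by (simp add: pos_divide_le_eq)
      then have 2: "N * (32 * (L * N powr (- \<epsilon>1))) \<le> N * \<delta>" using N1 by (intro mult_left_mono) auto
      have "(1 + \<delta>) * (2 * real (card Q) / real n) \<le> 2 * (2 * (N\<^sup>2 * (L * N powr (- \<epsilon>1))) / N)"
      proof (rule mult_mono)
        show "2 * real (card Q) / real n \<le> 2 * (N\<^sup>2 * (L * N powr (- \<epsilon>1))) / N"
          unfolding N_def[symmetric] using N1 q_le by (intro divide_right_mono) auto
      qed (use \<delta> in auto)
      also have "\<dots> = N * (4 * (L * N powr (- \<epsilon>1)))" using N1 by (simp add: power2_eq_square)
      finally have "(1 + \<delta>) * (2 * real (card Q) / real n) \<le> N * \<delta> / 8" using 2 by linarith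
      moreover have "real (2 * r) \<le> N * \<delta> / 16" using r_half 1 by simp
      moreover have "0 < N * \<delta>" using N1 \<delta> by simp
      moreover have "N * \<delta> / 2 \<le> \<delta> / (1 + \<delta>) * real n"
      proof -
        have "N * \<delta> / 2 \<le> N * \<delta> / (1 + \<delta>)" using \<delta> N1 by (intro divide_left_mono) auto
        then show ?thesis by (simp add: N_def mult.commute)
      qed
      ultimately show ?thesis by linarith
    qed
    show "exp (- (1 / 12 * exp (- (37 / (80 * (real k + 1)) * ln (real n))) * real r / 2)) \<le> 1 / 200"
    proof -
      let ?e = "1 / (80 * ?a)"
      have E: "exp (- (37 / (80 * (real k + 1)) * ln (real n))) = N powr (- (37 / (80 * ?a)))" unfolding Npow L_def by simp
      have "N powr ?e - 1 \<le> N powr (- (37 / (80 * ?a))) * real r"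
      proof -
        have "N powr (- (37 / (80 * ?a))) * (N powr ?\<beta> - 1) \<le> N powr (- (37 / (80 * ?a))) * real r"
          using r_le by (intro mult_left_mono) auto
        moreover have "N powr (- (37 / (80 * ?a))) * N powr ?\<beta> = N powr ?e"
          unfolding powr_add[symmetric] by (rule arg_cong[where f = "\<lambda>t. N powr t"]) (simp add: field_simps)
        moreover have "N powr (- (37 / (80 * ?a))) \<le> N powr 0" using N1 by (intro powr_mono) auto
        ultimately show ?thesis using N1 by (simp add: right_diff_distrib)
      qed
      moreover have "1600 * L ^ 0 \<le> N powr ?e" by (rule use_key[OF cle(6)]) (use e0 in auto)
      ultimately have "8 \<le> 1 / 12 * N powr (- (37 / (80 * ?a))) * real r / 2" by simp
      then have "exp (- (1 / 12 * N powr (- (37 / (80 * ?a))) * real r / 2)) \<le> exp (- 8)" by simp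
      then show ?thesis unfolding E using exp8 by linarith
    qed
    show "2 * p * l \<le> \<eta> / 4"
    proof -
      have "8 / \<eta> * L ^ 1 * p \<le> 1" by (rule small_p[OF cle(2) cpos(2)]) simp
      then have "8 * (p * L) \<le> \<eta>" using \<eta>0 by (simp add: pos_divide_le_eq ac_simps)
      moreover have "p * l \<le> p * L" using l_le p0 by simp
      ultimately show ?thesis by linarith
    qed
    show "2 * (?C * l\<^sup>2) \<le> \<eta> * d"
    proof -
      have "2 * ?C / \<eta> * L ^ 2 \<le> d" by (rule big_d[OF cle(7) cpos(6)]) simp
      then have "2 * (?C * L\<^sup>2) \<le> \<eta> * d" using \<eta>0 by (simp add: pos_divide_le_eq ac_simps)
      moreover have "2 * (?C * l\<^sup>2) \<le> 2 * (?C * L\<^sup>2)" using l_le l0 by (intro mult_left_mono power_mono) auto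
      ultimately show ?thesis by linarith
    qed
    show "2 * (?C * ((8 * ln (real n) / \<eta> + 1) * l)\<^sup>2) \<le> d"
    proof -
      have "(8 * ln (real n) / \<eta> + 1) * l \<le> ((8 / \<eta> + 1) * L) * L"
      proof (rule mult_mono)
        show "8 * ln (real n) / \<eta> + 1 \<le> (8 / \<eta> + 1) * L" using L1 by (simp add: L_def algebra_simps)
      qed (use l_le l0 L1 \<eta>0 in auto)
      then have "2 * (?C * ((8 * ln (real n) / \<eta> + 1) * l)\<^sup>2) \<le> 2 * (?C * (((8 / \<eta> + 1) * L) * L)\<^sup>2)"
        using l0 L1 \<eta>0 by (intro mult_left_mono power_mono) (auto simp: L_def)
      also have "\<dots> = 2 * ?C * (8 / \<eta> + 1)\<^sup>2 * L ^ 4" by (simp only: power_mult_distrib power2_eq_square power4_eq_xxxx ac_simps)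
      also have "\<dots> \<le> d" by (rule big_d[OF cle(8) cpos(7)]) (use k in simp)
      finally show ?thesis .
    qed
    show "real n * exp (- d * ?c) \<le> 1 / 200"
    proof -
      have "9 / ?c * L ^ 1 \<le> d" by (rule big_d[OF cle(9) cpos(8)]) simp
      then have "9 * L \<le> d * ?c" using c0 by (simp add: pos_divide_le_eq)
      then have "exp (- d * ?c) \<le> exp (- 8 - L)" using L1 by simp
      then have "real n * exp (- d * ?c) \<le> N * exp (- 8 - L)" using N1 unfolding N_def by (intro mult_left_mono) auto
      also have "\<dots> = exp (- 8)" using NL by (simp add: exp_diff N_def) (use n in simp)
      also have "\<dots> \<le> 1 / 200" by (rule exp8)
      finally show ?thesis .
    qed
    show "8 * (exp l * ln (real n)) / d
       + 3 * (5 * (3 * real k + 1) * fact (3 * k + 5)) * (32 * (exp l * (ln (real n)) ^ 3)) / (\<eta> * d) \<le> 1 / 30"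
    proof -
      let ?B = "3 * (5 * (3 * real k + 1) * fact (3 * k + 5))"
      have "8 * (exp l * L) / d + ?B * (32 * (exp l * L ^ 3)) / (\<eta> * d)
         = (8 * L + ?B * 32 / \<eta> * L ^ 3) * (exp l / d)" using d0 \<eta>0 by (simp add: field_simps)
      also have "\<dots> \<le> (8 * L ^ 3 + ?B * 32 / \<eta> * L ^ 3) * N powr (- \<epsilon>1)"
        using el_d d0 L1 \<eta>0 self_le_power[OF L1(1), of 3] by (intro mult_mono add_right_mono) auto
      also have "\<dots> = (30 * (8 + ?B * 32 / \<eta>)) * L ^ 3 * N powr (- \<epsilon>1) / 30" by (simp add: algebra_simps)
      also have "\<dots> \<le> 1 / 30" using small[OF cle(10) cpos(9), of 3] by (intro divide_right_mono) auto
      finally show ?thesis by (simp only: L_def)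
    qed
    show "real n * exp (1 - 4 * ln (real n)) \<le> 1 / 200"
    proof -
      have "real n * exp (1 - 4 * ln (real n)) = exp L * exp (1 - 4 * L)" unfolding NL by (simp add: N_def L_def)
      also have "\<dots> = exp (1 - 3 * L)" by (simp add: exp_add[symmetric])
      also have "\<dots> \<le> exp (- 8)" using L3 by simp
      finally show ?thesis using exp8 by linarith
    qed
    show "2 * ln (real n) \<le> p * d ^ (k + 1)" using low by (simp only: L_def)
    show "(real k + 1) * (real k + 4) * (2 * ln (real n)) \<le> real n"
    proof -
      have "2 * a * b * l ^ 1 = a * b * (2 * l)" for a b l :: real by simp
      moreover have "2 * (real k + 1) * (real k + 4) * L ^ 1 \<le> N powr 1"
        by (rule use_key[OF cle(15) cpos(14)]) (use ex in auto)
      ultimately have "(real k + 1) * (real k + 4) * (2 * L) \<le> N powr 1" by (simp only:)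
      then show ?thesis using N1 by (simp only: L_def N_def powr_one)
    qed
    show "k + 4 \<le> n"
    proof -
      have "real k + 4 \<le> 2 * real k + 6" by simp
      also have "\<dots> = (2 * real k + 6) * L ^ 0" by simp
      also have "\<dots> \<le> N powr 1" by (rule use_key[OF cle(13) cpos(12)]) (use ex in auto)
      finally have "real (k + 4) \<le> real n" using N1 by (simp add: N_def)
      then show ?thesis by (simp only: of_nat_le_iff)
    qed
    show "p * (?C' * (2 ^ (k + 2) * ln (real n))\<^sup>2) ^ (k + 1) \<le> 1"
    proof -
      have eq: "(c * (a * l)\<^sup>2) ^ m = (c * a\<^sup>2) ^ m * l ^ (2 * m)" for c a l :: real and m
        by (simp only: power_mult_distrib power_mult mult.assoc)
      have "(?C' * (2 ^ (k + 2))\<^sup>2) ^ (k + 1) * L ^ (2 * (k + 1)) * p \<le> 1"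
        by (rule small_p[OF cle(3) cpos(3)]) simp
      then show ?thesis unfolding eq L_def by (simp only: mult.commute[of p])
    qed
    show "p * (real k + 2) \<le> 1"
    proof -
      have "(real k + 2) * L ^ 0 * p \<le> 1" by (rule small_p[OF cle(4) cpos(4)]) simp
      then show ?thesis by (simp only: power_0 mult_1_right mult.commute)
    qed
    show "2 * real (card Q) * exp (2 - 2 * ln (real n)) \<le> 1 / 200"
    proof -
      have E: "exp (2 - 2 * ln (real n)) = exp 2 / N\<^sup>2"
      proof -
        have "exp (2 * L) = N\<^sup>2" by (simp only: mult_2 exp_add NL power2_eq_square)
        then show ?thesis by (simp add: exp_diff L_def)
      qed
      have "2 * real (card Q) * exp (2 - 2 * ln (real n)) \<le> 2 * (N\<^sup>2 * (L * N powr (- \<epsilon>1))) * (exp 2 / N\<^sup>2)"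
        unfolding E using q_le by (intro mult_right_mono mult_left_mono) auto
      also have "\<dots> = (400 * exp 2) * L ^ 1 * N powr (- \<epsilon>1) / 200" using N1 by simp
      also have "\<dots> \<le> 1 / 200" by (rule divide_right_mono[OF small[OF cle(11) cpos(10)]]) auto
      finally show ?thesis .
    qed
  qed
qed

text \<open>Each of the \<open>m\<close> logarithms is compared with its own power of exponent \<open>e / (2 (m +
  1))\<close>, and \<open>K\<close> with the remaining power of exponent \<open>e / 2\<close>.\<close>

lemma eventually_log_power_le_powr:
  fixes e K :: real and m :: nat
  assumes "0 < e"
  shows "\<forall>\<^sub>F n in sequentially. K * ln (real n) ^ m \<le> real n powr e"
proof -
  let ?g = "\<lambda>x :: real. x powr (e / (2 * real (Suc m)))"
  have "eventually (\<lambda>x :: real. ln x \<le> ?g x) at_top"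
    using assms by real_asymp
  moreover have "eventually (\<lambda>x :: real. \<bar>K\<bar> \<le> x powr (e / 2)) at_top"
    using assms by real_asymp
  ultimately have "eventually (\<lambda>x :: real. K * ln x ^ m \<le> x powr e) at_top"
    using eventually_ge_at_top[of 1]
  proof eventually_elim
    case (elim x)
    have "K * ln x ^ m \<le> \<bar>K\<bar> * ln x ^ m" using elim by (intro mult_right_mono) auto
    also have "\<dots> \<le> x powr (e / 2) * ?g x ^ m" using elim by (intro mult_mono power_mono) auto
    also have "?g x ^ m \<le> ?g x ^ Suc m"
      using elim assms by (intro power_increasing ge_one_powr_ge_zero) auto
    also have "?g x ^ Suc m = x powr (e / 2)"
    proof -
      have e2: "e / (2 * real (Suc m)) * real (Suc m) = e / 2" by (simp del: of_nat_Suc)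
      have "?g x ^ Suc m = x powr (e / (2 * real (Suc m)) * real (Suc m))"
        by (rule powr_power_eq) (use elim in simp)
      then show ?thesis by (simp only: e2)
    qed
    also have "x powr (e / 2) * x powr (e / 2) = x powr e" by (simp add: powr_add[symmetric])
    finally show ?case by (simp add: mult_left_mono)
  qed
  then show ?thesis by (rule eventually_compose_filterlim[OF _ filterlim_real_sequentially])
qed

theorem theorem4:
  fixes k :: nat and \<epsilon> :: real and p \<omega> :: "nat \<Rightarrow> real"
  assumes "k \<ge> 1"
    and "\<epsilon> > 0"
    and "filterlim \<omega> at_top sequentially"
    and "\<forall>\<^sub>F n in sequentially.
           p n = root (k + 2) ((2 * ln (real n) + \<omega> n) / real n ^ (k + 1))"
    and "\<forall>\<^sub>F n in sequentially.
           p n < root (k + 1) ((1 / (real k + 1) - \<epsilon>) * (ln (real n) / real n ^ k))"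
  shows "\<not> (\<exists>Q :: nat \<Rightarrow> nat set set.
           (\<forall>n. Q n \<subseteq> vertex_pairs n) \<and>
           (\<forall>\<^sub>F n in sequentially.
              real (card (Q n)) \<le>
                1 / (8 * (real k + 1)\<^sup>2 * (real n powi (int k - 2)) * p n ^ k)
                  * exp (real n ^ k * p n ^ (k + 1)) * ln (real n)) \<and>
           (\<lambda>n. measure_pmf.prob (binomial_random_graph n (p n))
                  {G. reconstructible n (Q n) G}) \<longlonglongrightarrow> 1)"
proof
  assume "\<exists>Q :: nat \<Rightarrow> nat set set.
           (\<forall>n. Q n \<subseteq> vertex_pairs n) \<and>
           (\<forall>\<^sub>F n in sequentially.
              real (card (Q n)) \<le>
                1 / (8 * (real k + 1)\<^sup>2 * (real n powi (int k - 2)) * p n ^ k)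
                  * exp (real n ^ k * p n ^ (k + 1)) * ln (real n)) \<and>
           (\<lambda>n. measure_pmf.prob (binomial_random_graph n (p n))
                  {G. reconstructible n (Q n) G}) \<longlonglongrightarrow> 1"
  then obtain Q :: "nat \<Rightarrow> nat set set" where Q: "\<And>n. Q n \<subseteq> vertex_pairs n"
    and Qcard: "\<forall>\<^sub>F n in sequentially. real (card (Q n)) \<le>
                1 / (8 * (real k + 1)\<^sup>2 * (real n powi (int k - 2)) * p n ^ k)
                  * exp (real n ^ k * p n ^ (k + 1)) * ln (real n)"
    and lim: "(\<lambda>n. measure_pmf.prob (binomial_random_graph n (p n)) {G. reconstructible n (Q n) G}) \<longlonglongrightarrow> 1"
    by blast
  \<comment> \<open>so small that \<open>(1 + \<delta>)\<^bsup>k+6\<^esup> \<le> exp (1/100)\<close>\<close>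
  define \<delta> :: real where "\<delta> = 1 / (100 * (real k + 6))"
  have \<delta>: "0 < \<delta>" "\<delta> \<le> 1" by (auto simp: \<delta>_def field_simps)
  have \<delta>_pow: "(1 + \<delta>) ^ (k + 6) \<le> 102 / 100"
  proof -
    have "(1 + \<delta>) ^ (k + 6) \<le> exp \<delta> ^ (k + 6)" using \<delta> by (intro power_mono) auto
    also have "\<dots> = exp (1 / 100)" by (simp add: exp_of_nat_mult[symmetric] \<delta>_def)
    also have "\<dots> \<le> 1 + 1 / 100 + (1 / 100)\<^sup>2" by (rule exp_bound) auto
    finally show ?thesis by (simp add: power2_eq_square)
  qed
  define \<eta> where "\<eta> = ln (1 + \<delta>) / 2"
  define \<epsilon>1 where "\<epsilon>1 = min \<epsilon> (1 / (2 * (real k + 2)))"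
  define e0 where "e0 = min \<epsilon>1 (1 / (80 * (real k + 1)))"
  have eps: "0 < \<epsilon>1" "\<epsilon>1 \<le> \<epsilon>" "\<epsilon>1 \<le> 1 / (2 * (real k + 2))" "0 < e0" "e0 \<le> \<epsilon>1" "e0 \<le> 1 / (80 * (real k + 1))"
    using assms(2) by (auto simp: \<epsilon>1_def e0_def)
  have ln3: "\<forall>\<^sub>F n in sequentially. 3 \<le> ln (real n)" by real_asymp
  have \<omega>0: "\<forall>\<^sub>F n in sequentially. 0 \<le> \<omega> n" using assms(3) by (simp add: filterlim_at_top)
  have "\<forall>\<^sub>F n in sequentially. measure_pmf.prob (binomial_random_graph n (p n)) {G. reconstructible n (Q n) G} \<le> 39 / 40"
    using assms(4,5) Qcard ln3 \<omega>0 eventually_log_power_le_powr[OF eps(4), of "window_const k \<delta> \<eta>" "2 * k + 5"]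
  proof eventually_elim
    case (elim n)
    let ?d = "real n * p n" and ?l = "p n * (real n * p n) ^ k"
    have n: "0 < n"
    proof (rule ccontr)
      assume "\<not> 0 < n"
      then show False using elim(4) by simp
    qed
    let ?X = "(2 * ln (real n) + \<omega> n) / real n ^ (k + 1)"
    have X: "0 < ?X" using elim(4,5) n by simp
    have p0: "0 < p n" unfolding elim(1) using X by (intro real_root_gt_zero) auto
    have pX: "p n ^ (k + 2) = ?X" unfolding elim(1) using X by (intro real_root_pow_pos2) auto
    have low: "2 * ln (real n) \<le> p n * ?d ^ (k + 1)"
    proof -
      have "p n * ?d ^ (k + 1) = p n ^ (k + 2) * real n ^ (k + 1)" by (simp add: power_mult_distrib)
      also have "\<dots> = 2 * ln (real n) + \<omega> n" unfolding pX using n by simp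
      finally show ?thesis using elim(5) by simp
    qed
    have l_eq: "?l = real n ^ k * p n ^ (k + 1)" by (simp add: power_mult_distrib)
    let ?Y = "(1 / (real k + 1) - \<epsilon>) * (ln (real n) / real n ^ k)"
    have Y: "0 < ?Y"
    proof (rule ccontr)
      assume "\<not> 0 < ?Y"
      then have "root (k + 1) ?Y \<le> 0" by (simp add: not_less)
      then show False using elim(2) p0 by linarith
    qed
    have "p n ^ (k + 1) < root (k + 1) ?Y ^ (k + 1)"
      using elim(2) p0 by (intro power_strict_mono) auto
    also have "\<dots> = ?Y" using Y by (intro real_root_pow_pos2) auto
    finally have "real n ^ k * p n ^ (k + 1) < real n ^ k * ?Y" using n by (intro mult_strict_left_mono) auto
    also have "\<dots> = (1 / (real k + 1) - \<epsilon>) * ln (real n)" using n by simp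
    finally have up: "?l \<le> (1 / (real k + 1) - \<epsilon>) * ln (real n)" unfolding l_eq by simp
    have card: "real (card (Q n)) * ?d ^ k / (real n)\<^sup>2 \<le> exp ?l * ln (real n) / (8 * (real k + 1)\<^sup>2)"
    proof -
      have powi: "real n powi (int k - 2) = real n ^ k / (real n)\<^sup>2"
        using n by (simp add: power_int_diff)
      have "real (card (Q n)) * (?d ^ k / (real n)\<^sup>2) \<le> 1 / (8 * (real k + 1)\<^sup>2 * (real n powi (int k - 2)) * p n ^ k)
                  * exp (real n ^ k * p n ^ (k + 1)) * ln (real n) * (?d ^ k / (real n)\<^sup>2)"
        using elim(3) p0 by (intro mult_right_mono) auto
      also have "\<dots> = exp ?l * ln (real n) / (8 * (real k + 1)\<^sup>2)"
      proof -
        have "1 / (A * (N / M) * P) * E * Lg * ((N * P) / M) = E * Lg / A" if "A \<noteq> 0" "N \<noteq> 0" "M \<noteq> 0" "P \<noteq> 0" for A N M P E Lg :: real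
          using that by (simp add: field_simps)
        from this[of "8 * (real k + 1)\<^sup>2" "real n ^ k" "(real n)\<^sup>2" "p n ^ k" "exp ?l" "ln (real n)"]
        show ?thesis unfolding powi l_eq[symmetric] power_mult_distrib[of "real n" "p n" k, symmetric]
          using n p0 by (simp add: power_mult_distrib)
      qed
      finally show ?thesis by simp
    qed
    interpret threshold_window k n "nat \<lfloor>real n powr (19 / (40 * (real k + 1)))\<rfloor>" "p n" ?d ?l \<delta> \<eta> "Q n"
      unfolding \<eta>_def
      by (rule threshold_windowI[OF assms(1) Q p0 \<delta> \<delta>_pow low up card eps(1-3) refl eps(4-6) elim(4)])
         (use elim(6) in \<open>simp add: \<eta>_def\<close>)
    show ?case
      using prob_reconstructible_bound prob_binomial_random_graph[OF p1(2,3), of n "reconstructible n (Q n)"] by simp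
  qed
  then have "(1::real) \<le> 39 / 40" by (rule tendsto_upperbound[OF lim]) simp
  then show False by simp
qed

end
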